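(* Let $k$ be a commutative ring and $H$ a $k$-prebialgebra. If any of (rm) and (rc) holds, then $H_s$ and $H_t$, and also $H_s^*$ and $H_t^*$, carry $k$-coalgebra structures. If any of (lm) and (lc) holds, then $\overline{H}_s$ and $\overline{H}_t$, and also $\overline{H}_s^*$ and $\overline{H}_t^*$, carry $k$-coalgebra structures. The comultiplication maps are given by the following formulas, for $y$ in $H_s$ (resp. $\overline{H}_s$), $z$ in $H_t$ (resp. $\overline{H}_t$), $\psi$ in $H_s^*$ (resp. $\overline{H}_s^*$) and $\varphi$ in $H_t^*$ (resp. $\overline{H}_t^*$): $$\Delta_s(y)=\varepsilon_s(1_{(1)})\otimes\varepsilon_s(y1_{(2)}),\qquad \Delta_s^*(\psi)=\varepsilon_s^*(g'(1_{(1)}))\otimes\varepsilon_s^*(\psi\, g(1_{(2)})),$$ $$\Delta_t(z)=\varepsilon_t(1_{(1)}z)\otimes\varepsilon_t(1_{(2)}),\qquad \Delta_t^*(\varphi)=\varepsilon_t^*(g'(1_{(1)})\varphi)\otimes\varepsilon_t^*(g(1_{(2)})),$$ $$\overline{\Delta}_s(y)=\overline{\varepsilon}_s(1_{(1)})\otimes\overline{\varepsilon}_s(1_{(2)}y),\qquad \overline{\Delta}_s^*(\psi)=\overline{\varepsilon}_s^*(g'(1_{(2)}))\otimes\overline{\varepsilon}_s^*(g(1_{(1)})\psi),$$ $$\overline{\Delta}_t(z)=\overline{\varepsilon}_t(z1_{(1)})\otimes\overline{\varepsilon}_t(1_{(2)}),\qquad \overline{\Delta}_t^*(\varphi)=\overline{\varepsilon}_t^*(\varphi\,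 g'(1_{(2)}))\otimes\overline{\varepsilon}_t^*(g(1_{(1)})).$$
   Context: Conventions. $k$ is a commutative ring and $\otimes=\otimes_k$. A $k$-prebialgebra is a $k$-module $H$ that is both an associative unital $k$-algebra (unit $1$) and a coassociative counital $k$-coalgebra ($\Delta$, $\varepsilon$) such that $\Delta(hk)=\Delta(h)\Delta(k)$ for all $h,k\in H$; it is not required that $\Delta(1)=1\otimes 1$ nor that $\varepsilon$ is multiplicative. Sweedler notation: $\Delta(h)=h_{(1)}\otimes h_{(2)}$, $\Delta(1)=1_{(1)}\otimes 1_{(2)}=1_{(1')}\otimes 1_{(2')}$, $\Delta^2=(\Delta\otimes H)\circ\Delta$. Axioms (for all $h,k,l\in H$): (lm) $\varepsilon(hkl)=\varepsilon(hk_{(1)})\varepsilon(k_{(2)}l)$; (rm) $\varepsilon(hkl)=\varepsilon(hk_{(2)})\varepsilon(k_{(1)}l)$; (lc) $\Delta^2(1)=1_{(1)}\otimes 1_{(2)}1_{(1')}\otimes 1_{(2')}$; (rc) $\Delta^2(1)=1_{(1)}\otimes 1_{(1')}1_{(2)}\otimes 1_{(2')}$. $H^*=\mathrm{Hom}_k(H,k)$ is a $k$-algebra with the opposite convolution product $\langle h^*k^*,h\rangle=\langle h^*,h_{(2)}\rangle\langle k^*,h_{(1)}\rangle$ and unit $\varepsilon$. Define $g,g':H\to H^*$ by $g(h)=\langle\varepsilon,-h\rangle$, $g'(h)=\langle\varepsilon,h-\rangle$. Define maps $H\to H$: $\varepsilon_t(h)=\langle\varepsilon,1_{(1)}h\rangle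 1_{(2)}$, $\varepsilon_s(h)=\langle\varepsilon,h1_{(2)}\rangle 1_{(1)}$, $\overline{\varepsilon}_t(h)=\langle\varepsilon,h1_{(1)}\rangle 1_{(2)}$, $\overline{\varepsilon}_s(h)=\langle\varepsilon,1_{(2)}h\rangle 1_{(1)}$, and maps $H^*\to H^*$: $\varepsilon_t^*(h^* )=h^*\circ\varepsilon_s$, $\varepsilon_s^*(h^* )=h^*\circ\varepsilon_t$, $\overline{\varepsilon}_t^*(h^* )=h^*\circ\overline{\varepsilon}_t$, $\overline{\varepsilon}_s^*(h^* )=h^*\circ\overline{\varepsilon}_s$. Then $H_t,H_s,\overline{H}_t,\overline{H}_s\subset H$ are the images of $\varepsilon_t,\varepsilon_s,\overline{\varepsilon}_t,\overline{\varepsilon}_s$, and $H_t^*,H_s^*,\overline{H}_t^*,\overline{H}_s^*\subset H^*$ are the images of $\varepsilon_t^*,\varepsilon_s^*,\overline{\varepsilon}_t^*,\overline{\varepsilon}_s^*$ (not to be confused with the $k$-duals of $H_t$, etc.). *)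

theory Defs
  imports "HOL-Algebra.Module" "HOL-Algebra.QuotRing" "HOL-Algebra.Free_Abelian_Groups"
begin

section \<open>Linear maps and tensor products of modules over a commutative ring\<close>

definition regular_module :: "'k ring \<Rightarrow> ('k, 'k) module" where
  "regular_module k =
     \<lparr>carrier = carrier k, monoid.mult = monoid.mult k, monoid.one = \<one>\<^bsub>k\<^esub>, ring.zero = \<zero>\<^bsub>k\<^esub>, ring.add = ring.add k,
      smult = monoid.mult k\<rparr>"

definition linear_maps :: "'k ring \<Rightarrow> ('k, 'a) module \<Rightarrow> ('k, 'b) module \<Rightarrow> ('a \<Rightarrow> 'b) set" where
  "linear_maps k M N =
     {f \<in> carrier M \<rightarrow> carrier N.
        (\<forall>x\<in>carrier M. \<forall>y\<in>carrier M. f (x \<oplus>\<^bsub>M\<^esub> y) = f x \<oplus>\<^bsub>N\<^esub> f y) \<and>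
        (\<forall>r\<in>carrier k. \<forall>x\<in>carrier M. f (r \<odot>\<^bsub>M\<^esub> x) = r \<odot>\<^bsub>N\<^esub> f x)}"

text \<open>
  The tensor product \<open>M \<otimes>\<^sub>k N\<close> is the quotient of the free abelian group over
  \<open>carrier M \<times> carrier N\<close> by the subgroup generated by the usual bilinearity and balancing
  relations, so a tensor is a coset of finite formal sums of pairs.
\<close>

definition tensor_relations ::
  "'k ring \<Rightarrow> ('k, 'a) module \<Rightarrow> ('k, 'b) module \<Rightarrow> (('a \<times> 'b) \<Rightarrow>\<^sub>0 int) set" where
  "tensor_relations k M N =
     {frag_of (a \<oplus>\<^bsub>M\<^esub> a', b) - frag_of (a, b) - frag_of (a', b) | a a' b.
        a \<in> carrier M \<and> a' \<in> carrier M \<and> b \<in> carrier N}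
   \<union> {frag_of (a, b \<oplus>\<^bsub>N\<^esub> b') - frag_of (a, b) - frag_of (a, b') | a b b'.
        a \<in> carrier M \<and> b \<in> carrier N \<and> b' \<in> carrier N}
   \<union> {frag_of (r \<odot>\<^bsub>M\<^esub> a, b) - frag_of (a, r \<odot>\<^bsub>N\<^esub> b) | r a b.
        r \<in> carrier k \<and> a \<in> carrier M \<and> b \<in> carrier N}"

definition tensor_free :: "('k, 'a) module \<Rightarrow> ('k, 'b) module \<Rightarrow> (('a \<times> 'b) \<Rightarrow>\<^sub>0 int) monoid" where
  "tensor_free M N = free_Abelian_group (carrier M \<times> carrier N)"

definition tensor_null ::
  "'k ring \<Rightarrow> ('k, 'a) module \<Rightarrow> ('k, 'b) module \<Rightarrow> (('a \<times> 'b) \<Rightarrow>\<^sub>0 int) set" where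
  "tensor_null k M N = generate (tensor_free M N) (tensor_relations k M N)"

definition tensor_class ::
  "'k ring \<Rightarrow> ('k, 'a) module \<Rightarrow> ('k, 'b) module \<Rightarrow> (('a \<times> 'b) \<Rightarrow>\<^sub>0 int)
     \<Rightarrow> (('a \<times> 'b) \<Rightarrow>\<^sub>0 int) set" where
  "tensor_class k M N x = tensor_null k M N #>\<^bsub>tensor_free M N\<^esub> x"

definition pure_tensor ::
  "'k ring \<Rightarrow> ('k, 'a) module \<Rightarrow> ('k, 'b) module \<Rightarrow> 'a \<Rightarrow> 'b \<Rightarrow> (('a \<times> 'b) \<Rightarrow>\<^sub>0 int) set" where
  "pure_tensor k M N a b = tensor_class k M N (frag_of (a, b))"

text \<open>
  The multiplicative fields are given by \<open>(a \<otimes> b)(c \<otimes> d) = ac \<otimes> bd\<close> and \<open>1 \<otimes> 1\<close>; they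
  are meaningful only if both factors are algebras. As in the library's \<^const>\<open>rcoset_mult\<close>,
  the unions below range over representatives that all yield the same coset.
\<close>

definition tensor ::
  "'k ring \<Rightarrow> ('k, 'a) module \<Rightarrow> ('k, 'b) module \<Rightarrow> ('k, (('a \<times> 'b) \<Rightarrow>\<^sub>0 int) set) module" where
  "tensor k M N =
     \<lparr>carrier = carrier (tensor_free M N Mod tensor_null k M N),
      monoid.mult = (\<lambda>X Y. \<Union>x\<in>X. \<Union>y\<in>Y. tensor_class k M N
        (frag_extend (\<lambda>(a, b). frag_extend (\<lambda>(c, d). frag_of (a \<otimes>\<^bsub>M\<^esub> c, b \<otimes>\<^bsub>N\<^esub> d)) y) x)),
      monoid.one = pure_tensor k M N \<one>\<^bsub>M\<^esub> \<one>\<^bsub>N\<^esub>,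
      ring.zero = \<one>\<^bsub>tensor_free M N Mod tensor_null k M N\<^esub>,
      ring.add = monoid.mult (tensor_free M N Mod tensor_null k M N),
      smult = (\<lambda>r X. \<Union>x\<in>X. tensor_class k M N
        (frag_extend (\<lambda>(a, b). frag_of (r \<odot>\<^bsub>M\<^esub> a, b)) x))\<rparr>"

text \<open>
  The additive map out of a tensor product induced by a function \<open>f\<close> of two arguments:
  \<open>\<Sum>\<^sub>i a\<^sub>i \<otimes> b\<^sub>i\<close> is sent to \<open>\<Sum>\<^sub>i f a\<^sub>i b\<^sub>i\<close>, computed in \<open>N\<close>. If \<open>f\<close> is bilinear, all
  representatives of a tensor give the same value, which is the one picked by
  \<^const>\<open>the_elem\<close>. This renders Sweedler notation: \<open>tensor_lift N f (\<Delta> h)\<close> stands for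
  \<open>f h\<^sub>(\<^sub>1\<^sub>) h\<^sub>(\<^sub>2\<^sub>)\<close>.
\<close>

definition formal_sum_eval ::
  "('n, 'm) ring_scheme \<Rightarrow> ('a \<Rightarrow> 'b \<Rightarrow> 'n) \<Rightarrow> (('a \<times> 'b) \<Rightarrow>\<^sub>0 int) \<Rightarrow> 'n" where
  "formal_sum_eval N f x =
     (\<Oplus>\<^bsub>N\<^esub>p\<in>Poly_Mapping.keys x. [Poly_Mapping.lookup x p] \<cdot>\<^bsub>N\<^esub> f (fst p) (snd p))"

definition tensor_lift ::
  "('n, 'm) ring_scheme \<Rightarrow> ('a \<Rightarrow> 'b \<Rightarrow> 'n) \<Rightarrow> (('a \<times> 'b) \<Rightarrow>\<^sub>0 int) set \<Rightarrow> 'n" where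
  "tensor_lift N f X = the_elem (formal_sum_eval N f ` X)"

text \<open>\<open>tensor_map k M' N' f g\<close> is \<open>f \<otimes> g\<close> with values in \<open>M' \<otimes> N'\<close>.\<close>

definition tensor_map ::
  "'k ring \<Rightarrow> ('k, 'c) module \<Rightarrow> ('k, 'd) module \<Rightarrow> ('a \<Rightarrow> 'c) \<Rightarrow> ('b \<Rightarrow> 'd)
     \<Rightarrow> (('a \<times> 'b) \<Rightarrow>\<^sub>0 int) set \<Rightarrow> (('c \<times> 'd) \<Rightarrow>\<^sub>0 int) set" where
  "tensor_map k M' N' f g = tensor_lift (tensor k M' N') (\<lambda>a b. pure_tensor k M' N' (f a) (g b))"

text \<open>The canonical map \<open>(L \<otimes> M) \<otimes> N \<rightarrow> L \<otimes> (M \<otimes> N)\<close>.\<close>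

definition tensor_assoc ::
  "'k ring \<Rightarrow> ('k, 'a) module \<Rightarrow> ('k, 'b) module \<Rightarrow> ('k, 'c) module
     \<Rightarrow> (((('a \<times> 'b) \<Rightarrow>\<^sub>0 int) set \<times> 'c) \<Rightarrow>\<^sub>0 int) set
     \<Rightarrow> (('a \<times> (('b \<times> 'c) \<Rightarrow>\<^sub>0 int) set) \<Rightarrow>\<^sub>0 int) set" where
  "tensor_assoc k L M N =
     tensor_lift (tensor k L (tensor k M N))
       (\<lambda>X c. tensor_lift (tensor k L (tensor k M N))
          (\<lambda>a b. pure_tensor k L (tensor k M N) a (pure_tensor k M N b c)) X)"


section \<open>Coalgebras and prebialgebras\<close>

locale coalgebra = module k C
  for k :: "'k ring" and C :: "('k, 'c) module" +
  fixes \<Delta> :: "'c \<Rightarrow> (('c \<times> 'c) \<Rightarrow>\<^sub>0 int) set"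
    and \<epsilon> :: "'c \<Rightarrow> 'k"
  assumes comult_linear: "\<Delta> \<in> linear_maps k C (tensor k C C)"
    and counit_linear: "\<epsilon> \<in> linear_maps k C (regular_module k)"
    and coassoc: "\<And>c. c \<in> carrier C \<Longrightarrow>
      tensor_assoc k C C C (tensor_map k (tensor k C C) C \<Delta> (\<lambda>x. x) (\<Delta> c)) =
      tensor_map k C (tensor k C C) (\<lambda>x. x) \<Delta> (\<Delta> c)"
    and counit_left: "\<And>c. c \<in> carrier C \<Longrightarrow> tensor_lift C (\<lambda>a b. \<epsilon> a \<odot>\<^bsub>C\<^esub> b) (\<Delta> c) = c"
    and counit_right: "\<And>c. c \<in> carrier C \<Longrightarrow> tensor_lift C (\<lambda>a b. \<epsilon> b \<odot>\<^bsub>C\<^esub> a) (\<Delta> c) = c"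

text \<open>
  The library's locale \<^locale>\<open>algebra\<close> is restricted to commutative algebras, so the
  associative unital algebra structure is spelled out as a ring with bilinear multiplication.
\<close>

locale prebialgebra = coalgebra k H \<Delta> \<epsilon> + ring H
  for k :: "'k ring" and H :: "('k, 'h) module"
    and \<Delta> :: "'h \<Rightarrow> (('h \<times> 'h) \<Rightarrow>\<^sub>0 int) set" and \<epsilon> :: "'h \<Rightarrow> 'k" +
  assumes smult_mult_left: "\<And>r x y. \<lbrakk>r \<in> carrier k; x \<in> carrier H; y \<in> carrier H\<rbrakk> \<Longrightarrow>
      (r \<odot>\<^bsub>H\<^esub> x) \<otimes>\<^bsub>H\<^esub> y = r \<odot>\<^bsub>H\<^esub> (x \<otimes>\<^bsub>H\<^esub> y)"
    and smult_mult_right: "\<And>r x y. \<lbrakk>r \<in> carrier k; x \<in> carrier H; y \<in> carrier H\<rbrakk> \<Longrightarrow>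
      x \<otimes>\<^bsub>H\<^esub> (r \<odot>\<^bsub>H\<^esub> y) = r \<odot>\<^bsub>H\<^esub> (x \<otimes>\<^bsub>H\<^esub> y)"
    and comult_mult: "\<And>x y. \<lbrakk>x \<in> carrier H; y \<in> carrier H\<rbrakk> \<Longrightarrow>
      \<Delta> (x \<otimes>\<^bsub>H\<^esub> y) = \<Delta> x \<otimes>\<^bsub>tensor k H H\<^esub> \<Delta> y"

definition axiom_lm ::
  "'k ring \<Rightarrow> ('k, 'h) module \<Rightarrow> ('h \<Rightarrow> (('h \<times> 'h) \<Rightarrow>\<^sub>0 int) set) \<Rightarrow> ('h \<Rightarrow> 'k) \<Rightarrow> bool" where
  "axiom_lm k H \<Delta> \<epsilon> \<longleftrightarrow>
     (\<forall>h\<in>carrier H. \<forall>x\<in>carrier H. \<forall>l\<in>carrier H.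
        \<epsilon> (h \<otimes>\<^bsub>H\<^esub> x \<otimes>\<^bsub>H\<^esub> l) =
        tensor_lift k (\<lambda>x1 x2. \<epsilon> (h \<otimes>\<^bsub>H\<^esub> x1) \<otimes>\<^bsub>k\<^esub> \<epsilon> (x2 \<otimes>\<^bsub>H\<^esub> l)) (\<Delta> x))"

definition axiom_rm ::
  "'k ring \<Rightarrow> ('k, 'h) module \<Rightarrow> ('h \<Rightarrow> (('h \<times> 'h) \<Rightarrow>\<^sub>0 int) set) \<Rightarrow> ('h \<Rightarrow> 'k) \<Rightarrow> bool" where
  "axiom_rm k H \<Delta> \<epsilon> \<longleftrightarrow>
     (\<forall>h\<in>carrier H. \<forall>x\<in>carrier H. \<forall>l\<in>carrier H.
        \<epsilon> (h \<otimes>\<^bsub>H\<^esub> x \<otimes>\<^bsub>H\<^esub> l) =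
        tensor_lift k (\<lambda>x1 x2. \<epsilon> (h \<otimes>\<^bsub>H\<^esub> x2) \<otimes>\<^bsub>k\<^esub> \<epsilon> (x1 \<otimes>\<^bsub>H\<^esub> l)) (\<Delta> x))"

text \<open>
  Axioms (lc) and (rc) are equations in \<open>(H \<otimes> H) \<otimes> H\<close>, where
  \<open>\<Delta>\<^sup>2 = (\<Delta> \<otimes> H) \<circ> \<Delta>\<close> takes its values.
\<close>

definition axiom_lc ::
  "'k ring \<Rightarrow> ('k, 'h) module \<Rightarrow> ('h \<Rightarrow> (('h \<times> 'h) \<Rightarrow>\<^sub>0 int) set) \<Rightarrow> bool" where
  "axiom_lc k H \<Delta> \<longleftrightarrow>
     tensor_map k (tensor k H H) H \<Delta> (\<lambda>x. x) (\<Delta> \<one>\<^bsub>H\<^esub>) =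
     tensor_lift (tensor k (tensor k H H) H) (\<lambda>a b.
       tensor_lift (tensor k (tensor k H H) H) (\<lambda>a' b'.
         pure_tensor k (tensor k H H) H (pure_tensor k H H a (b \<otimes>\<^bsub>H\<^esub> a')) b')
       (\<Delta> \<one>\<^bsub>H\<^esub>)) (\<Delta> \<one>\<^bsub>H\<^esub>)"

definition axiom_rc ::
  "'k ring \<Rightarrow> ('k, 'h) module \<Rightarrow> ('h \<Rightarrow> (('h \<times> 'h) \<Rightarrow>\<^sub>0 int) set) \<Rightarrow> bool" where
  "axiom_rc k H \<Delta> \<longleftrightarrow>
     tensor_map k (tensor k H H) H \<Delta> (\<lambda>x. x) (\<Delta> \<one>\<^bsub>H\<^esub>) =
     tensor_lift (tensor k (tensor k H H) H) (\<lambda>a b.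
       tensor_lift (tensor k (tensor k H H) H) (\<lambda>a' b'.
         pure_tensor k (tensor k H H) H (pure_tensor k H H a (a' \<otimes>\<^bsub>H\<^esub> b)) b')
       (\<Delta> \<one>\<^bsub>H\<^esub>)) (\<Delta> \<one>\<^bsub>H\<^esub>)"


section \<open>The dual algebra\<close>

text \<open>
  Elements of \<open>H\<^sup>*\<close> are represented by functions that are \<^const>\<open>undefined\<close> outside
  \<open>carrier H\<close>, so that equality in \<open>H\<^sup>*\<close> is equality of linear forms on \<open>H\<close>. The product is
  the opposite convolution product.
\<close>

definition dual ::
  "'k ring \<Rightarrow> ('k, 'h) module \<Rightarrow> ('h \<Rightarrow> (('h \<times> 'h) \<Rightarrow>\<^sub>0 int) set) \<Rightarrow> ('h \<Rightarrow> 'k)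
     \<Rightarrow> ('k, 'h \<Rightarrow> 'k) module" where
  "dual k H \<Delta> \<epsilon> =
     \<lparr>carrier = linear_maps k H (regular_module k) \<inter> extensional (carrier H),
      monoid.mult = (\<lambda>\<phi> \<psi>. \<lambda>h\<in>carrier H. tensor_lift k (\<lambda>h1 h2. \<phi> h2 \<otimes>\<^bsub>k\<^esub> \<psi> h1) (\<Delta> h)),
      monoid.one = restrict \<epsilon> (carrier H),
      ring.zero = (\<lambda>h\<in>carrier H. \<zero>\<^bsub>k\<^esub>),
      ring.add = (\<lambda>\<phi> \<psi>. \<lambda>h\<in>carrier H. \<phi> h \<oplus>\<^bsub>k\<^esub> \<psi> h),
      smult = (\<lambda>r \<phi>. \<lambda>h\<in>carrier H. r \<otimes>\<^bsub>k\<^esub> \<phi> h)\<rparr>"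

definition dual_g :: "('k, 'h) module \<Rightarrow> ('h \<Rightarrow> 'k) \<Rightarrow> 'h \<Rightarrow> ('h \<Rightarrow> 'k)" where
  "dual_g H \<epsilon> h = (\<lambda>x\<in>carrier H. \<epsilon> (x \<otimes>\<^bsub>H\<^esub> h))"

definition dual_g' :: "('k, 'h) module \<Rightarrow> ('h \<Rightarrow> 'k) \<Rightarrow> 'h \<Rightarrow> ('h \<Rightarrow> 'k)" where
  "dual_g' H \<epsilon> h = (\<lambda>x\<in>carrier H. \<epsilon> (h \<otimes>\<^bsub>H\<^esub> x))"


section \<open>The counital maps and their images\<close>

definition eps_t :: "('k, 'h) module \<Rightarrow> ('h \<Rightarrow> (('h \<times> 'h) \<Rightarrow>\<^sub>0 int) set) \<Rightarrow> ('h \<Rightarrow> 'k) \<Rightarrow> 'h \<Rightarrow> 'h" where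
  "eps_t H \<Delta> \<epsilon> h = tensor_lift H (\<lambda>a b. \<epsilon> (a \<otimes>\<^bsub>H\<^esub> h) \<odot>\<^bsub>H\<^esub> b) (\<Delta> \<one>\<^bsub>H\<^esub>)"

definition eps_s :: "('k, 'h) module \<Rightarrow> ('h \<Rightarrow> (('h \<times> 'h) \<Rightarrow>\<^sub>0 int) set) \<Rightarrow> ('h \<Rightarrow> 'k) \<Rightarrow> 'h \<Rightarrow> 'h" where
  "eps_s H \<Delta> \<epsilon> h = tensor_lift H (\<lambda>a b. \<epsilon> (h \<otimes>\<^bsub>H\<^esub> b) \<odot>\<^bsub>H\<^esub> a) (\<Delta> \<one>\<^bsub>H\<^esub>)"

definition bar_eps_t :: "('k, 'h) module \<Rightarrow> ('h \<Rightarrow> (('h \<times> 'h) \<Rightarrow>\<^sub>0 int) set) \<Rightarrow> ('h \<Rightarrow> 'k) \<Rightarrow> 'h \<Rightarrow> 'h" where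
  "bar_eps_t H \<Delta> \<epsilon> h = tensor_lift H (\<lambda>a b. \<epsilon> (h \<otimes>\<^bsub>H\<^esub> a) \<odot>\<^bsub>H\<^esub> b) (\<Delta> \<one>\<^bsub>H\<^esub>)"

definition bar_eps_s :: "('k, 'h) module \<Rightarrow> ('h \<Rightarrow> (('h \<times> 'h) \<Rightarrow>\<^sub>0 int) set) \<Rightarrow> ('h \<Rightarrow> 'k) \<Rightarrow> 'h \<Rightarrow> 'h" where
  "bar_eps_s H \<Delta> \<epsilon> h = tensor_lift H (\<lambda>a b. \<epsilon> (b \<otimes>\<^bsub>H\<^esub> h) \<odot>\<^bsub>H\<^esub> a) (\<Delta> \<one>\<^bsub>H\<^esub>)"

text \<open>The unbarred dual maps swap source and target: \<open>\<epsilon>\<^sub>t\<^sup>*\<close> is composition with \<open>\<epsilon>\<^sub>s\<close>.\<close>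

definition dual_eps_t ::
  "('k, 'h) module \<Rightarrow> ('h \<Rightarrow> (('h \<times> 'h) \<Rightarrow>\<^sub>0 int) set) \<Rightarrow> ('h \<Rightarrow> 'k) \<Rightarrow> ('h \<Rightarrow> 'k) \<Rightarrow> ('h \<Rightarrow> 'k)" where
  "dual_eps_t H \<Delta> \<epsilon> \<phi> = compose (carrier H) \<phi> (eps_s H \<Delta> \<epsilon>)"

definition dual_eps_s ::
  "('k, 'h) module \<Rightarrow> ('h \<Rightarrow> (('h \<times> 'h) \<Rightarrow>\<^sub>0 int) set) \<Rightarrow> ('h \<Rightarrow> 'k) \<Rightarrow> ('h \<Rightarrow> 'k) \<Rightarrow> ('h \<Rightarrow> 'k)" where
  "dual_eps_s H \<Delta> \<epsilon> \<phi> = compose (carrier H) \<phi> (eps_t H \<Delta> \<epsilon>)"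

definition dual_bar_eps_t ::
  "('k, 'h) module \<Rightarrow> ('h \<Rightarrow> (('h \<times> 'h) \<Rightarrow>\<^sub>0 int) set) \<Rightarrow> ('h \<Rightarrow> 'k) \<Rightarrow> ('h \<Rightarrow> 'k) \<Rightarrow> ('h \<Rightarrow> 'k)" where
  "dual_bar_eps_t H \<Delta> \<epsilon> \<phi> = compose (carrier H) \<phi> (bar_eps_t H \<Delta> \<epsilon>)"

definition dual_bar_eps_s ::
  "('k, 'h) module \<Rightarrow> ('h \<Rightarrow> (('h \<times> 'h) \<Rightarrow>\<^sub>0 int) set) \<Rightarrow> ('h \<Rightarrow> 'k) \<Rightarrow> ('h \<Rightarrow> 'k) \<Rightarrow> ('h \<Rightarrow> 'k)" where
  "dual_bar_eps_s H \<Delta> \<epsilon> \<phi> = compose (carrier H) \<phi> (bar_eps_s H \<Delta> \<epsilon>)"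

text \<open>
  The image of an endomorphism \<open>e\<close> of \<open>M\<close>, with the operations inherited from \<open>M\<close>. Tensor
  products of such images are formed over the images themselves and not inside \<open>M \<otimes> M\<close>.
\<close>

definition image_module :: "('k, 'a) module \<Rightarrow> ('a \<Rightarrow> 'a) \<Rightarrow> ('k, 'a) module" where
  "image_module M e = M\<lparr>carrier := e ` carrier M\<rparr>"

definition H_t :: "('k, 'h) module \<Rightarrow> ('h \<Rightarrow> (('h \<times> 'h) \<Rightarrow>\<^sub>0 int) set) \<Rightarrow> ('h \<Rightarrow> 'k) \<Rightarrow> ('k, 'h) module" where
  "H_t H \<Delta> \<epsilon> = image_module H (eps_t H \<Delta> \<epsilon>)"

definition H_s :: "('k, 'h) module \<Rightarrow> ('h \<Rightarrow> (('h \<times> 'h) \<Rightarrow>\<^sub>0 int) set) \<Rightarrow> ('h \<Rightarrow> 'k) \<Rightarrow> ('k, 'h) module" where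
  "H_s H \<Delta> \<epsilon> = image_module H (eps_s H \<Delta> \<epsilon>)"

definition bar_H_t :: "('k, 'h) module \<Rightarrow> ('h \<Rightarrow> (('h \<times> 'h) \<Rightarrow>\<^sub>0 int) set) \<Rightarrow> ('h \<Rightarrow> 'k) \<Rightarrow> ('k, 'h) module" where
  "bar_H_t H \<Delta> \<epsilon> = image_module H (bar_eps_t H \<Delta> \<epsilon>)"

definition bar_H_s :: "('k, 'h) module \<Rightarrow> ('h \<Rightarrow> (('h \<times> 'h) \<Rightarrow>\<^sub>0 int) set) \<Rightarrow> ('h \<Rightarrow> 'k) \<Rightarrow> ('k, 'h) module" where
  "bar_H_s H \<Delta> \<epsilon> = image_module H (bar_eps_s H \<Delta> \<epsilon>)"

definition dual_H_t ::
  "'k ring \<Rightarrow> ('k, 'h) module \<Rightarrow> ('h \<Rightarrow> (('h \<times> 'h) \<Rightarrow>\<^sub>0 int) set) \<Rightarrow> ('h \<Rightarrow> 'k) \<Rightarrow> ('k, 'h \<Rightarrow> 'k) module" where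
  "dual_H_t k H \<Delta> \<epsilon> = image_module (dual k H \<Delta> \<epsilon>) (dual_eps_t H \<Delta> \<epsilon>)"

definition dual_H_s ::
  "'k ring \<Rightarrow> ('k, 'h) module \<Rightarrow> ('h \<Rightarrow> (('h \<times> 'h) \<Rightarrow>\<^sub>0 int) set) \<Rightarrow> ('h \<Rightarrow> 'k) \<Rightarrow> ('k, 'h \<Rightarrow> 'k) module" where
  "dual_H_s k H \<Delta> \<epsilon> = image_module (dual k H \<Delta> \<epsilon>) (dual_eps_s H \<Delta> \<epsilon>)"

definition dual_bar_H_t ::
  "'k ring \<Rightarrow> ('k, 'h) module \<Rightarrow> ('h \<Rightarrow> (('h \<times> 'h) \<Rightarrow>\<^sub>0 int) set) \<Rightarrow> ('h \<Rightarrow> 'k) \<Rightarrow> ('k, 'h \<Rightarrow> 'k) module" where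
  "dual_bar_H_t k H \<Delta> \<epsilon> = image_module (dual k H \<Delta> \<epsilon>) (dual_bar_eps_t H \<Delta> \<epsilon>)"

definition dual_bar_H_s ::
  "'k ring \<Rightarrow> ('k, 'h) module \<Rightarrow> ('h \<Rightarrow> (('h \<times> 'h) \<Rightarrow>\<^sub>0 int) set) \<Rightarrow> ('h \<Rightarrow> 'k) \<Rightarrow> ('k, 'h \<Rightarrow> 'k) module" where
  "dual_bar_H_s k H \<Delta> \<epsilon> = image_module (dual k H \<Delta> \<epsilon>) (dual_bar_eps_s H \<Delta> \<epsilon>)"


section \<open>The comultiplications\<close>

definition Delta_s ::
  "'k ring \<Rightarrow> ('k, 'h) module \<Rightarrow> ('h \<Rightarrow> (('h \<times> 'h) \<Rightarrow>\<^sub>0 int) set) \<Rightarrow> ('h \<Rightarrow> 'k)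
     \<Rightarrow> 'h \<Rightarrow> (('h \<times> 'h) \<Rightarrow>\<^sub>0 int) set" where
  "Delta_s k H \<Delta> \<epsilon> y =
     (let C = H_s H \<Delta> \<epsilon>; e = eps_s H \<Delta> \<epsilon>
      in tensor_lift (tensor k C C)
           (\<lambda>a b. pure_tensor k C C (e a) (e (y \<otimes>\<^bsub>H\<^esub> b))) (\<Delta> \<one>\<^bsub>H\<^esub>))"

definition Delta_t ::
  "'k ring \<Rightarrow> ('k, 'h) module \<Rightarrow> ('h \<Rightarrow> (('h \<times> 'h) \<Rightarrow>\<^sub>0 int) set) \<Rightarrow> ('h \<Rightarrow> 'k)
     \<Rightarrow> 'h \<Rightarrow> (('h \<times> 'h) \<Rightarrow>\<^sub>0 int) set" where
  "Delta_t k H \<Delta> \<epsilon> z =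
     (let C = H_t H \<Delta> \<epsilon>; e = eps_t H \<Delta> \<epsilon>
      in tensor_lift (tensor k C C)
           (\<lambda>a b. pure_tensor k C C (e (a \<otimes>\<^bsub>H\<^esub> z)) (e b)) (\<Delta> \<one>\<^bsub>H\<^esub>))"

definition bar_Delta_s ::
  "'k ring \<Rightarrow> ('k, 'h) module \<Rightarrow> ('h \<Rightarrow> (('h \<times> 'h) \<Rightarrow>\<^sub>0 int) set) \<Rightarrow> ('h \<Rightarrow> 'k)
     \<Rightarrow> 'h \<Rightarrow> (('h \<times> 'h) \<Rightarrow>\<^sub>0 int) set" where
  "bar_Delta_s k H \<Delta> \<epsilon> y =
     (let C = bar_H_s H \<Delta> \<epsilon>; e = bar_eps_s H \<Delta> \<epsilon>
      in tensor_lift (tensor k C C)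
           (\<lambda>a b. pure_tensor k C C (e a) (e (b \<otimes>\<^bsub>H\<^esub> y))) (\<Delta> \<one>\<^bsub>H\<^esub>))"

definition bar_Delta_t ::
  "'k ring \<Rightarrow> ('k, 'h) module \<Rightarrow> ('h \<Rightarrow> (('h \<times> 'h) \<Rightarrow>\<^sub>0 int) set) \<Rightarrow> ('h \<Rightarrow> 'k)
     \<Rightarrow> 'h \<Rightarrow> (('h \<times> 'h) \<Rightarrow>\<^sub>0 int) set" where
  "bar_Delta_t k H \<Delta> \<epsilon> z =
     (let C = bar_H_t H \<Delta> \<epsilon>; e = bar_eps_t H \<Delta> \<epsilon>
      in tensor_lift (tensor k C C)
           (\<lambda>a b. pure_tensor k C C (e (z \<otimes>\<^bsub>H\<^esub> a)) (e b)) (\<Delta> \<one>\<^bsub>H\<^esub>))"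

definition dual_Delta_s ::
  "'k ring \<Rightarrow> ('k, 'h) module \<Rightarrow> ('h \<Rightarrow> (('h \<times> 'h) \<Rightarrow>\<^sub>0 int) set) \<Rightarrow> ('h \<Rightarrow> 'k)
     \<Rightarrow> ('h \<Rightarrow> 'k) \<Rightarrow> ((('h \<Rightarrow> 'k) \<times> ('h \<Rightarrow> 'k)) \<Rightarrow>\<^sub>0 int) set" where
  "dual_Delta_s k H \<Delta> \<epsilon> \<psi> =
     (let C = dual_H_s k H \<Delta> \<epsilon>; e = dual_eps_s H \<Delta> \<epsilon>
      in tensor_lift (tensor k C C)
           (\<lambda>a b. pure_tensor k C C (e (dual_g' H \<epsilon> a)) (e (\<psi> \<otimes>\<^bsub>dual k H \<Delta> \<epsilon>\<^esub> dual_g H \<epsilon> b)))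
           (\<Delta> \<one>\<^bsub>H\<^esub>))"

definition dual_Delta_t ::
  "'k ring \<Rightarrow> ('k, 'h) module \<Rightarrow> ('h \<Rightarrow> (('h \<times> 'h) \<Rightarrow>\<^sub>0 int) set) \<Rightarrow> ('h \<Rightarrow> 'k)
     \<Rightarrow> ('h \<Rightarrow> 'k) \<Rightarrow> ((('h \<Rightarrow> 'k) \<times> ('h \<Rightarrow> 'k)) \<Rightarrow>\<^sub>0 int) set" where
  "dual_Delta_t k H \<Delta> \<epsilon> \<phi> =
     (let C = dual_H_t k H \<Delta> \<epsilon>; e = dual_eps_t H \<Delta> \<epsilon>
      in tensor_lift (tensor k C C)
           (\<lambda>a b. pure_tensor k C C (e (dual_g' H \<epsilon> a \<otimes>\<^bsub>dual k H \<Delta> \<epsilon>\<^esub> \<phi>)) (e (dual_g H \<epsilon> b)))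
           (\<Delta> \<one>\<^bsub>H\<^esub>))"

definition dual_bar_Delta_s ::
  "'k ring \<Rightarrow> ('k, 'h) module \<Rightarrow> ('h \<Rightarrow> (('h \<times> 'h) \<Rightarrow>\<^sub>0 int) set) \<Rightarrow> ('h \<Rightarrow> 'k)
     \<Rightarrow> ('h \<Rightarrow> 'k) \<Rightarrow> ((('h \<Rightarrow> 'k) \<times> ('h \<Rightarrow> 'k)) \<Rightarrow>\<^sub>0 int) set" where
  "dual_bar_Delta_s k H \<Delta> \<epsilon> \<psi> =
     (let C = dual_bar_H_s k H \<Delta> \<epsilon>; e = dual_bar_eps_s H \<Delta> \<epsilon>
      in tensor_lift (tensor k C C)
           (\<lambda>a b. pure_tensor k C C (e (dual_g' H \<epsilon> b)) (e (dual_g H \<epsilon> a \<otimes>\<^bsub>dual k H \<Delta> \<epsilon>\<^esub> \<psi>)))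
           (\<Delta> \<one>\<^bsub>H\<^esub>))"

definition dual_bar_Delta_t ::
  "'k ring \<Rightarrow> ('k, 'h) module \<Rightarrow> ('h \<Rightarrow> (('h \<times> 'h) \<Rightarrow>\<^sub>0 int) set) \<Rightarrow> ('h \<Rightarrow> 'k)
     \<Rightarrow> ('h \<Rightarrow> 'k) \<Rightarrow> ((('h \<Rightarrow> 'k) \<times> ('h \<Rightarrow> 'k)) \<Rightarrow>\<^sub>0 int) set" where
  "dual_bar_Delta_t k H \<Delta> \<epsilon> \<phi> =
     (let C = dual_bar_H_t k H \<Delta> \<epsilon>; e = dual_bar_eps_t H \<Delta> \<epsilon>
      in tensor_lift (tensor k C C)
           (\<lambda>a b. pure_tensor k C C (e (\<phi> \<otimes>\<^bsub>dual k H \<Delta> \<epsilon>\<^esub> dual_g' H \<epsilon> b)) (e (dual_g H \<epsilon> a)))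
           (\<Delta> \<one>\<^bsub>H\<^esub>))"

end

theory Submission
  imports Defs
begin

text \<open>
  Write \<open>e\<close> for \<open>\<epsilon>\<^sub>s\<close> and \<open>t\<close> for \<open>\<epsilon>\<^sub>t\<close>. The counit of \<open>H\<^sub>s\<close> is the restriction of \<open>\<epsilon>\<close>, because
  \<open>\<epsilon>(e(h)) = \<epsilon>(h)\<close>. The two hypotheses give coassociativity for two different reasons.

  Under (rm) the values of \<open>e\<close> satisfy \<open>e(hl) = \<epsilon>(hl\<^sub>(\<^sub>2\<^sub>)) e(l\<^sub>(\<^sub>1\<^sub>))\<close> and \<open>e(e(h)l) = e(hl)\<close>. With
  \<open>\<Delta>(h) = \<Delta>(h)\<Delta>(1)\<close> and coassociativity at \<open>\<Delta>(1)\<close> this yields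
  \<open>e(h\<^sub>(\<^sub>1\<^sub>)) \<otimes> e(h\<^sub>(\<^sub>2\<^sub>)) = e(1\<^sub>(\<^sub>1\<^sub>)) \<otimes> e(h1\<^sub>(\<^sub>2\<^sub>))\<close> (lemma \<open>rm_comult_e\<close>). So \<open>\<Delta>\<^sub>s \<circ> e = (e \<otimes> e) \<circ> \<Delta>\<close>, and
  \<open>H\<^sub>s\<close> is a quotient coalgebra of \<open>H\<close>.

  Under (rc) applying the counit to the middle leg gives
  \<open>1\<^sub>(\<^sub>1\<^sub>) \<otimes> 1\<^sub>(\<^sub>2\<^sub>) = e(1\<^sub>(\<^sub>1\<^sub>)) \<otimes> 1\<^sub>(\<^sub>2\<^sub>) = 1\<^sub>(\<^sub>1\<^sub>) \<otimes> t(1\<^sub>(\<^sub>2\<^sub>))\<close>, and \<open>\<Delta>(t(h)) = 1\<^sub>(\<^sub>1\<^sub>)t(h) \<otimes> 1\<^sub>(\<^sub>2\<^sub>)\<close>. Hence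
  \<open>H\<^sub>t\<close> is closed under multiplication (lemma \<open>rc_t_mult\<close>). As \<open>e\<close> and \<open>t\<close> are adjoint for the
  form \<open>\<epsilon>(hx)\<close> (lemma \<open>counit_t_e\<close>), \<open>\<Delta>\<^sub>s\<close> is dual to this associative product, and both
  sides of coassociativity at \<open>h\<close> become
  \<open>e(1\<^sub>(\<^sub>1\<^sub>)) \<otimes> e(1\<^sub>(\<^sub>1\<^sub>'\<^sub>)) \<otimes> e(h1\<^sub>(\<^sub>2\<^sub>)1\<^sub>(\<^sub>2\<^sub>'\<^sub>))\<close> (lemma \<open>rc_coassoc\<close>).

  On the dual side, \<open>h\<^sup>* \<circ> t = \<epsilon>(y-)\<close> with \<open>y = \<langle>h\<^sup>*, 1\<^sub>(\<^sub>2\<^sub>)\<rangle> 1\<^sub>(\<^sub>1\<^sub>)\<close>, so \<open>y \<mapsto> \<epsilon>(y-)\<close> maps \<open>H\<^sub>s\<close> onto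
  \<open>H\<^sub>s\<^sup>*\<close>. It carries the flip of \<open>\<Delta>\<^sub>s\<close> to \<open>\<Delta>\<^sub>s\<^sup>*\<close> (lemma \<open>coalgebra_dual\<close>).

  The other six structures follow by symmetry: reversing the multiplication of \<open>H\<close> exchanges
  (lm) with (rm) and (lc) with (rc), and so does reversing the comultiplication, while the
  maps \<open>\<epsilon>\<^sub>s, \<epsilon>\<^sub>t\<close> and their barred versions are permuted.

  Sweedler notation is rendered by choosing, for each \<open>h\<close>, a finite list of pairs that represents
  \<open>\<Delta>(h)\<close>. Sums over such a list can be interchanged without any bilinearity conditions, and the
  universal property of the tensor product makes the value of a bilinear expression independent of
  the list.
\<close>

section \<open>Finite sums over lists of pairs\<close>

primrec psum :: "('n, 'm) ring_scheme \<Rightarrow> ('a \<Rightarrow> 'b \<Rightarrow> 'n) \<Rightarrow> ('a \<times> 'b) list \<Rightarrow> 'n" where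
  "psum N f [] = \<zero>\<^bsub>N\<^esub>"
| "psum N f (p # ps) = f (fst p) (snd p) \<oplus>\<^bsub>N\<^esub> psum N f ps"

lemma psum_cong:
  assumes "set ps \<subseteq> A \<times> B" "\<And>a b. a \<in> A \<Longrightarrow> b \<in> B \<Longrightarrow> f a b = g a b"
  shows "psum N f ps = psum N g ps"
  using assms(1) by (induction ps) (auto simp: assms(2))

lemma psum_map: "psum N f (map (\<lambda>(a, b). (p a b, q a b)) ps) = psum N (\<lambda>a b. f (p a b) (q a b)) ps"
  by (induction ps) auto

lemma psum_swap_pairs: "psum N f (map prod.swap ps) = psum N (\<lambda>a b. f b a) ps"
  by (induction ps) auto

lemma psum_hom:
  assumes "set ps \<subseteq> A \<times> B" "\<And>a b. a \<in> A \<Longrightarrow> b \<in> B \<Longrightarrow> f a b \<in> carrier N"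
    and "abelian_monoid N"
    and "\<phi> \<zero>\<^bsub>N\<^esub> = \<zero>\<^bsub>P\<^esub>"
    and "\<And>x y. x \<in> carrier N \<Longrightarrow> y \<in> carrier N \<Longrightarrow> \<phi> (x \<oplus>\<^bsub>N\<^esub> y) = \<phi> x \<oplus>\<^bsub>P\<^esub> \<phi> y"
  shows "\<phi> (psum N f ps) = psum P (\<lambda>a b. \<phi> (f a b)) ps \<and> psum N f ps \<in> carrier N"
proof -
  interpret abelian_monoid N by fact
  show ?thesis using assms(1) by (induction ps) (auto simp: assms)
qed

context abelian_monoid
begin

lemma psum_closed:
  assumes "set ps \<subseteq> A \<times> B" "\<And>a b. a \<in> A \<Longrightarrow> b \<in> B \<Longrightarrow> f a b \<in> carrier G"
  shows "psum G f ps \<in> carrier G"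
  using assms(1) by (induction ps) (auto simp: assms(2))

lemma psum_append:
  assumes "set ps \<subseteq> A \<times> B" "set qs \<subseteq> A \<times> B" "\<And>a b. a \<in> A \<Longrightarrow> b \<in> B \<Longrightarrow> f a b \<in> carrier G"
  shows "psum G f (ps @ qs) = psum G f ps \<oplus> psum G f qs"
  using assms(1)
proof (induction ps)
  case (Cons p ps)
  then have "psum G f ps \<in> carrier G" "f (fst p) (snd p) \<in> carrier G"
    by (simp_all add: psum_closed[of ps A B f] assms(3) mem_Times_iff)
  then show ?case using Cons psum_closed[OF assms(2,3)] by (simp add: a_assoc)
qed (simp add: psum_closed[OF assms(2,3)])

lemma psum_zero: "psum G (\<lambda>a b. \<zero>) ps = \<zero>"
  by (induction ps) auto

lemma psum_add:
  assumes "set ps \<subseteq> A \<times> B" "\<And>a b. a \<in> A \<Longrightarrow> b \<in> B \<Longrightarrow> f a b \<in> carrier G"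
    "\<And>a b. a \<in> A \<Longrightarrow> b \<in> B \<Longrightarrow> g a b \<in> carrier G"
  shows "psum G (\<lambda>a b. f a b \<oplus> g a b) ps = psum G f ps \<oplus> psum G g ps"
  using assms(1)
proof (induction ps)
  case (Cons p ps)
  then have "psum G f ps \<in> carrier G" "psum G g ps \<in> carrier G"
    "f (fst p) (snd p) \<in> carrier G" "g (fst p) (snd p) \<in> carrier G"
    by (simp_all add: psum_closed[of ps A B] assms(2,3) mem_Times_iff)
  with Cons show ?case by (simp add: a_ac)
qed auto

lemma psum_commute:
  assumes "set ps \<subseteq> A \<times> B" "set qs \<subseteq> C \<times> D"
    and "\<And>a b c d. a \<in> A \<Longrightarrow> b \<in> B \<Longrightarrow> c \<in> C \<Longrightarrow> d \<in> D \<Longrightarrow> f a b c d \<in> carrier G"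
  shows "psum G (\<lambda>a b. psum G (f a b) qs) ps = psum G (\<lambda>c d. psum G (\<lambda>a b. f a b c d) ps) qs"
  using assms(1)
proof (induction ps)
  case Nil
  then show ?case by (simp add: psum_zero)
next
  case (Cons p ps)
  then show ?case
    by (simp add: mem_Times_iff psum_add[OF assms(2)] psum_closed[of ps A B] assms(3))
qed

end

section \<open>Linear and bilinear maps\<close>

lemma regular_module_simps [simp]:
  "carrier (regular_module k) = carrier k" "\<zero>\<^bsub>regular_module k\<^esub> = \<zero>\<^bsub>k\<^esub>"
  "add (regular_module k) = add k" "smult (regular_module k) = monoid.mult k"
  by (auto simp: regular_module_def)

lemma module_regular: "cring k \<Longrightarrow> module k (regular_module k)"
proof -
  assume "cring k"
  then interpret cring k .
  show ?thesis
  proof (intro moduleI abelian_groupI cring_axioms)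
    show "\<exists>y\<in>carrier (regular_module k). y \<oplus>\<^bsub>regular_module k\<^esub> x = \<zero>\<^bsub>regular_module k\<^esub>"
      if "x \<in> carrier (regular_module k)" for x
      using that by (intro bexI[of _ "\<ominus>\<^bsub>k\<^esub> x"]) (auto simp: l_neg)
  qed (auto simp: a_ac m_ac l_distr r_distr)
qed

lemma psum_regular: "psum (regular_module k) f ps = psum k f ps"
  by (induction ps) auto

lemma tensor_lift_regular: "tensor_lift (regular_module k) f X = tensor_lift k f X"
  unfolding tensor_lift_def formal_sum_eval_def finsum_def finprod_def add_pow_def int_pow_def nat_pow_def m_inv_def
  by (simp add: Let_def cong: if_cong)

lemma linear_mapsI:
  assumes "\<And>x. x \<in> carrier M \<Longrightarrow> f x \<in> carrier N"
    "\<And>x y. x \<in> carrier M \<Longrightarrow> y \<in> carrier M \<Longrightarrow> f (x \<oplus>\<^bsub>M\<^esub> y) = f x \<oplus>\<^bsub>N\<^esub> f y"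
    "\<And>r x. r \<in> carrier k \<Longrightarrow> x \<in> carrier M \<Longrightarrow> f (r \<odot>\<^bsub>M\<^esub> x) = r \<odot>\<^bsub>N\<^esub> f x"
  shows "f \<in> linear_maps k M N"
  using assms by (auto simp: linear_maps_def)

lemma linear_mapsD:
  assumes "f \<in> linear_maps k M N"
  shows "x \<in> carrier M \<Longrightarrow> f x \<in> carrier N"
    and "x \<in> carrier M \<Longrightarrow> y \<in> carrier M \<Longrightarrow> f (x \<oplus>\<^bsub>M\<^esub> y) = f x \<oplus>\<^bsub>N\<^esub> f y"
    and "r \<in> carrier k \<Longrightarrow> x \<in> carrier M \<Longrightarrow> f (r \<odot>\<^bsub>M\<^esub> x) = r \<odot>\<^bsub>N\<^esub> f x"
  using assms by (auto simp: linear_maps_def)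

lemma linear_maps_zero:
  assumes "module k M" "module k N" "f \<in> linear_maps k M N"
  shows "f \<zero>\<^bsub>M\<^esub> = \<zero>\<^bsub>N\<^esub>"
proof -
  interpret M: module k M by fact
  interpret N: module k N by fact
  have "f (\<zero>\<^bsub>k\<^esub> \<odot>\<^bsub>M\<^esub> \<zero>\<^bsub>M\<^esub>) = \<zero>\<^bsub>k\<^esub> \<odot>\<^bsub>N\<^esub> f \<zero>\<^bsub>M\<^esub>"
    using assms(3) by (simp add: linear_mapsD(3) del: M.smult_l_null N.smult_l_null M.smult_r_null)
  with linear_mapsD(1)[OF assms(3)] show ?thesis by simp
qed

lemma linear_maps_psum:
  assumes "module k M" "module k N" "f \<in> linear_maps k M N"
    and "set ps \<subseteq> A \<times> B" "\<And>a b. a \<in> A \<Longrightarrow> b \<in> B \<Longrightarrow> g a b \<in> carrier M"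
  shows "f (psum M g ps) = psum N (\<lambda>a b. f (g a b)) ps"
  using psum_hom[OF assms(4,5) _ linear_maps_zero[OF assms(1-3)] linear_mapsD(2)[OF assms(3)]]
    assms(1) by (simp add: module_def abelian_group_def)

lemma linear_maps_comp:
  "f \<in> linear_maps k M N \<Longrightarrow> g \<in> linear_maps k N P \<Longrightarrow> (\<lambda>x. g (f x)) \<in> linear_maps k M P"
  by (auto simp: linear_maps_def Pi_iff)

definition bilinear_maps ::
  "'k ring \<Rightarrow> ('k, 'a) module \<Rightarrow> ('k, 'b) module \<Rightarrow> ('k, 'c) module \<Rightarrow> ('a \<Rightarrow> 'b \<Rightarrow> 'c) set" where
  "bilinear_maps k M N P =
     {f. (\<forall>a\<in>carrier M. f a \<in> linear_maps k N P) \<and>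
         (\<forall>b\<in>carrier N. (\<lambda>a. f a b) \<in> linear_maps k M P)}"

lemma bilinear_mapsI:
  assumes "\<And>b. b \<in> carrier N \<Longrightarrow> (\<lambda>a. f a b) \<in> linear_maps k M P"
    and "\<And>a. a \<in> carrier M \<Longrightarrow> (\<lambda>b. f a b) \<in> linear_maps k N P"
  shows "f \<in> bilinear_maps k M N P"
  using assms by (auto simp: bilinear_maps_def)

lemma bilinear_mapsD:
  assumes "f \<in> bilinear_maps k M N P"
  shows "a \<in> carrier M \<Longrightarrow> f a \<in> linear_maps k N P"
    and "b \<in> carrier N \<Longrightarrow> (\<lambda>a. f a b) \<in> linear_maps k M P"
    and "a \<in> carrier M \<Longrightarrow> b \<in> carrier N \<Longrightarrow> f a b \<in> carrier P"
  using assms by (auto simp: bilinear_maps_def linear_maps_def)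

lemma linear_psum:
  assumes "module k P" "set ps \<subseteq> A \<times> B" "\<And>a b. a \<in> A \<Longrightarrow> b \<in> B \<Longrightarrow> f a b \<in> linear_maps k M P"
  shows "(\<lambda>x. psum P (\<lambda>a b. f a b x) ps) \<in> linear_maps k M P"
proof -
  interpret P: module k P by fact
  note f = linear_mapsD[OF assms(3)]
  show ?thesis
  proof (rule linear_mapsI)
    fix r x assume r: "r \<in> carrier k" "x \<in> carrier M"
    have "psum P (\<lambda>a b. f a b (r \<odot>\<^bsub>M\<^esub> x)) ps = psum P (\<lambda>a b. r \<odot>\<^bsub>P\<^esub> f a b x) ps"
      by (rule psum_cong[OF assms(2)]) (simp add: f r)
    also have "\<dots> = r \<odot>\<^bsub>P\<^esub> psum P (\<lambda>a b. f a b x) ps"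
      using psum_hom[OF assms(2), of "\<lambda>a b. f a b x" P "\<lambda>x. r \<odot>\<^bsub>P\<^esub> x" P] f r P.abelian_monoid_axioms
      by (simp add: P.smult_r_distr)
    finally show "psum P (\<lambda>a b. f a b (r \<odot>\<^bsub>M\<^esub> x)) ps = r \<odot>\<^bsub>P\<^esub> psum P (\<lambda>a b. f a b x) ps" .
  next
    fix x y assume x: "x \<in> carrier M" "y \<in> carrier M"
    have "psum P (\<lambda>a b. f a b (x \<oplus>\<^bsub>M\<^esub> y)) ps = psum P (\<lambda>a b. f a b x \<oplus>\<^bsub>P\<^esub> f a b y) ps"
      by (rule psum_cong[OF assms(2)]) (simp add: f x)
    then show "psum P (\<lambda>a b. f a b (x \<oplus>\<^bsub>M\<^esub> y)) ps = psum P (\<lambda>a b. f a b x) ps \<oplus>\<^bsub>P\<^esub> psum P (\<lambda>a b. f a b y) ps"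
      using P.psum_add[OF assms(2), of "\<lambda>a b. f a b x" "\<lambda>a b. f a b y"] by (simp add: f x)
  qed (rule P.psum_closed[OF assms(2)], simp add: f)
qed

section \<open>The tensor product\<close>

locale two_modules = M: module k M + N: module k N
  for k :: "'k ring" and M :: "('k, 'a) module" and N :: "('k, 'b) module"
begin

abbreviation "F \<equiv> tensor_free M N"
abbreviation "Z \<equiv> tensor_null k M N"
abbreviation "T \<equiv> tensor k M N"
abbreviation "cls \<equiv> tensor_class k M N"
abbreviation pt (infixl "\<otimes>\<^sub>t" 75) where "a \<otimes>\<^sub>t b \<equiv> pure_tensor k M N a b"

lemma F_simps [simp]:
  "x \<in> carrier F \<longleftrightarrow> Poly_Mapping.keys x \<subseteq> carrier M \<times> carrier N"
  "\<one>\<^bsub>F\<^esub> = 0" "x \<otimes>\<^bsub>F\<^esub> y = x + y"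
  by (auto simp: tensor_free_def)

lemma comm_group_F: "comm_group F"
  by (simp add: tensor_free_def abelian_free_Abelian_group)

sublocale F: comm_group F by (rule comm_group_F)

lemma F_inv: "x \<in> carrier F \<Longrightarrow> inv\<^bsub>F\<^esub> x = - x"
  by (simp add: tensor_free_def)

lemma F_diff: "x \<in> carrier F \<Longrightarrow> y \<in> carrier F \<Longrightarrow> x - y \<in> carrier F"
  using F.m_closed[OF _ F.inv_closed, of x y] by (simp add: F_inv)

lemma F_add: "x \<in> carrier F \<Longrightarrow> y \<in> carrier F \<Longrightarrow> x + y \<in> carrier F"
  using F.m_closed by simp

lemma frag_of_F: "a \<in> carrier M \<Longrightarrow> b \<in> carrier N \<Longrightarrow> frag_of (a, b) \<in> carrier F"
  by simp

lemma relations_subset: "tensor_relations k M N \<subseteq> carrier F"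
  unfolding tensor_relations_def
  by (auto intro!: F_diff[unfolded F_simps] frag_of_F[unfolded F_simps] M.smult_closed N.smult_closed dest!: set_mp[OF keys_diff] )

lemma subgroup_Z: "subgroup Z F"
  unfolding tensor_null_def by (rule F.generate_is_subgroup[OF relations_subset])

lemma normal_Z: "Z \<lhd> F"
  using F.normal_iff_subgroup subgroup_Z by blast

sublocale Z: normal Z F by (rule normal_Z)

lemma relation_in_Z: "x \<in> tensor_relations k M N \<Longrightarrow> x \<in> Z"
  unfolding tensor_null_def by (rule generate.incl)

lemma cls_eqI:
  assumes "x \<in> carrier F" "y \<in> carrier F" "x - y \<in> Z"
  shows "cls x = cls y"
proof -
  have "x = (x - y) \<otimes>\<^bsub>F\<^esub> y" by simp
  then have "x \<in> Z #>\<^bsub>F\<^esub> y" using assms(3) unfolding r_coset_def by blast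
  then show ?thesis
    unfolding tensor_class_def using F.repr_independence[OF _ assms(2) subgroup_Z] by metis
qed

lemma cls_memD:
  assumes "y \<in> carrier F" "x \<in> cls y"
  shows "x - y \<in> Z" "x \<in> carrier F"
proof -
  obtain z where "z \<in> Z" "x = z + y" using assms(2) by (auto simp: tensor_class_def r_coset_def)
  then show "x - y \<in> Z" "x \<in> carrier F" using F_add Z.mem_carrier assms(1) by auto
qed

lemma cls_self: "x \<in> carrier F \<Longrightarrow> x \<in> cls x"
  unfolding tensor_class_def using F.rcos_self[OF _ subgroup_Z] by simp

lemma T_carrier: "carrier T = cls ` carrier F"
  by (auto simp: tensor_def FactGroup_def RCOSETS_def tensor_class_def)

lemma T_carrierE:
  assumes "X \<in> carrier T" obtains x where "x \<in> carrier F" "X = cls x"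
  using assms T_carrier by blast

lemma T_add: "x \<in> carrier F \<Longrightarrow> y \<in> carrier F \<Longrightarrow> cls x \<oplus>\<^bsub>T\<^esub> cls y = cls (x + y)"
  using Z.rcos_sum[of x y] by (simp add: tensor_def FactGroup_def tensor_class_def)

lemma T_zero: "\<zero>\<^bsub>T\<^esub> = cls 0"
  using F.coset_mult_one[of Z] Z.subset by (simp add: tensor_def FactGroup_def tensor_class_def)

lemma abelian_group_T: "abelian_group T"
proof (rule abelian_groupI)
  fix X assume "X \<in> carrier T"
  then obtain x where x: "x \<in> carrier F" "X = cls x" by (rule T_carrierE)
  show "\<exists>Y\<in>carrier T. Y \<oplus>\<^bsub>T\<^esub> X = \<zero>\<^bsub>T\<^esub>"
    using x F_inv[OF x(1)] F.inv_closed[OF x(1)]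
    by (intro bexI[of _ "cls (- x)"]) (auto simp: T_add T_zero T_carrier simp del: F_simps)
next
  have [simp]: "0 \<in> carrier F" by simp
  show "\<zero>\<^bsub>T\<^esub> \<in> carrier T" by (auto simp: T_zero T_carrier simp del: F_simps)
  fix X Y W assume "X \<in> carrier T" "Y \<in> carrier T" "W \<in> carrier T"
  then show "X \<oplus>\<^bsub>T\<^esub> Y \<oplus>\<^bsub>T\<^esub> W = X \<oplus>\<^bsub>T\<^esub> (Y \<oplus>\<^bsub>T\<^esub> W)"
    by (auto elim!: T_carrierE simp: T_add F_add add_ac simp del: F_simps)
next
  fix X Y assume "X \<in> carrier T" "Y \<in> carrier T"
  then show "X \<oplus>\<^bsub>T\<^esub> Y \<in> carrier T"  "X \<oplus>\<^bsub>T\<^esub> Y = Y \<oplus>\<^bsub>T\<^esub> X"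
    by (auto elim!: T_carrierE simp: T_carrier T_add F_add add_ac simp del: F_simps)
next
  fix X assume "X \<in> carrier T"
  moreover have "0 \<in> carrier F" by simp
  ultimately show "\<zero>\<^bsub>T\<^esub> \<oplus>\<^bsub>T\<^esub> X = X"
    by (auto elim!: T_carrierE simp: T_add T_zero simp del: F_simps)
qed

sublocale T: abelian_group T by (rule abelian_group_T)

lemma pt_closed [simp, intro]: "a \<in> carrier M \<Longrightarrow> b \<in> carrier N \<Longrightarrow> a \<otimes>\<^sub>t b \<in> carrier T"
  using frag_of_F by (auto simp: pure_tensor_def T_carrier simp del: F_simps)

lemma cls_relation3:
  assumes "x \<in> carrier F" "y \<in> carrier F" "z \<in> carrier F" "x - y - z \<in> Z"
  shows "cls x = cls y \<oplus>\<^bsub>T\<^esub> cls z"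
  using assms cls_eqI[of x "y + z"] F_add[OF assms(2,3)] by (simp add: T_add diff_diff_eq del: F_simps)

lemma pt_add_left:
  assumes "a \<in> carrier M" "a' \<in> carrier M" "b \<in> carrier N"
  shows "(a \<oplus>\<^bsub>M\<^esub> a') \<otimes>\<^sub>t b = a \<otimes>\<^sub>t b \<oplus>\<^bsub>T\<^esub> a' \<otimes>\<^sub>t b"
  unfolding pure_tensor_def using assms
  by (intro cls_relation3 frag_of_F relation_in_Z) (auto simp: tensor_relations_def)

lemma pt_add_right:
  assumes "a \<in> carrier M" "b \<in> carrier N" "b' \<in> carrier N"
  shows "a \<otimes>\<^sub>t (b \<oplus>\<^bsub>N\<^esub> b') = a \<otimes>\<^sub>t b \<oplus>\<^bsub>T\<^esub> a \<otimes>\<^sub>t b'"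
  unfolding pure_tensor_def using assms
  by (intro cls_relation3 frag_of_F relation_in_Z) (auto simp: tensor_relations_def)

lemma pt_balanced:
  assumes "a \<in> carrier M" "b \<in> carrier N" "r \<in> carrier k"
  shows "(r \<odot>\<^bsub>M\<^esub> a) \<otimes>\<^sub>t b = a \<otimes>\<^sub>t (r \<odot>\<^bsub>N\<^esub> b)"
  unfolding pure_tensor_def using assms
  by (intro cls_eqI frag_of_F relation_in_Z) (auto simp: tensor_relations_def)

lemma pt_balanced_smult:
  assumes "a \<in> carrier M" "b \<in> carrier N" "r \<in> carrier k" "s \<in> carrier k"
  shows "(r \<odot>\<^bsub>M\<^esub> (s \<odot>\<^bsub>M\<^esub> a)) \<otimes>\<^sub>t b = (r \<odot>\<^bsub>M\<^esub> a) \<otimes>\<^sub>t (s \<odot>\<^bsub>N\<^esub> b)"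
  using assms pt_balanced[of "r \<odot>\<^bsub>M\<^esub> a" b s] by (simp add: M.smult_assoc1[symmetric] M.R.m_comm)

lemma pt_uminus:
  assumes "a \<in> carrier M" "b \<in> carrier N"
  shows "(\<ominus>\<^bsub>M\<^esub> a) \<otimes>\<^sub>t b \<oplus>\<^bsub>T\<^esub> a \<otimes>\<^sub>t b = \<zero>\<^bsub>T\<^esub>"
proof -
  have "\<zero>\<^bsub>M\<^esub> \<otimes>\<^sub>t b \<oplus>\<^bsub>T\<^esub> \<zero>\<^bsub>M\<^esub> \<otimes>\<^sub>t b = \<zero>\<^bsub>M\<^esub> \<otimes>\<^sub>t b"
    using pt_add_left[of "\<zero>\<^bsub>M\<^esub>" "\<zero>\<^bsub>M\<^esub>" b] assms by simp
  then have "\<zero>\<^bsub>M\<^esub> \<otimes>\<^sub>t b = \<zero>\<^bsub>T\<^esub>" using assms by (simp add: T.add.l_cancel_one)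
  then show ?thesis using pt_add_left[of "\<ominus>\<^bsub>M\<^esub> a" a b] assms by (simp add: M.l_neg)
qed

text \<open>
  A formal difference of pairs is a formal sum, as \<open>-(a \<otimes> b) = (-a) \<otimes> b\<close>; so lists suffice and
  no integer coefficients have to be carried along.
\<close>

lemma T_psum:
  assumes "X \<in> carrier T"
  obtains ps where "set ps \<subseteq> carrier M \<times> carrier N" "X = psum T (\<otimes>\<^sub>t) ps"
proof -
  obtain x where x: "x \<in> carrier F" "X = cls x" using assms by (rule T_carrierE)
  from x(1) have "Poly_Mapping.keys x \<subseteq> carrier M \<times> carrier N" by simp
  then have "x \<in> carrier F \<and> (\<exists>ps. set ps \<subseteq> carrier M \<times> carrier N \<and> cls x = psum T (\<otimes>\<^sub>t) ps)"
  proof (induction x rule: frag_induction)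
    case zero
    show ?case by (auto intro!: exI[of _ "[]"] simp: T_zero)
  next
    case (one p)
    then show ?case
      by (cases p) (auto intro!: exI[of _ "[p]"] simp: pure_tensor_def[symmetric])
  next
    case (diff x y)
    then obtain ps qs where ps: "x \<in> carrier F" "y \<in> carrier F"
      "set ps \<subseteq> carrier M \<times> carrier N" "cls x = psum T (\<otimes>\<^sub>t) ps"
      "set qs \<subseteq> carrier M \<times> carrier N" "cls y = psum T (\<otimes>\<^sub>t) qs" by blast
    (* Negation of a tensor is moved into the first factors. *)
    let ?qs = "map (\<lambda>(a, b). (\<ominus>\<^bsub>M\<^esub> a, b)) qs"
    have *: "set ?qs \<subseteq> carrier M \<times> carrier N" using ps by auto
    have xy: "x - y \<in> carrier F" by (rule F_diff) (use ps in auto)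
    have "psum T (\<otimes>\<^sub>t) ?qs \<oplus>\<^bsub>T\<^esub> psum T (\<otimes>\<^sub>t) qs = psum T (\<lambda>a b. \<zero>\<^bsub>T\<^esub>) qs"
      unfolding psum_map
      by (subst T.psum_add[symmetric, OF ps(5)], simp_all) (rule psum_cong[OF ps(5)], simp add: pt_uminus)
    then have "psum T (\<otimes>\<^sub>t) ?qs \<oplus>\<^bsub>T\<^esub> cls y = \<zero>\<^bsub>T\<^esub>"
      by (simp add: ps T.psum_zero)
    moreover have "cls (x - y) \<oplus>\<^bsub>T\<^esub> cls y = cls x"
      using xy ps by (subst T_add) auto
    moreover have "cls y \<in> carrier T" "cls x \<in> carrier T" "cls (x - y) \<in> carrier T"
      using xy ps(1,2) by (auto simp: T_carrier simp del: F_simps)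
    moreover have "psum T (\<otimes>\<^sub>t) ?qs \<in> carrier T"
      by (rule T.psum_closed[OF *]) auto
    ultimately have "cls (x - y) = cls x \<oplus>\<^bsub>T\<^esub> psum T (\<otimes>\<^sub>t) ?qs"
      by (metis T.add.m_assoc T.add.m_comm T.r_zero)
    also have "\<dots> = psum T (\<otimes>\<^sub>t) (ps @ ?qs)"
      using ps by (subst T.psum_append[OF ps(3) *]) auto
    finally show ?case using * ps(3) xy by (intro conjI exI[of _ "ps @ ?qs"]) auto
  qed
  then show ?thesis using that x by blast
qed

lemma T_psum_closed: "set ps \<subseteq> carrier M \<times> carrier N \<Longrightarrow> psum T (\<otimes>\<^sub>t) ps \<in> carrier T"
  by (rule T.psum_closed) auto

lemma formal_sum_eval_F:
  assumes "abelian_group P" "\<And>a b. a \<in> carrier M \<Longrightarrow> b \<in> carrier N \<Longrightarrow> f a b \<in> carrier P"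
  shows "formal_sum_eval P f \<in> hom F (add_monoid P)"
    and "a \<in> carrier M \<Longrightarrow> b \<in> carrier N \<Longrightarrow> formal_sum_eval P f (frag_of (a, b)) = f a b"
proof -
  interpret P: abelian_group P by fact
  have zero: "[(0::int)] \<cdot>\<^bsub>P\<^esub> x = \<zero>\<^bsub>P\<^esub>" for x
    by (simp add: add_pow_def int_pow_def nat_pow_def)
  have ext: "formal_sum_eval P f x = (\<Oplus>\<^bsub>P\<^esub>p\<in>K. [Poly_Mapping.lookup x p] \<cdot>\<^bsub>P\<^esub> f (fst p) (snd p))"
    if "finite K" "Poly_Mapping.keys x \<subseteq> K" "K \<subseteq> carrier M \<times> carrier N" for K x
    unfolding formal_sum_eval_def using that assms(2)
    by (intro P.add.finprod_mono_neutral_cong_left) (auto simp: in_keys_iff zero P.add.int_pow_closed)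
  show "formal_sum_eval P f \<in> hom F (add_monoid P)"
  proof (rule homI)
    fix x assume x: "x \<in> carrier F"
    then show "formal_sum_eval P f x \<in> carrier (add_monoid P)"
      unfolding formal_sum_eval_def using assms(2) by (auto intro!: P.finsum_closed P.add.int_pow_closed)
    fix y assume y: "y \<in> carrier F"
    let ?K = "Poly_Mapping.keys x \<union> Poly_Mapping.keys y"
    have K: "finite ?K" "?K \<subseteq> carrier M \<times> carrier N" using x y by auto
    have "Poly_Mapping.keys (x + y) \<subseteq> ?K" by (rule keys_add)
    then have "formal_sum_eval P f (x + y) = (\<Oplus>\<^bsub>P\<^esub>p\<in>?K. [Poly_Mapping.lookup (x + y) p] \<cdot>\<^bsub>P\<^esub> f (fst p) (snd p))"
      using K by (intro ext) auto
    also have "\<dots> = (\<Oplus>\<^bsub>P\<^esub>p\<in>?K. [Poly_Mapping.lookup x p] \<cdot>\<^bsub>P\<^esub> f (fst p) (snd p) \<oplus>\<^bsub>P\<^esub> [Poly_Mapping.lookup y p] \<cdot>\<^bsub>P\<^esub> f (fst p) (snd p))"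
    proof (rule P.finsum_cong', rule refl)
      show "(\<lambda>p. [Poly_Mapping.lookup x p] \<cdot>\<^bsub>P\<^esub> f (fst p) (snd p) \<oplus>\<^bsub>P\<^esub> [Poly_Mapping.lookup y p] \<cdot>\<^bsub>P\<^esub> f (fst p) (snd p)) \<in> ?K \<rightarrow> carrier P"
        using K(2) assms(2) by (auto intro!: P.add.m_closed P.add.int_pow_closed)
    next
      fix p assume "p \<in> ?K"
      then have "p \<in> carrier M \<times> carrier N" using K(2) by blast
      then have "f (fst p) (snd p) \<in> carrier P" using assms(2) by auto
      then show "[Poly_Mapping.lookup (x + y) p] \<cdot>\<^bsub>P\<^esub> f (fst p) (snd p) = [Poly_Mapping.lookup x p] \<cdot>\<^bsub>P\<^esub> f (fst p) (snd p) \<oplus>\<^bsub>P\<^esub> [Poly_Mapping.lookup y p] \<cdot>\<^bsub>P\<^esub> f (fst p) (snd p)"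
        by (simp add: lookup_add P.add.int_pow_mult)
    qed
    also have "\<dots> = formal_sum_eval P f x \<oplus>\<^bsub>P\<^esub> formal_sum_eval P f y"
      using K assms(2) by (subst P.finsum_addf) (auto intro!: P.add.int_pow_closed arg_cong2[where f="add P"] ext[symmetric])
    finally show "formal_sum_eval P f (x \<otimes>\<^bsub>F\<^esub> y) = formal_sum_eval P f x \<otimes>\<^bsub>add_monoid P\<^esub> formal_sum_eval P f y"
      by simp
  qed
  show "formal_sum_eval P f (frag_of (a, b)) = f a b" if "a \<in> carrier M" "b \<in> carrier N"
    using assms(2)[OF that] by (simp add: formal_sum_eval_def P.finsum_insert)
qed

text \<open>
  The target is an abelian group, so that the scalar multiplication of \<open>M \<otimes> N\<close> can be recognised as
  such a lift before \<open>M \<otimes> N\<close> is known to be a module. The relations evaluate to zero, whence all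
  representatives of a tensor have the same value.
\<close>

lemma tensor_lift_general:
  assumes "abelian_group P" "\<And>a b. a \<in> carrier M \<Longrightarrow> b \<in> carrier N \<Longrightarrow> f a b \<in> carrier P"
    and add1: "\<And>a a' b. a \<in> carrier M \<Longrightarrow> a' \<in> carrier M \<Longrightarrow> b \<in> carrier N \<Longrightarrow> f (a \<oplus>\<^bsub>M\<^esub> a') b = f a b \<oplus>\<^bsub>P\<^esub> f a' b"
    and add2: "\<And>a b b'. a \<in> carrier M \<Longrightarrow> b \<in> carrier N \<Longrightarrow> b' \<in> carrier N \<Longrightarrow> f a (b \<oplus>\<^bsub>N\<^esub> b') = f a b \<oplus>\<^bsub>P\<^esub> f a b'"
    and bal: "\<And>r a b. r \<in> carrier k \<Longrightarrow> a \<in> carrier M \<Longrightarrow> b \<in> carrier N \<Longrightarrow> f (r \<odot>\<^bsub>M\<^esub> a) b = f a (r \<odot>\<^bsub>N\<^esub> b)"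
  shows tensor_lift_cls: "\<And>x. x \<in> carrier F \<Longrightarrow> tensor_lift P f (cls x) = formal_sum_eval P f x"
    and tensor_lift_closed: "\<And>X. X \<in> carrier T \<Longrightarrow> tensor_lift P f X \<in> carrier P"
    and tensor_lift_add: "\<And>X Y. X \<in> carrier T \<Longrightarrow> Y \<in> carrier T \<Longrightarrow>
      tensor_lift P f (X \<oplus>\<^bsub>T\<^esub> Y) = tensor_lift P f X \<oplus>\<^bsub>P\<^esub> tensor_lift P f Y"
    and tensor_lift_pt: "\<And>a b. a \<in> carrier M \<Longrightarrow> b \<in> carrier N \<Longrightarrow> tensor_lift P f (a \<otimes>\<^sub>t b) = f a b"
    and tensor_lift_psum: "\<And>ps. set ps \<subseteq> carrier M \<times> carrier N \<Longrightarrow>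
      tensor_lift P f (psum T (\<otimes>\<^sub>t) ps) = psum P f ps"
proof -
  interpret P: abelian_group P by fact
  let ?e = "formal_sum_eval P f"
  interpret e: group_hom F "add_monoid P" ?e
    by (intro group_hom.intro group_hom_axioms.intro F.is_group P.add.is_group formal_sum_eval_F(1) assms)
  note one = formal_sum_eval_F(2)[OF assms(1,2)]
  have diff: "?e (x - y) = ?e x \<ominus>\<^bsub>P\<^esub> ?e y" if "x \<in> carrier F" "y \<in> carrier F" for x y
    using e.hom_mult[of x "inv\<^bsub>F\<^esub> y"] e.hom_inv[of y] that F_inv[OF that(2)] F.inv_closed[OF that(2)]
    by (simp add: a_minus_def a_inv_def del: F_simps(1))
  have cancel: "x \<oplus>\<^bsub>P\<^esub> y \<ominus>\<^bsub>P\<^esub> x \<ominus>\<^bsub>P\<^esub> y = \<zero>\<^bsub>P\<^esub>" if "x \<in> carrier P" "y \<in> carrier P" for x y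
    using that P.r_neg[of "x \<oplus>\<^bsub>P\<^esub> y"] by (simp add: a_minus_def P.minus_add P.a_assoc)
  have rel: "?e x = \<zero>\<^bsub>P\<^esub>" if "x \<in> tensor_relations k M N" for x
    using that unfolding tensor_relations_def
    apply (elim UnE CollectE exE conjE)
    subgoal for a a' b
      using add1[of a a' b] assms(2)[of a b] assms(2)[of a' b]
      by (simp only: diff F_diff frag_of_F one M.a_closed)
         (simp add: cancel)
    subgoal for a b b'
      using add2[of a b b'] assms(2)[of a b] assms(2)[of a b']
      by (simp only: diff F_diff frag_of_F one N.a_closed)
         (simp add: cancel)
    subgoal for r a b
      using bal[of r a b] assms(2)[of a "r \<odot>\<^bsub>N\<^esub> b"]
      by (simp only: diff F_diff frag_of_F one M.smult_closed N.smult_closed) (simp add: a_minus_def P.r_neg)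
    done
  have Z: "?e x = \<zero>\<^bsub>P\<^esub>" if "x \<in> Z" for x
    using that unfolding tensor_null_def
  proof (induction rule: generate.induct)
    case one then show ?case using e.hom_one by simp
  next
    case (incl h) then show ?case by (rule rel)
  next
    case (inv h)
    then have "h \<in> carrier F" using relations_subset by blast
    then have "?e (inv\<^bsub>F\<^esub> h) = \<ominus>\<^bsub>P\<^esub> ?e h" using e.hom_inv[of h] by (simp add: a_inv_def)
    then show ?case using rel[OF inv] by simp
  next
    case (eng h1 h2)
    then have "h1 \<in> carrier F" "h2 \<in> carrier F" using Z.mem_carrier by (auto simp: tensor_null_def)
    then show ?case using e.hom_mult[of h1 h2] eng by simp
  qed
  show cls: "tensor_lift P f (cls x) = ?e x" if x: "x \<in> carrier F" for x
  proof -
    have "?e y = ?e x" if "y \<in> cls x" for y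
    proof -
      note y = cls_memD[OF x that]
      have "?e y = ?e ((y - x) + x)" by simp
      also have "\<dots> = \<zero>\<^bsub>P\<^esub> \<oplus>\<^bsub>P\<^esub> ?e x"
        using e.hom_mult[of "y - x" x] y x Z[OF y(1)] Z.mem_carrier[OF y(1)] by simp
      finally show ?thesis using e.hom_closed[OF x] by simp
    qed
    then have "?e ` cls x = {?e x}" using cls_self[OF x] by blast
    then show ?thesis by (simp add: tensor_lift_def)
  qed
  show closed: "tensor_lift P f X \<in> carrier P" if "X \<in> carrier T" for X
    using that e.hom_closed by (auto elim!: T_carrierE simp: cls simp del: F_simps)
  show add: "tensor_lift P f (X \<oplus>\<^bsub>T\<^esub> Y) = tensor_lift P f X \<oplus>\<^bsub>P\<^esub> tensor_lift P f Y"
    if "X \<in> carrier T" "Y \<in> carrier T" for X Y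
    using that e.hom_mult by (auto elim!: T_carrierE simp: cls T_add F_add simp del: F_simps(1))
  show pt: "tensor_lift P f (a \<otimes>\<^sub>t b) = f a b" if "a \<in> carrier M" "b \<in> carrier N" for a b
    using that by (simp add: pure_tensor_def cls frag_of_F one del: F_simps)
  show "tensor_lift P f (psum T (\<otimes>\<^sub>t) ps) = psum P f ps" if ps: "set ps \<subseteq> carrier M \<times> carrier N" for ps
  proof -
    have "tensor_lift P f \<zero>\<^bsub>T\<^esub> \<oplus>\<^bsub>P\<^esub> tensor_lift P f \<zero>\<^bsub>T\<^esub> = tensor_lift P f \<zero>\<^bsub>T\<^esub>"
      using add[of "\<zero>\<^bsub>T\<^esub>" "\<zero>\<^bsub>T\<^esub>"] by simp
    then have "tensor_lift P f \<zero>\<^bsub>T\<^esub> = \<zero>\<^bsub>P\<^esub>" using closed by (simp add: P.add.l_cancel_one)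
    then have "tensor_lift P f (psum T (\<otimes>\<^sub>t) ps) = psum P (\<lambda>a b. tensor_lift P f (a \<otimes>\<^sub>t b)) ps"
      using psum_hom[OF ps, of "(\<otimes>\<^sub>t)" T "tensor_lift P f" P] add T.abelian_monoid_axioms by simp
    also have "\<dots> = psum P f ps" by (rule psum_cong[OF ps]) (simp add: pt)
    finally show ?thesis .
  qed
qed

text \<open>
  Both the scalar multiplication and the product of tensors are defined by extending a map \<open>G\<close> of
  pairs additively to representatives. Modulo the relations such an extension is an evaluation of formal
  sums, and evaluations have been seen to be independent of the representative.
\<close>

lemma cls_frag_extend:
  assumes G: "\<And>a b. a \<in> carrier M \<Longrightarrow> b \<in> carrier N \<Longrightarrow> G (a, b) \<in> carrier F" and x: "x \<in> carrier F"
  shows "frag_extend G x \<in> carrier F"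
    and "cls (frag_extend G x) = formal_sum_eval T (\<lambda>a b. cls (G (a, b))) x"
proof -
  let ?f = "\<lambda>a b. cls (G (a, b))"
  have f: "?f a b \<in> carrier T" if "a \<in> carrier M" "b \<in> carrier N" for a b
    using G[OF that] by (auto simp: T_carrier simp del: F_simps)
  interpret e: group_hom F "add_monoid T" "formal_sum_eval T ?f"
    by (intro group_hom.intro group_hom_axioms.intro F.is_group T.add.is_group formal_sum_eval_F(1) abelian_group_T f)
  from x have "Poly_Mapping.keys x \<subseteq> carrier M \<times> carrier N" by simp
  then have "x \<in> carrier F \<and> frag_extend G x \<in> carrier F \<and> cls (frag_extend G x) = formal_sum_eval T ?f x"
  proof (induction x rule: frag_induction)
    case zero
    then show ?case using e.hom_one T_zero by simp
  next
    case (one p)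
    obtain a b where p: "p = (a, b)" "a \<in> carrier M" "b \<in> carrier N" using one by blast
    show ?case
      using formal_sum_eval_F(2)[OF abelian_group_T f p(2,3)] G[OF p(2,3)] frag_of_F[OF p(2,3)] p
      by (simp del: F_simps)
  next
    case (diff x y)
    have xy: "x - y \<in> carrier F" "frag_extend G (x - y) \<in> carrier F"
      using diff by (simp_all add: F_diff frag_extend_diff del: F_simps)
    then have "cls (frag_extend G (x - y)) \<oplus>\<^bsub>T\<^esub> cls (frag_extend G y) = cls (frag_extend G (x - y) + frag_extend G y)"
      using diff by (intro T_add) auto
    then have "cls (frag_extend G (x - y)) \<oplus>\<^bsub>T\<^esub> cls (frag_extend G y) = cls (frag_extend G x)"
      by (simp add: frag_extend_diff)
    moreover have "formal_sum_eval T ?f (x - y) \<oplus>\<^bsub>T\<^esub> formal_sum_eval T ?f y = formal_sum_eval T ?f x"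
      using e.hom_mult[of "x - y" y] xy diff by (simp del: F_simps(1))
    moreover have "cls (frag_extend G (x - y)) \<in> carrier T" using xy by (auto simp: T_carrier simp del: F_simps)
    moreover have "formal_sum_eval T ?f z \<in> carrier T" if "z \<in> carrier F" for z
      using e.hom_closed[OF that] by simp
    ultimately show ?case using diff xy by (metis T.add.right_cancel)
  qed
  then show "frag_extend G x \<in> carrier F" "cls (frag_extend G x) = formal_sum_eval T ?f x" by auto
qed

lemma formal_sum_eval_cong:
  assumes "abelian_group P" "\<And>a b. a \<in> carrier M \<Longrightarrow> b \<in> carrier N \<Longrightarrow> f a b \<in> carrier P"
    and "\<And>a b. a \<in> carrier M \<Longrightarrow> b \<in> carrier N \<Longrightarrow> g a b = f a b" and "x \<in> carrier F"
  shows "formal_sum_eval P g x = formal_sum_eval P f x"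
proof -
  interpret P: abelian_group P by fact
  show ?thesis
    unfolding formal_sum_eval_def
    using assms(4) by (intro P.finsum_cong') (auto intro!: P.add.int_pow_closed simp: assms(2,3))
qed

lemma T_smult:
  assumes "r \<in> carrier k" "X \<in> carrier T"
  shows "r \<odot>\<^bsub>T\<^esub> X = tensor_lift T (\<lambda>a b. (r \<odot>\<^bsub>M\<^esub> a) \<otimes>\<^sub>t b) X"
proof -
  let ?f = "\<lambda>a b. (r \<odot>\<^bsub>M\<^esub> a) \<otimes>\<^sub>t b" and ?s = "\<lambda>x. frag_extend (\<lambda>(a, b). frag_of (r \<odot>\<^bsub>M\<^esub> a, b)) x"
  have f: "?f a b \<in> carrier T" if "a \<in> carrier M" "b \<in> carrier N" for a b
    using that assms(1) by simp
  have lift: "tensor_lift T ?f (cls x) = formal_sum_eval T ?f x" if "x \<in> carrier F" for x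
    using that assms(1)
    by (intro tensor_lift_cls abelian_group_T f)
       (auto simp: M.smult_r_distr pt_add_left pt_add_right pt_balanced_smult simp del: F_simps)
  have cls: "cls (?s x) = formal_sum_eval T ?f x" if "x \<in> carrier F" for x
    using cls_frag_extend[of "\<lambda>(a, b). frag_of (r \<odot>\<^bsub>M\<^esub> a, b)", OF _ that] assms(1)
    by (simp add: pure_tensor_def)
  obtain x where x: "x \<in> carrier F" "X = cls x" using assms(2) by (rule T_carrierE)
  have "cls (?s y) = tensor_lift T ?f X" if "y \<in> X" for y
    using cls[of y] lift[of y] cls_memD[OF x(1), of y] cls_eqI[of y x] that x by (simp del: F_simps)
  then have "(\<Union>y\<in>X. cls (?s y)) = tensor_lift T ?f X"
    using cls_self[OF x(1)] x(2) by blast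
  then show ?thesis by (simp add: tensor_def)
qed

lemma T_smult_pt:
  assumes "r \<in> carrier k" "a \<in> carrier M" "b \<in> carrier N"
  shows "r \<odot>\<^bsub>T\<^esub> (a \<otimes>\<^sub>t b) = (r \<odot>\<^bsub>M\<^esub> a) \<otimes>\<^sub>t b"
  using assms
  by (subst T_smult, simp, simp, subst tensor_lift_pt[OF abelian_group_T])
     (auto simp: M.smult_r_distr pt_add_left pt_add_right pt_balanced_smult)

lemma T_smult_psum:
  assumes "r \<in> carrier k" "set ps \<subseteq> carrier M \<times> carrier N"
  shows "r \<odot>\<^bsub>T\<^esub> psum T (\<otimes>\<^sub>t) ps = psum T (\<lambda>a b. (r \<odot>\<^bsub>M\<^esub> a) \<otimes>\<^sub>t b) ps"
  using assms T_psum_closed[OF assms(2)]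
  by (subst T_smult, simp, simp, subst tensor_lift_psum[OF abelian_group_T])
     (auto simp: M.smult_r_distr pt_add_left pt_add_right pt_balanced_smult)

lemma module_T: "module k T"
proof (rule moduleI)
  fix X assume "X \<in> carrier T"
  then obtain ps where ps: "set ps \<subseteq> carrier M \<times> carrier N" "X = psum T (\<otimes>\<^sub>t) ps" using T_psum by blast
  show "\<one>\<^bsub>k\<^esub> \<odot>\<^bsub>T\<^esub> X = X"
    unfolding ps(2) T_smult_psum[OF M.R.one_closed ps(1)] by (rule psum_cong[OF ps(1)]) simp
next
  fix r X assume r: "r \<in> carrier k" and "X \<in> carrier T"
  then obtain ps where ps: "set ps \<subseteq> carrier M \<times> carrier N" "X = psum T (\<otimes>\<^sub>t) ps" using T_psum by blast
  show "r \<odot>\<^bsub>T\<^esub> X \<in> carrier T"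
    unfolding ps(2) T_smult_psum[OF r ps(1)] by (rule T.psum_closed[OF ps(1)]) (simp add: r)
  fix s assume s: "s \<in> carrier k"
  show "(r \<oplus>\<^bsub>k\<^esub> s) \<odot>\<^bsub>T\<^esub> X = r \<odot>\<^bsub>T\<^esub> X \<oplus>\<^bsub>T\<^esub> s \<odot>\<^bsub>T\<^esub> X"
    unfolding ps(2) T_smult_psum[OF r ps(1)] T_smult_psum[OF s ps(1)] T_smult_psum[OF M.R.a_closed[OF r s] ps(1)]
    by (subst T.psum_add[OF ps(1), symmetric], (simp add: r s)+)
       (rule psum_cong[OF ps(1)], simp add: r s M.smult_l_distr pt_add_left)
  have ps': "set (map (\<lambda>(a, b). (s \<odot>\<^bsub>M\<^esub> a, b)) ps) \<subseteq> carrier M \<times> carrier N"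
    using ps s by auto
  have "s \<odot>\<^bsub>T\<^esub> X = psum T (\<otimes>\<^sub>t) (map (\<lambda>(a, b). (s \<odot>\<^bsub>M\<^esub> a, b)) ps)"
    unfolding ps(2) T_smult_psum[OF s ps(1)] psum_map ..
  then have "r \<odot>\<^bsub>T\<^esub> (s \<odot>\<^bsub>T\<^esub> X) = psum T (\<lambda>a b. (r \<odot>\<^bsub>M\<^esub> (s \<odot>\<^bsub>M\<^esub> a)) \<otimes>\<^sub>t b) ps"
    by (simp only: T_smult_psum[OF r ps']) (simp only: psum_map)
  also have "\<dots> = (r \<otimes>\<^bsub>k\<^esub> s) \<odot>\<^bsub>T\<^esub> X"
    unfolding ps(2) T_smult_psum[OF M.R.m_closed[OF r s] ps(1)]
    by (rule psum_cong[OF ps(1)]) (simp add: r s M.smult_assoc1)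
  finally show "(r \<otimes>\<^bsub>k\<^esub> s) \<odot>\<^bsub>T\<^esub> X = r \<odot>\<^bsub>T\<^esub> (s \<odot>\<^bsub>T\<^esub> X)" ..
next
  fix r X Y assume r: "r \<in> carrier k" and "X \<in> carrier T" "Y \<in> carrier T"
  then obtain ps qs where ps: "set ps \<subseteq> carrier M \<times> carrier N" "X = psum T (\<otimes>\<^sub>t) ps"
    "set qs \<subseteq> carrier M \<times> carrier N" "Y = psum T (\<otimes>\<^sub>t) qs" using T_psum by metis
  have a: "X \<oplus>\<^bsub>T\<^esub> Y = psum T (\<otimes>\<^sub>t) (ps @ qs)" using T.psum_append[OF ps(1,3)] ps by simp
  have psqs: "set (ps @ qs) \<subseteq> carrier M \<times> carrier N" using ps by simp
  show "r \<odot>\<^bsub>T\<^esub> (X \<oplus>\<^bsub>T\<^esub> Y) = r \<odot>\<^bsub>T\<^esub> X \<oplus>\<^bsub>T\<^esub> r \<odot>\<^bsub>T\<^esub> Y"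
    unfolding a T_smult_psum[OF r psqs] unfolding ps(2,4) T_smult_psum[OF r ps(1)] T_smult_psum[OF r ps(3)]
    by (rule T.psum_append[OF ps(1,3)]) (simp add: r)
qed (intro M.R.cring_axioms abelian_group_T)+

lemma pt_bilinear: "(\<otimes>\<^sub>t) \<in> bilinear_maps k M N T"
  by (intro bilinear_mapsI linear_mapsI) (auto simp: T_smult_pt pt_add_left pt_add_right pt_balanced)

lemma bilinear_lift:
  assumes "module k P" "f \<in> bilinear_maps k M N P"
  shows lift_pt: "a \<in> carrier M \<Longrightarrow> b \<in> carrier N \<Longrightarrow> tensor_lift P f (a \<otimes>\<^sub>t b) = f a b"
    and lift_psum: "set ps \<subseteq> carrier M \<times> carrier N \<Longrightarrow> tensor_lift P f (psum T (\<otimes>\<^sub>t) ps) = psum P f ps"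
    and lift_linear: "tensor_lift P f \<in> linear_maps k T P"
    and bilinear_lift_cls: "x \<in> carrier F \<Longrightarrow> tensor_lift P f (cls x) = formal_sum_eval P f x"
proof -
  interpret P: module k P by fact
  note f = bilinear_mapsD[OF assms(2)]
  have a1: "f (a \<oplus>\<^bsub>M\<^esub> a') b = f a b \<oplus>\<^bsub>P\<^esub> f a' b" if "a \<in> carrier M" "a' \<in> carrier M" "b \<in> carrier N" for a a' b
    using linear_mapsD(2)[OF f(2)] that by blast
  have a2: "f a (b \<oplus>\<^bsub>N\<^esub> b') = f a b \<oplus>\<^bsub>P\<^esub> f a b'" if "a \<in> carrier M" "b \<in> carrier N" "b' \<in> carrier N" for a b b'
    using linear_mapsD(2)[OF f(1)] that by blast
  have b1: "f (r \<odot>\<^bsub>M\<^esub> a) b = r \<odot>\<^bsub>P\<^esub> f a b" if "r \<in> carrier k" "a \<in> carrier M" "b \<in> carrier N" for r a b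
    using linear_mapsD(3)[OF f(2)] that by blast
  have b2: "f a (r \<odot>\<^bsub>N\<^esub> b) = r \<odot>\<^bsub>P\<^esub> f a b" if "r \<in> carrier k" "a \<in> carrier M" "b \<in> carrier N" for r a b
    using linear_mapsD(3)[OF f(1)] that by blast
  note lift = tensor_lift_general[OF P.abelian_group_axioms f(3) a1 a2 trans[OF b1 b2[symmetric]]]
  show "a \<in> carrier M \<Longrightarrow> b \<in> carrier N \<Longrightarrow> tensor_lift P f (a \<otimes>\<^sub>t b) = f a b"
    by (rule lift(4))
  show "x \<in> carrier F \<Longrightarrow> tensor_lift P f (cls x) = formal_sum_eval P f x"
    by (rule lift(1))
  show psum: "set ps \<subseteq> carrier M \<times> carrier N \<Longrightarrow> tensor_lift P f (psum T (\<otimes>\<^sub>t) ps) = psum P f ps" for ps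
    by (rule lift(5))
  show "tensor_lift P f \<in> linear_maps k T P"
  proof (rule linear_mapsI)
    fix r X assume r: "r \<in> carrier k" and "X \<in> carrier T"
    then obtain ps where ps: "set ps \<subseteq> carrier M \<times> carrier N" "X = psum T (\<otimes>\<^sub>t) ps" using T_psum by blast
    let ?ps = "map (\<lambda>(a, b). (r \<odot>\<^bsub>M\<^esub> a, b)) ps"
    have ps': "set ?ps \<subseteq> carrier M \<times> carrier N" using ps r by auto
    have "r \<odot>\<^bsub>T\<^esub> X = psum T (\<otimes>\<^sub>t) ?ps" unfolding ps(2) T_smult_psum[OF r ps(1)] psum_map ..
    then have "tensor_lift P f (r \<odot>\<^bsub>T\<^esub> X) = psum P (\<lambda>a b. f (r \<odot>\<^bsub>M\<^esub> a) b) ps"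
      by (simp only: psum[OF ps']) (simp only: psum_map)
    also have "\<dots> = psum P (\<lambda>a b. r \<odot>\<^bsub>P\<^esub> f a b) ps" by (rule psum_cong[OF ps(1)]) (simp add: b1 r)
    also have "\<dots> = r \<odot>\<^bsub>P\<^esub> psum P f ps"
      using psum_hom[OF ps(1), of f P "\<lambda>x. r \<odot>\<^bsub>P\<^esub> x" P] f(3) r P.abelian_monoid_axioms
      by (simp add: P.smult_r_distr)
    finally show "tensor_lift P f (r \<odot>\<^bsub>T\<^esub> X) = r \<odot>\<^bsub>P\<^esub> tensor_lift P f X"
      by (simp add: ps psum)
  qed (use lift(2,3) in auto)
qed

text \<open>
  Each representative of the second factor gives the same inner class, since that class is a lift
  evaluated at the tensor itself; the outer union then collapses in the same way.
\<close>

lemma T_mult: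
  assumes f: "\<And>a b. a \<in> carrier M \<Longrightarrow> b \<in> carrier N \<Longrightarrow>
      (\<lambda>a' b'. (a \<otimes>\<^bsub>M\<^esub> a') \<otimes>\<^sub>t (b \<otimes>\<^bsub>N\<^esub> b')) \<in> bilinear_maps k M N T"
    and f': "\<And>a b. a \<in> carrier M \<Longrightarrow> b \<in> carrier N \<Longrightarrow>
      (\<lambda>a' b'. (a' \<otimes>\<^bsub>M\<^esub> a) \<otimes>\<^sub>t (b' \<otimes>\<^bsub>N\<^esub> b)) \<in> bilinear_maps k M N T"
    and mult: "\<And>a a'. a \<in> carrier M \<Longrightarrow> a' \<in> carrier M \<Longrightarrow> a \<otimes>\<^bsub>M\<^esub> a' \<in> carrier M"
      "\<And>b b'. b \<in> carrier N \<Longrightarrow> b' \<in> carrier N \<Longrightarrow> b \<otimes>\<^bsub>N\<^esub> b' \<in> carrier N"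
    and ps: "set ps \<subseteq> carrier M \<times> carrier N" and qs: "set qs \<subseteq> carrier M \<times> carrier N"
  shows "psum T (\<otimes>\<^sub>t) ps \<otimes>\<^bsub>T\<^esub> psum T (\<otimes>\<^sub>t) qs =
    psum T (\<lambda>a b. psum T (\<lambda>a' b'. (a \<otimes>\<^bsub>M\<^esub> a') \<otimes>\<^sub>t (b \<otimes>\<^bsub>N\<^esub> b')) qs) ps"
proof -
  define X Y where "X = psum T (\<otimes>\<^sub>t) ps" and "Y = psum T (\<otimes>\<^sub>t) qs"
  let ?G = "\<lambda>a b (c, d). frag_of (a \<otimes>\<^bsub>M\<^esub> c, b \<otimes>\<^bsub>N\<^esub> d)"
  let ?L = "\<lambda>a b. psum T (\<lambda>a' b'. (a \<otimes>\<^bsub>M\<^esub> a') \<otimes>\<^sub>t (b \<otimes>\<^bsub>N\<^esub> b')) qs"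
  have XY: "X \<in> carrier T" "Y \<in> carrier T" by (auto simp: X_def Y_def T_psum_closed ps qs)
  obtain x where x: "x \<in> carrier F" "X = cls x" using XY(1) by (rule T_carrierE)
  obtain y where y: "y \<in> carrier F" "Y = cls y" using XY(2) by (rule T_carrierE)
  have inner: "frag_extend (?G a b) y' \<in> carrier F" "cls (frag_extend (?G a b) y') = ?L a b"
    if ab: "a \<in> carrier M" "b \<in> carrier N" and y': "y' \<in> Y" for a b y'
  proof -
    have y'F: "y' \<in> carrier F" and "cls y' = Y"
      using cls_memD[OF y(1), of y'] cls_eqI[OF _ y(1), of y'] y(2) y' by auto
    have G: "\<And>a' b'. a' \<in> carrier M \<Longrightarrow> b' \<in> carrier N \<Longrightarrow> ?G a b (a', b') \<in> carrier F"
      using ab mult by simp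
    note c = cls_frag_extend[of "?G a b", OF G y'F]
    show "frag_extend (?G a b) y' \<in> carrier F" by (rule c(1))
    have "cls (frag_extend (?G a b) y') = formal_sum_eval T (\<lambda>a' b'. (a \<otimes>\<^bsub>M\<^esub> a') \<otimes>\<^sub>t (b \<otimes>\<^bsub>N\<^esub> b')) y'"
      using c(2) by (simp add: pure_tensor_def)
    also have "\<dots> = tensor_lift T (\<lambda>a' b'. (a \<otimes>\<^bsub>M\<^esub> a') \<otimes>\<^sub>t (b \<otimes>\<^bsub>N\<^esub> b')) (cls y')"
      by (rule bilinear_lift_cls[OF module_T f[OF ab] y'F, symmetric])
    also have "\<dots> = ?L a b"
      unfolding \<open>cls y' = Y\<close> Y_def by (rule lift_psum[OF module_T f[OF ab] qs])
    finally show "cls (frag_extend (?G a b) y') = ?L a b" .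
  qed
  have L: "?L \<in> bilinear_maps k M N T"
    by (intro bilinear_mapsI linear_psum[OF module_T qs] bilinear_mapsD(1)[OF f'] bilinear_mapsD(2)[OF f'])
  have outer: "cls (frag_extend (\<lambda>(a, b). frag_extend (?G a b) y') x') = tensor_lift T ?L X"
    if x': "x' \<in> X" and y': "y' \<in> Y" for x' y'
  proof -
    have x'F: "x' \<in> carrier F" and "cls x' = X"
      using cls_memD[OF x(1), of x'] cls_eqI[OF _ x(1), of x'] x(2) x' by auto
    have "cls (frag_extend (\<lambda>(a, b). frag_extend (?G a b) y') x') =
      formal_sum_eval T (\<lambda>a b. cls (frag_extend (?G a b) y')) x'"
      using cls_frag_extend(2)[of "\<lambda>(a, b). frag_extend (?G a b) y'" x'] inner(1)[OF _ _ y'] x'F by simp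
    also have "\<dots> = formal_sum_eval T ?L x'"
      by (rule formal_sum_eval_cong[OF abelian_group_T _ inner(2)[OF _ _ y'] x'F])
         (rule bilinear_mapsD(3)[OF L])
    also have "\<dots> = tensor_lift T ?L X"
      using bilinear_lift_cls[OF module_T L x'F] \<open>cls x' = X\<close> by simp
    finally show ?thesis .
  qed
  have "X \<otimes>\<^bsub>T\<^esub> Y = (\<Union>x'\<in>X. \<Union>y'\<in>Y. cls (frag_extend (\<lambda>(a, b). frag_extend (?G a b) y') x'))"
    by (simp add: tensor_def)
  also have "\<dots> = tensor_lift T ?L X"
    using outer cls_self[OF x(1)] cls_self[OF y(1)] x(2) y(2) by blast
  also have "\<dots> = psum T ?L ps" unfolding X_def by (rule lift_psum[OF module_T L ps])
  finally show ?thesis unfolding X_def Y_def .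
qed

end

lemma two_modulesI: "module k M \<Longrightarrow> module k N \<Longrightarrow> two_modules k M N"
  by (simp add: two_modules_def)

lemmas module_tensor = two_modules.module_T[OF two_modulesI]
lemmas pure_tensor_bilinear = two_modules.pt_bilinear[OF two_modulesI]
lemmas lift_pure = two_modules.lift_pt[OF two_modulesI]
lemmas lift_psum = two_modules.lift_psum[OF two_modulesI]
lemmas lift_linear = two_modules.lift_linear[OF two_modulesI]
lemmas tensor_psumE = two_modules.T_psum[OF two_modulesI]

definition trilinear_maps where
  "trilinear_maps k L M N P =
     {f. (\<forall>a\<in>carrier L. f a \<in> bilinear_maps k M N P) \<and>
         (\<forall>b\<in>carrier M. \<forall>c\<in>carrier N. (\<lambda>a. f a b c) \<in> linear_maps k L P)}"

lemma trilinear_mapsI: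
  assumes "\<And>b c. b \<in> carrier M \<Longrightarrow> c \<in> carrier N \<Longrightarrow> (\<lambda>a. f a b c) \<in> linear_maps k L P"
    and "\<And>a c. a \<in> carrier L \<Longrightarrow> c \<in> carrier N \<Longrightarrow> (\<lambda>b. f a b c) \<in> linear_maps k M P"
    and "\<And>a b. a \<in> carrier L \<Longrightarrow> b \<in> carrier M \<Longrightarrow> (\<lambda>c. f a b c) \<in> linear_maps k N P"
  shows "f \<in> trilinear_maps k L M N P"
  using assms by (auto simp: trilinear_maps_def bilinear_maps_def)

lemma trilinear_mapsD:
  assumes "f \<in> trilinear_maps k L M N P"
  shows "a \<in> carrier L \<Longrightarrow> f a \<in> bilinear_maps k M N P"
    and "c \<in> carrier N \<Longrightarrow> (\<lambda>a b. f a b c) \<in> bilinear_maps k L M P"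
    and "b \<in> carrier M \<Longrightarrow> c \<in> carrier N \<Longrightarrow> (\<lambda>a. f a b c) \<in> linear_maps k L P"
    and "a \<in> carrier L \<Longrightarrow> b \<in> carrier M \<Longrightarrow> f a b \<in> linear_maps k N P"
    and "a \<in> carrier L \<Longrightarrow> b \<in> carrier M \<Longrightarrow> c \<in> carrier N \<Longrightarrow> f a b c \<in> carrier P"
  using assms by (auto simp: trilinear_maps_def bilinear_maps_def linear_maps_def Pi_iff)

text \<open>
  Equations in \<open>L \<otimes> (M \<otimes> N)\<close> are used by applying \<open>\<Phi>\<close> to both sides, which allows an arbitrary
  trilinear expression in the three legs.
\<close>

lemma trilinear_lift_right:
  assumes "module k L" "module k M" "module k N" "module k P" "f \<in> trilinear_maps k L M N P"
  obtains \<Phi> where "\<Phi> \<in> linear_maps k (tensor k L (tensor k M N)) P"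
    "\<And>a b c. a \<in> carrier L \<Longrightarrow> b \<in> carrier M \<Longrightarrow> c \<in> carrier N \<Longrightarrow>
       \<Phi> (pure_tensor k L (tensor k M N) a (pure_tensor k M N b c)) = f a b c"
proof -
  let ?MN = "tensor k M N" and ?g = "\<lambda>a X. tensor_lift P (f a) X"
  note mod = assms(1-4) module_tensor[OF assms(2,3)]
  note f = trilinear_mapsD[OF assms(5)]
  have "?g \<in> bilinear_maps k L ?MN P"
  proof (rule bilinear_mapsI)
    fix X assume "X \<in> carrier ?MN"
    then obtain ps where ps: "set ps \<subseteq> carrier M \<times> carrier N" "X = psum ?MN (pure_tensor k M N) ps"
      using tensor_psumE[OF mod(2,3)] by blast
    have "(\<lambda>a. psum P (\<lambda>b c. f a b c) ps) \<in> linear_maps k L P"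
      by (rule linear_psum[OF mod(4) ps(1)]) (rule f)
    then show "(\<lambda>a. ?g a X) \<in> linear_maps k L P"
      unfolding linear_maps_def using mod
      by (simp add: ps lift_psum f module.smult_closed abelian_groupE(1)[OF module.axioms(2)] cong: Pi_cong)
  next
    fix a assume "a \<in> carrier L"
    then show "(\<lambda>X. ?g a X) \<in> linear_maps k ?MN P" using lift_linear[OF mod(2-4) f(1)] by simp
  qed
  note g = lift_pure[OF mod(1,5,4) this] lift_linear[OF mod(1,5,4) this]
  show ?thesis
    by (rule that[OF g(2)])
      (simp add: g(1) lift_pure[OF mod(2-4) f(1)] bilinear_mapsD(3)[OF pure_tensor_bilinear] mod)
qed

lemma trilinear_lift_left:
  assumes "module k L" "module k M" "module k N" "module k P" "f \<in> trilinear_maps k L M N P"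
  shows "(\<lambda>X c. tensor_lift P (\<lambda>a b. f a b c) X) \<in> bilinear_maps k (tensor k L M) N P"
proof -
  let ?LM = "tensor k L M" and ?g = "\<lambda>X c. tensor_lift P (\<lambda>a b. f a b c) X"
  note mod = assms(1-4) module_tensor[OF assms(1,2)]
  note f = trilinear_mapsD[OF assms(5)]
  show "?g \<in> bilinear_maps k ?LM N P"
  proof (rule bilinear_mapsI)
    fix X assume "X \<in> carrier ?LM"
    then obtain ps where ps: "set ps \<subseteq> carrier L \<times> carrier M" "X = psum ?LM (pure_tensor k L M) ps"
      using tensor_psumE[OF mod(1,2)] by blast
    have "(\<lambda>c. psum P (\<lambda>a b. f a b c) ps) \<in> linear_maps k N P"
      by (rule linear_psum[OF mod(4) ps(1)]) (use f(4) in simp)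
    then show "(\<lambda>c. ?g X c) \<in> linear_maps k N P"
      unfolding linear_maps_def using mod
      by (simp add: ps lift_psum f module.smult_closed abelian_groupE(1)[OF module.axioms(2)] cong: Pi_cong)
  next
    fix c assume "c \<in> carrier N"
    then show "(\<lambda>X. ?g X c) \<in> linear_maps k ?LM P" using lift_linear[OF mod(1,2,4) f(2)] by simp
  qed
qed

section \<open>Coalgebras in Sweedler notation\<close>

lemma linear_maps_cong:
  assumes "module k M" "\<And>x. x \<in> carrier M \<Longrightarrow> f x = g x" "g \<in> linear_maps k M N"
  shows "f \<in> linear_maps k M N"
proof -
  interpret module k M by fact
  show ?thesis using assms(2) linear_mapsD[OF assms(3)] by (intro linear_mapsI) auto
qed

lemma linear_id: "(\<lambda>x. x) \<in> linear_maps k M M"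
  by (simp add: linear_maps_def)

lemma linear_pure_left:
  assumes "module k M" "module k N" "b \<in> carrier N" "f \<in> linear_maps k L M"
  shows "(\<lambda>x. pure_tensor k M N (f x) b) \<in> linear_maps k L (tensor k M N)"
  using linear_maps_comp[OF assms(4) bilinear_mapsD(2)[OF pure_tensor_bilinear[OF assms(1,2)] assms(3)]] .

lemma linear_pure_right:
  assumes "module k M" "module k N" "a \<in> carrier M" "f \<in> linear_maps k L N"
  shows "(\<lambda>x. pure_tensor k M N a (f x)) \<in> linear_maps k L (tensor k M N)"
  using linear_maps_comp[OF assms(4) bilinear_mapsD(1)[OF pure_tensor_bilinear[OF assms(1,2)] assms(3)]] .

lemma pure_tensor_closed:
  "module k M \<Longrightarrow> module k N \<Longrightarrow> a \<in> carrier M \<Longrightarrow> b \<in> carrier N \<Longrightarrow>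
    pure_tensor k M N a b \<in> carrier (tensor k M N)"
  by (rule bilinear_mapsD(3)[OF pure_tensor_bilinear])

text \<open>
  The functions in the comultiplication formulas are bilinear only on the carriers, and agree there
  with expressions for which bilinearity is readily established.
\<close>

lemma tensor_lift_cong:
  assumes "module k M" "module k N" "module k P" "f \<in> bilinear_maps k M N P" "set ps \<subseteq> carrier M \<times> carrier N"
    and eq: "\<And>a b. a \<in> carrier M \<Longrightarrow> b \<in> carrier N \<Longrightarrow> g a b = f a b"
  shows "tensor_lift P g (psum (tensor k M N) (pure_tensor k M N) ps) = psum P f ps"
proof -
  have "g \<in> bilinear_maps k M N P"
  proof (rule bilinear_mapsI)
    show "(\<lambda>a. g a b) \<in> linear_maps k M P" if "b \<in> carrier N" for b
      by (rule linear_maps_cong[OF assms(1) eq[OF _ that] bilinear_mapsD(2)[OF assms(4) that]])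
    show "(\<lambda>b. g a b) \<in> linear_maps k N P" if "a \<in> carrier M" for a
      by (rule linear_maps_cong[OF assms(2) eq[OF that] bilinear_mapsD(1)[OF assms(4) that]])
  qed
  then have "tensor_lift P g (psum (tensor k M N) (pure_tensor k M N) ps) = psum P g ps"
    by (rule lift_psum[OF assms(1-3) _ assms(5)])
  also have "\<dots> = psum P f ps" by (rule psum_cong[OF assms(5) eq])
  finally show ?thesis .
qed

lemma tensor_assoc_linear:
  assumes "module k L" "module k M" "module k N"
  shows "tensor_assoc k L M N \<in> linear_maps k (tensor k (tensor k L M) N) (tensor k L (tensor k M N))"
    and "a \<in> carrier L \<Longrightarrow> b \<in> carrier M \<Longrightarrow> c \<in> carrier N \<Longrightarrow>
      tensor_assoc k L M N (pure_tensor k (tensor k L M) N (pure_tensor k L M a b) c) =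
      pure_tensor k L (tensor k M N) a (pure_tensor k M N b c)"
proof -
  let ?T = "tensor k L (tensor k M N)" and ?g = "\<lambda>a b c. pure_tensor k L (tensor k M N) a (pure_tensor k M N b c)"
  note mod = assms module_tensor[OF assms(1,2)] module_tensor[OF assms(2,3)]
  have T: "module k ?T" by (rule module_tensor[OF mod(1,5)])
  have g: "?g \<in> trilinear_maps k L M N ?T"
    by (intro trilinear_mapsI linear_pure_left linear_pure_right mod linear_id pure_tensor_closed)
  note h = trilinear_lift_left[OF mod(1-3) T g]
  show "tensor_assoc k L M N \<in> linear_maps k (tensor k (tensor k L M) N) ?T"
    using lift_linear[OF mod(4,3) T h] by (simp add: tensor_assoc_def[abs_def])
  show "a \<in> carrier L \<Longrightarrow> b \<in> carrier M \<Longrightarrow> c \<in> carrier N \<Longrightarrow>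
      tensor_assoc k L M N (pure_tensor k (tensor k L M) N (pure_tensor k L M a b) c) = ?g a b c"
    unfolding tensor_assoc_def
    by (simp add: lift_pure[OF mod(4,3) T h] lift_pure[OF mod(1,2) T trilinear_mapsD(2)[OF g]] pure_tensor_closed mod)
qed

text \<open>
  A coalgebra whose comultiplication is given by lists: \<open>d c\<close> lists the pairs
  \<open>(c\<^sub>(\<^sub>1\<^sub>), c\<^sub>(\<^sub>2\<^sub>))\<close>. Coassociativity is stated in \<open>C \<otimes> (C \<otimes> C)\<close>, with the associativity
  isomorphism already applied.
\<close>

locale sweedler_coalgebra = module k C
  for k :: "'k ring" and C :: "('k, 'c) module" +
  fixes d :: "'c \<Rightarrow> ('c \<times> 'c) list" and \<epsilon> :: "'c \<Rightarrow> 'k"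
  assumes d_closed: "c \<in> carrier C \<Longrightarrow> set (d c) \<subseteq> carrier C \<times> carrier C"
    and d_linear: "(\<lambda>c. psum (tensor k C C) (pure_tensor k C C) (d c)) \<in> linear_maps k C (tensor k C C)"
    and counit_linear: "\<epsilon> \<in> linear_maps k C (regular_module k)"
    and d_coassoc: "c \<in> carrier C \<Longrightarrow>
      psum (tensor k C (tensor k C C)) (\<lambda>a b. psum (tensor k C (tensor k C C))
        (\<lambda>a1 a2. pure_tensor k C (tensor k C C) a1 (pure_tensor k C C a2 b)) (d a)) (d c) =
      psum (tensor k C (tensor k C C)) (\<lambda>a b. psum (tensor k C (tensor k C C))
        (\<lambda>b1 b2. pure_tensor k C (tensor k C C) a (pure_tensor k C C b1 b2)) (d b)) (d c)"
    and d_counit_left: "c \<in> carrier C \<Longrightarrow> psum C (\<lambda>a b. \<epsilon> a \<odot>\<^bsub>C\<^esub> b) (d c) = c"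
    and d_counit_right: "c \<in> carrier C \<Longrightarrow> psum C (\<lambda>a b. \<epsilon> b \<odot>\<^bsub>C\<^esub> a) (d c) = c"
begin

lemma linear_d:
  assumes "module k P" "f \<in> bilinear_maps k C C P"
  shows "(\<lambda>c. psum P f (d c)) \<in> linear_maps k C P"
proof (rule linear_maps_cong[OF module_axioms])
  show "(\<lambda>c. tensor_lift P f (psum (tensor k C C) (pure_tensor k C C) (d c))) \<in> linear_maps k C P"
    by (rule linear_maps_comp[OF d_linear lift_linear[OF module_axioms module_axioms assms]])
qed (simp add: lift_psum[OF module_axioms module_axioms assms] d_closed)

lemma coassoc:
  assumes P: "module k P" and f: "f \<in> trilinear_maps k C C C P" and c: "c \<in> carrier C"
  shows "psum P (\<lambda>a b. psum P (\<lambda>a1 a2. f a1 a2 b) (d a)) (d c) =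
    psum P (\<lambda>a b. psum P (\<lambda>b1 b2. f a b1 b2) (d b)) (d c)"
proof -
  let ?CC = "tensor k C C" let ?T = "tensor k C ?CC"
  note mod = module_axioms module_tensor[OF module_axioms module_axioms]
  note modT = module_tensor[OF mod]
  note cl = pure_tensor_closed[OF mod] pure_tensor_closed[OF mod(1,1)]
  obtain \<Phi> where \<Phi>: "\<Phi> \<in> linear_maps k ?T P"
    "\<And>a b c. a \<in> carrier C \<Longrightarrow> b \<in> carrier C \<Longrightarrow> c \<in> carrier C \<Longrightarrow>
       \<Phi> (pure_tensor k C ?CC a (pure_tensor k C C b c)) = f a b c"
    using trilinear_lift_right[OF mod(1,1,1) P f] by blast
  have T: "abelian_monoid ?T" using modT by (simp add: module_def abelian_group_def)
  have double: "\<Phi> (psum ?T (\<lambda>a b. psum ?T (g a b) (e a b)) (d c)) = psum P (\<lambda>a b. psum P (\<lambda>x y. \<Phi> (g a b x y)) (e a b)) (d c)"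
    if e: "\<And>a b. a \<in> carrier C \<Longrightarrow> b \<in> carrier C \<Longrightarrow> set (e a b) \<subseteq> carrier C \<times> carrier C"
      and g: "\<And>a b x y. a \<in> carrier C \<Longrightarrow> b \<in> carrier C \<Longrightarrow> x \<in> carrier C \<Longrightarrow> y \<in> carrier C \<Longrightarrow> g a b x y \<in> carrier ?T"
    for g e
    by (subst linear_maps_psum[OF modT P \<Phi>(1) d_closed[OF c]])
       (auto intro!: abelian_monoid.psum_closed[OF T e] psum_cong[OF d_closed[OF c]] linear_maps_psum[OF modT P \<Phi>(1) e] g)
  have "psum P (\<lambda>a b. psum P (\<lambda>a1 a2. f a1 a2 b) (d a)) (d c) =
    \<Phi> (psum ?T (\<lambda>a b. psum ?T (\<lambda>a1 a2. pure_tensor k C ?CC a1 (pure_tensor k C C a2 b)) (d a)) (d c))"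
    by (subst double)
       (auto simp: d_closed cl \<Phi>(2) intro!: psum_cong[OF d_closed[OF c]] psum_cong[OF d_closed])
  also have "\<dots> = psum P (\<lambda>a b. psum P (\<lambda>b1 b2. f a b1 b2) (d b)) (d c)"
    unfolding d_coassoc[OF c]
    by (subst double)
       (auto simp: d_closed cl \<Phi>(2) intro!: psum_cong[OF d_closed[OF c]] psum_cong[OF d_closed])
  finally show ?thesis .
qed

lemma counit_closed [simp]: "c \<in> carrier C \<Longrightarrow> \<epsilon> c \<in> carrier k"
  using linear_mapsD(1)[OF counit_linear] by simp

lemma counit_left_map:
  assumes "module k P" "f \<in> linear_maps k C P" "c \<in> carrier C"
  shows "psum P (\<lambda>a b. \<epsilon> a \<odot>\<^bsub>P\<^esub> f b) (d c) = f c"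
proof -
  have "f c = f (psum C (\<lambda>a b. \<epsilon> a \<odot>\<^bsub>C\<^esub> b) (d c))" by (simp add: d_counit_left assms)
  also have "\<dots> = psum P (\<lambda>a b. f (\<epsilon> a \<odot>\<^bsub>C\<^esub> b)) (d c)"
    by (rule linear_maps_psum[OF module_axioms assms(1,2) d_closed]) (auto simp: assms)
  also have "\<dots> = psum P (\<lambda>a b. \<epsilon> a \<odot>\<^bsub>P\<^esub> f b) (d c)"
    by (rule psum_cong[OF d_closed]) (simp_all add: assms linear_mapsD(3)[OF assms(2)])
  finally show ?thesis ..
qed

lemma counit_right_map:
  assumes "module k P" "f \<in> linear_maps k C P" "c \<in> carrier C"
  shows "psum P (\<lambda>a b. \<epsilon> b \<odot>\<^bsub>P\<^esub> f a) (d c) = f c"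
proof -
  have "f c = f (psum C (\<lambda>a b. \<epsilon> b \<odot>\<^bsub>C\<^esub> a) (d c))" by (simp add: d_counit_right assms)
  also have "\<dots> = psum P (\<lambda>a b. f (\<epsilon> b \<odot>\<^bsub>C\<^esub> a)) (d c)"
    by (rule linear_maps_psum[OF module_axioms assms(1,2) d_closed]) (auto simp: assms)
  also have "\<dots> = psum P (\<lambda>a b. \<epsilon> b \<odot>\<^bsub>P\<^esub> f a) (d c)"
    by (rule psum_cong[OF d_closed]) (simp_all add: assms linear_mapsD(3)[OF assms(2)])
  finally show ?thesis ..
qed

lemma flip: "sweedler_coalgebra k C (\<lambda>c. map prod.swap (d c)) \<epsilon>"
proof (unfold_locales)
  let ?CC = "tensor k C C" let ?T = "tensor k C ?CC"
  note mod = module_axioms module_tensor[OF module_axioms module_axioms]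
  note modT = module_tensor[OF mod]
  note lin = linear_pure_left[OF mod(1,1)] linear_pure_right[OF mod(1,1)] linear_pure_left[OF mod] linear_pure_right[OF mod]
    pure_tensor_closed[OF mod(1,1)]
  show "(\<lambda>c. psum ?CC (pure_tensor k C C) (map prod.swap (d c))) \<in> linear_maps k C ?CC"
    unfolding psum_swap_pairs
    by (rule linear_d[OF mod(2)]) (intro bilinear_mapsI lin linear_id)
  fix c assume c: "c \<in> carrier C"
  then show "set (map prod.swap (d c)) \<subseteq> carrier C \<times> carrier C" using d_closed[OF c] by auto
  show "psum C (\<lambda>a b. \<epsilon> a \<odot>\<^bsub>C\<^esub> b) (map prod.swap (d c)) = c"
    "psum C (\<lambda>a b. \<epsilon> b \<odot>\<^bsub>C\<^esub> a) (map prod.swap (d c)) = c"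
    unfolding psum_swap_pairs by (simp_all add: c d_counit_left d_counit_right)
  have "psum ?T (\<lambda>a b. psum ?T (\<lambda>a1 a2. pure_tensor k C ?CC b (pure_tensor k C C a2 a1)) (d a)) (d c) =
    psum ?T (\<lambda>a b. psum ?T (\<lambda>b1 b2. pure_tensor k C ?CC b2 (pure_tensor k C C b1 a)) (d b)) (d c)"
    by (rule coassoc[OF modT _ c]) (intro trilinear_mapsI lin linear_id; assumption)
  then show "psum ?T (\<lambda>a b. psum ?T
        (\<lambda>a1 a2. pure_tensor k C ?CC a1 (pure_tensor k C C a2 b)) (map prod.swap (d a))) (map prod.swap (d c)) =
      psum ?T (\<lambda>a b. psum ?T
        (\<lambda>b1 b2. pure_tensor k C ?CC a (pure_tensor k C C b1 b2)) (map prod.swap (d b))) (map prod.swap (d c))"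
    unfolding psum_swap_pairs ..
qed (rule counit_linear)

end

lemma coassoc_in_lists:
  fixes C (structure)
  assumes mod: "module k C"
    and d: "\<And>c. c \<in> carrier C \<Longrightarrow> set (d c) \<subseteq> carrier C \<times> carrier C"
    and \<Delta>: "\<And>c. c \<in> carrier C \<Longrightarrow> \<Delta> c = psum (tensor k C C) (pure_tensor k C C) (d c)"
    and lin: "\<Delta> \<in> linear_maps k C (tensor k C C)"
    and c: "c \<in> carrier C"
  shows "tensor_assoc k C C C (tensor_map k (tensor k C C) C \<Delta> (\<lambda>x. x) (\<Delta> c)) =
      psum (tensor k C (tensor k C C)) (\<lambda>a b. psum (tensor k C (tensor k C C))
        (\<lambda>a1 a2. pure_tensor k C (tensor k C C) a1 (pure_tensor k C C a2 b)) (d a)) (d c)"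
    and "tensor_map k C (tensor k C C) (\<lambda>x. x) \<Delta> (\<Delta> c) =
      psum (tensor k C (tensor k C C)) (\<lambda>a b. psum (tensor k C (tensor k C C))
        (\<lambda>b1 b2. pure_tensor k C (tensor k C C) a (pure_tensor k C C b1 b2)) (d b)) (d c)"
proof -
  let ?CC = "tensor k C C" let ?T = "tensor k C ?CC" let ?S = "tensor k ?CC C"
  have CC: "module k ?CC" by (rule module_tensor[OF mod mod])
  have T: "module k ?T" by (rule module_tensor[OF mod CC])
  have S: "module k ?S" by (rule module_tensor[OF CC mod])
  let ?g = "\<lambda>a b c. pure_tensor k C ?CC a (pure_tensor k C C b c)"
  note assoc = tensor_assoc_linear[OF mod mod mod]
  have "tensor_map k ?CC C \<Delta> (\<lambda>x. x) (\<Delta> c) = psum ?S (\<lambda>a b. pure_tensor k ?CC C (\<Delta> a) b) (d c)"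
    unfolding tensor_map_def \<Delta>[OF c]
    by (rule lift_psum[OF mod mod S _ d[OF c]])
       (auto intro!: bilinear_mapsI linear_pure_left[OF CC mod _ lin] linear_pure_right[OF CC mod _ linear_id] linear_mapsD(1)[OF lin])
  then have "tensor_assoc k C C C (tensor_map k ?CC C \<Delta> (\<lambda>x. x) (\<Delta> c)) =
    psum ?T (\<lambda>a b. tensor_assoc k C C C (pure_tensor k ?CC C (\<Delta> a) b)) (d c)"
    by (simp only:) (rule linear_maps_psum[OF S T assoc(1) d[OF c]],
      simp add: pure_tensor_closed CC mod linear_mapsD(1)[OF lin])
  also have "\<dots> = psum ?T (\<lambda>a b. psum ?T (\<lambda>a1 a2. ?g a1 a2 b) (d a)) (d c)"
  proof (rule psum_cong[OF d[OF c]])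
    fix a b assume ab: "a \<in> carrier C" "b \<in> carrier C"
    have "tensor_assoc k C C C (pure_tensor k ?CC C (\<Delta> a) b) =
      psum ?T (\<lambda>a1 a2. tensor_assoc k C C C (pure_tensor k ?CC C (pure_tensor k C C a1 a2) b)) (d a)"
      unfolding \<Delta>[OF ab(1)]
      by (rule linear_maps_psum[OF CC T linear_maps_comp[OF linear_pure_left[OF CC mod ab(2) linear_id] assoc(1)] d[OF ab(1)]])
         (simp add: pure_tensor_closed mod)
    also have "\<dots> = psum ?T (\<lambda>a1 a2. ?g a1 a2 b) (d a)"
      by (rule psum_cong[OF d[OF ab(1)]]) (simp add: assoc(2) ab)
    finally show "tensor_assoc k C C C (pure_tensor k ?CC C (\<Delta> a) b) = psum ?T (\<lambda>a1 a2. ?g a1 a2 b) (d a)" .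
  qed
  finally show "tensor_assoc k C C C (tensor_map k ?CC C \<Delta> (\<lambda>x. x) (\<Delta> c)) =
    psum ?T (\<lambda>a b. psum ?T (\<lambda>a1 a2. ?g a1 a2 b) (d a)) (d c)" .
  have "tensor_map k C ?CC (\<lambda>x. x) \<Delta> (\<Delta> c) = psum ?T (\<lambda>a b. pure_tensor k C ?CC a (\<Delta> b)) (d c)"
    unfolding tensor_map_def \<Delta>[OF c]
    by (rule lift_psum[OF mod mod T _ d[OF c]])
       (auto intro!: bilinear_mapsI linear_pure_left[OF mod CC _ linear_id] linear_pure_right[OF mod CC _ lin] linear_mapsD(1)[OF lin])
  also have "\<dots> = psum ?T (\<lambda>a b. psum ?T (\<lambda>b1 b2. ?g a b1 b2) (d b)) (d c)"
  proof (rule psum_cong[OF d[OF c]])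
    fix a b assume ab: "a \<in> carrier C" "b \<in> carrier C"
    show "pure_tensor k C ?CC a (\<Delta> b) = psum ?T (\<lambda>b1 b2. ?g a b1 b2) (d b)"
      unfolding \<Delta>[OF ab(2)]
      by (rule linear_maps_psum[OF CC T _ d[OF ab(2)]])
         (use ab in \<open>auto intro!: linear_pure_right[OF mod CC _ linear_id, simplified] pure_tensor_closed mod\<close>)
  qed
  finally show "tensor_map k C ?CC (\<lambda>x. x) \<Delta> (\<Delta> c) =
    psum ?T (\<lambda>a b. psum ?T (\<lambda>b1 b2. ?g a b1 b2) (d b)) (d c)" .
qed

lemma linear_smult:
  assumes "module k P" "f \<in> linear_maps k M (regular_module k)" "v \<in> carrier P"
  shows "(\<lambda>x. f x \<odot>\<^bsub>P\<^esub> v) \<in> linear_maps k M P"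
proof -
  interpret module k P by fact
  show ?thesis using linear_mapsD[OF assms(2)] assms(3)
    by (intro linear_mapsI) (auto simp: smult_l_distr smult_assoc1)
qed

lemma linear_smult_const:
  assumes "module k P" "r \<in> carrier k" "f \<in> linear_maps k M P"
  shows "(\<lambda>x. r \<odot>\<^bsub>P\<^esub> f x) \<in> linear_maps k M P"
proof -
  interpret module k P by fact
  show ?thesis using linear_mapsD[OF assms(3)] assms(2)
    by (intro linear_mapsI) (auto simp: smult_r_distr smult_assoc1[symmetric] R.m_comm)
qed

lemma counits_in_lists:
  assumes mod: "module k C"
    and d: "set ps \<subseteq> carrier C \<times> carrier C"
    and \<epsilon>: "\<epsilon> \<in> linear_maps k C (regular_module k)"
  shows "tensor_lift C (\<lambda>a b. \<epsilon> a \<odot>\<^bsub>C\<^esub> b) (psum (tensor k C C) (pure_tensor k C C) ps) = psum C (\<lambda>a b. \<epsilon> a \<odot>\<^bsub>C\<^esub> b) ps"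
    and "tensor_lift C (\<lambda>a b. \<epsilon> b \<odot>\<^bsub>C\<^esub> a) (psum (tensor k C C) (pure_tensor k C C) ps) = psum C (\<lambda>a b. \<epsilon> b \<odot>\<^bsub>C\<^esub> a) ps"
  using linear_mapsD(1)[OF \<epsilon>]
  by (auto intro!: lift_psum[OF mod mod mod _ d] bilinear_mapsI linear_smult[OF mod \<epsilon>] linear_smult_const[OF mod _ linear_id])

lemma coalgebra_imp_sweedler:
  assumes "coalgebra k C \<Delta> \<epsilon>"
  obtains d where "sweedler_coalgebra k C d \<epsilon>"
    "\<And>c. c \<in> carrier C \<Longrightarrow> \<Delta> c = psum (tensor k C C) (pure_tensor k C C) (d c)"
proof -
  interpret coalgebra k C \<Delta> \<epsilon> by fact
  have "\<forall>c\<in>carrier C. \<exists>ps. set ps \<subseteq> carrier C \<times> carrier C \<and> \<Delta> c = psum (tensor k C C) (pure_tensor k C C) ps"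
    using linear_mapsD(1)[OF comult_linear] by (metis tensor_psumE[OF module_axioms module_axioms])
  then obtain d where d: "\<And>c. c \<in> carrier C \<Longrightarrow> set (d c) \<subseteq> carrier C \<times> carrier C"
    and \<Delta>: "\<And>c. c \<in> carrier C \<Longrightarrow> \<Delta> c = psum (tensor k C C) (pure_tensor k C C) (d c)"
    by metis
  have "sweedler_coalgebra k C d \<epsilon>"
  proof
    show "(\<lambda>c. psum (tensor k C C) (pure_tensor k C C) (d c)) \<in> linear_maps k C (tensor k C C)"
      by (rule linear_maps_cong[OF module_axioms \<Delta>[symmetric] comult_linear])
  next
    fix c assume c: "c \<in> carrier C"
    show "psum C (\<lambda>a b. \<epsilon> a \<odot>\<^bsub>C\<^esub> b) (d c) = c" "psum C (\<lambda>a b. \<epsilon> b \<odot>\<^bsub>C\<^esub> a) (d c) = c"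
      using counit_left[OF c] counit_right[OF c] counits_in_lists[OF module_axioms d[OF c] counit_linear]
      by (simp_all add: \<Delta>[OF c])
  next
    fix c assume c: "c \<in> carrier C"
    note lists = coassoc_in_lists[where d = d and \<Delta> = \<Delta>, OF module_axioms d \<Delta> comult_linear c]
    show "psum (tensor k C (tensor k C C)) (\<lambda>a b. psum (tensor k C (tensor k C C))
        (\<lambda>a1 a2. pure_tensor k C (tensor k C C) a1 (pure_tensor k C C a2 b)) (d a)) (d c) =
      psum (tensor k C (tensor k C C)) (\<lambda>a b. psum (tensor k C (tensor k C C))
        (\<lambda>b1 b2. pure_tensor k C (tensor k C C) a (pure_tensor k C C b1 b2)) (d b)) (d c)"
      by (rule trans[OF trans[OF lists(1)[symmetric] coassoc[OF c]] lists(2)])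
  qed (fact counit_linear d)+
  then show ?thesis using \<Delta> that by blast
qed

lemma sweedler_imp_coalgebra:
  assumes "sweedler_coalgebra k C d \<epsilon>"
    and \<Delta>: "\<And>c. c \<in> carrier C \<Longrightarrow> \<Delta> c = psum (tensor k C C) (pure_tensor k C C) (d c)"
  shows "coalgebra k C \<Delta> \<epsilon>"
proof -
  interpret sweedler_coalgebra k C d \<epsilon> by fact
  have lin: "\<Delta> \<in> linear_maps k C (tensor k C C)"
    by (rule linear_maps_cong[OF module_axioms \<Delta> d_linear])
  show ?thesis
  proof
    fix c assume c: "c \<in> carrier C"
    note lists = coassoc_in_lists[where d = d and \<Delta> = \<Delta>, OF module_axioms d_closed \<Delta> lin c]
    show "tensor_lift C (\<lambda>a b. \<epsilon> a \<odot>\<^bsub>C\<^esub> b) (\<Delta> c) = c" "tensor_lift C (\<lambda>a b. \<epsilon> b \<odot>\<^bsub>C\<^esub> a) (\<Delta> c) = c"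
      by (simp_all add: \<Delta>[OF c] counits_in_lists[OF module_axioms d_closed[OF c] counit_linear] c
        d_counit_left d_counit_right)
    show "tensor_assoc k C C C (tensor_map k (tensor k C C) C \<Delta> (\<lambda>x. x) (\<Delta> c)) =
      tensor_map k C (tensor k C C) (\<lambda>x. x) \<Delta> (\<Delta> c)"
      by (rule trans[OF trans[OF lists(1) d_coassoc[OF c]] lists(2)[symmetric]])
  qed (fact counit_linear lin)+
qed

text \<open>
  Coassociativity and counitality of the lists \<open>W h\<close> are assumed after applying \<open>p\<close> to all legs.
  The criterion thus applies to quotients of a coalgebra, and equally to
  \<open>h \<mapsto> 1\<^sub>(\<^sub>1\<^sub>) \<otimes> h1\<^sub>(\<^sub>2\<^sub>)\<close>, which becomes coassociative only modulo the kernel of \<open>p = \<epsilon>\<^sub>s\<close>.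
\<close>

lemma quotient_coalgebra:
  assumes H: "module k H" and C: "module k C" and p: "p \<in> linear_maps k H C" and surj: "carrier C = p ` carrier H"
    and W: "\<And>h. h \<in> carrier H \<Longrightarrow> set (W h) \<subseteq> carrier H \<times> carrier H"
    and d: "\<And>c. c \<in> carrier C \<Longrightarrow> set (d c) \<subseteq> carrier C \<times> carrier C"
    and dW: "\<And>h. h \<in> carrier H \<Longrightarrow> psum (tensor k C C) (pure_tensor k C C) (d (p h)) =
      psum (tensor k C C) (\<lambda>a b. pure_tensor k C C (p a) (p b)) (W h)"
    and linear: "(\<lambda>h. psum (tensor k C C) (\<lambda>a b. pure_tensor k C C (p a) (p b)) (W h)) \<in> linear_maps k H (tensor k C C)"
    and \<epsilon>: "\<epsilon> \<in> linear_maps k C (regular_module k)"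
    and coassoc: "\<And>h. h \<in> carrier H \<Longrightarrow>
      psum (tensor k C (tensor k C C)) (\<lambda>a b. psum (tensor k C (tensor k C C))
        (\<lambda>a1 a2. pure_tensor k C (tensor k C C) (p a1) (pure_tensor k C C (p a2) (p b))) (W a)) (W h) =
      psum (tensor k C (tensor k C C)) (\<lambda>a b. psum (tensor k C (tensor k C C))
        (\<lambda>b1 b2. pure_tensor k C (tensor k C C) (p a) (pure_tensor k C C (p b1) (p b2))) (W b)) (W h)"
    and counit_left: "\<And>h. h \<in> carrier H \<Longrightarrow> psum C (\<lambda>a b. \<epsilon> (p a) \<odot>\<^bsub>C\<^esub> p b) (W h) = p h"
    and counit_right: "\<And>h. h \<in> carrier H \<Longrightarrow> psum C (\<lambda>a b. \<epsilon> (p b) \<odot>\<^bsub>C\<^esub> p a) (W h) = p h"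
  shows "sweedler_coalgebra k C d \<epsilon>"
proof -
  interpret H: module k H by fact
  interpret C: module k C by fact
  let ?CC = "tensor k C C" let ?T = "tensor k C ?CC"
  have CC: "module k ?CC" by (rule module_tensor[OF C C])
  have T: "module k ?T" by (rule module_tensor[OF C CC])
  note p' = linear_mapsD[OF p]
  (* The lists on C are known up to equality of tensors; the universal property extends this to
     every bilinear expression f. *)
  have eval: "psum P f (d (p h)) = psum P (\<lambda>a b. f (p a) (p b)) (W h)"
    if P: "module k P" and f: "f \<in> bilinear_maps k C C P" and h: "h \<in> carrier H" for P f h
  proof -
    have "psum P f (d (p h)) = tensor_lift P f (psum ?CC (pure_tensor k C C) (d (p h)))"
      using h by (simp add: lift_psum[OF C C P f] d p')
    also have "\<dots> = psum P (\<lambda>a b. tensor_lift P f (pure_tensor k C C (p a) (p b))) (W h)"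
      unfolding dW[OF h]
      by (rule linear_maps_psum[OF CC P lift_linear[OF C C P f] W[OF h]])
         (simp add: pure_tensor_closed C p')
    also have "\<dots> = psum P (\<lambda>a b. f (p a) (p b)) (W h)"
      by (rule psum_cong[OF W[OF h]]) (simp add: lift_pure[OF C C P f] p')
    finally show ?thesis .
  qed
  have d_lin: "(\<lambda>c. psum ?CC (pure_tensor k C C) (d c)) \<in> linear_maps k C ?CC"
  proof (rule linear_mapsI)
    fix x y r assume "x \<in> carrier C" "y \<in> carrier C"
    then obtain g h where gh: "g \<in> carrier H" "h \<in> carrier H" "x = p g" "y = p h" using surj by blast
    show "psum ?CC (pure_tensor k C C) (d (x \<oplus>\<^bsub>C\<^esub> y)) =
      psum ?CC (pure_tensor k C C) (d x) \<oplus>\<^bsub>?CC\<^esub> psum ?CC (pure_tensor k C C) (d y)"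
      using dW[of g] dW[of h] dW[of "g \<oplus>\<^bsub>H\<^esub> h"] linear_mapsD(2)[OF linear, of g h] gh p'(2) by simp
  next
    fix x r assume r: "r \<in> carrier k" "x \<in> carrier C"
    then obtain h where h: "h \<in> carrier H" "x = p h" using surj by blast
    show "psum ?CC (pure_tensor k C C) (d (r \<odot>\<^bsub>C\<^esub> x)) = r \<odot>\<^bsub>?CC\<^esub> psum ?CC (pure_tensor k C C) (d x)"
      using dW[of h] dW[of "r \<odot>\<^bsub>H\<^esub> h"] linear_mapsD(3)[OF linear, of r h] h r p'(3) by simp
  next
    fix x assume "x \<in> carrier C"
    then show "psum ?CC (pure_tensor k C C) (d x) \<in> carrier ?CC"
      using dW linear_mapsD(1)[OF linear] surj by auto
  qed
  have d_linear: "(\<lambda>c. psum P f (d c)) \<in> linear_maps k C P"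
    if P: "module k P" and f: "f \<in> bilinear_maps k C C P" for P f
  proof (rule linear_maps_cong[OF C])
    show "(\<lambda>c. tensor_lift P f (psum ?CC (pure_tensor k C C) (d c))) \<in> linear_maps k C P"
      by (rule linear_maps_comp[OF d_lin lift_linear[OF C C P f]])
  qed (simp add: lift_psum[OF C C P f] d)
  note lin = linear_pure_left[OF C C] linear_pure_right[OF C C] linear_pure_left[OF C CC] linear_pure_right[OF C CC]
    pure_tensor_closed[OF C C] linear_id bilinear_mapsI
  show ?thesis
  proof
    show "(\<lambda>c. psum ?CC (pure_tensor k C C) (d c)) \<in> linear_maps k C ?CC" by fact
    show "\<epsilon> \<in> linear_maps k C (regular_module k)" by fact
    fix c assume c: "c \<in> carrier C"
    then obtain h where h: "h \<in> carrier H" "c = p h" using surj by blast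
    show "set (d c) \<subseteq> carrier C \<times> carrier C" by (rule d[OF c])
    have \<epsilon>_closed: "\<epsilon> x \<in> carrier k" if "x \<in> carrier C" for x using linear_mapsD(1)[OF \<epsilon> that] by simp
    show "psum C (\<lambda>a b. \<epsilon> a \<odot>\<^bsub>C\<^esub> b) (d c) = c"
      unfolding h(2)
      by (rule trans[OF eval[OF C _ h(1)] counit_left[OF h(1)]]) (auto intro!: bilinear_mapsI linear_smult[OF C \<epsilon>] linear_smult_const[OF C] linear_id \<epsilon>_closed)
    show "psum C (\<lambda>a b. \<epsilon> b \<odot>\<^bsub>C\<^esub> a) (d c) = c"
      unfolding h(2)
      by (rule trans[OF eval[OF C _ h(1)] counit_right[OF h(1)]]) (auto intro!: bilinear_mapsI linear_smult[OF C \<epsilon>] linear_smult_const[OF C] linear_id \<epsilon>_closed)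
    let ?g = "\<lambda>a b c. pure_tensor k C ?CC a (pure_tensor k C C b c)"
    have "psum ?T (\<lambda>a b. psum ?T (\<lambda>a1 a2. ?g a1 a2 b) (d a)) (d c) =
      psum ?T (\<lambda>a b. psum ?T (\<lambda>a1 a2. ?g a1 a2 (p b)) (d (p a))) (W h)"
      unfolding h(2)
      by (rule eval[OF T _ h(1)])
         (auto intro!: bilinear_mapsI d_linear[OF T] linear_psum[OF T d] lin)
    also have "\<dots> = psum ?T (\<lambda>a b. psum ?T (\<lambda>a1 a2. ?g (p a1) (p a2) (p b)) (W a)) (W h)"
      by (rule psum_cong[OF W[OF h(1)]], rule eval[OF T]) (auto intro!: lin p')
    also have "\<dots> = psum ?T (\<lambda>a b. psum ?T (\<lambda>b1 b2. ?g (p a) (p b1) (p b2)) (W b)) (W h)"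
      by (rule coassoc[OF h(1)])
    also have "\<dots> = psum ?T (\<lambda>a b. psum ?T (\<lambda>b1 b2. ?g (p a) b1 b2) (d (p b))) (W h)"
      by (rule psum_cong[OF W[OF h(1)]], rule eval[OF T, symmetric]) (auto intro!: lin p')
    also have "\<dots> = psum ?T (\<lambda>a b. psum ?T (\<lambda>b1 b2. ?g a b1 b2) (d b)) (d c)"
      unfolding h(2)
      by (rule eval[OF T _ h(1), symmetric])
         (auto intro!: bilinear_mapsI d_linear[OF T] linear_psum[OF T d] lin)
    finally show "psum ?T (\<lambda>a b. psum ?T (\<lambda>a1 a2. ?g a1 a2 b) (d a)) (d c) =
      psum ?T (\<lambda>a b. psum ?T (\<lambda>b1 b2. ?g a b1 b2) (d b)) (d c)" .
  qed
qed

text \<open>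
  The compatibility of \<open>q\<close> with the given lists on \<open>D\<close> makes the comultiplication well defined, so the
  lemma covers quotient coalgebras as well as isomorphic copies.
\<close>

lemma transport_coalgebra:
  assumes sw: "sweedler_coalgebra k C d \<epsilon>" and D: "module k D"
    and q: "q \<in> linear_maps k C D" and surj: "carrier D = q ` carrier C"
    and d': "\<And>x. x \<in> carrier D \<Longrightarrow> set (d' x) \<subseteq> carrier D \<times> carrier D"
    and qd: "\<And>c. c \<in> carrier C \<Longrightarrow> psum (tensor k D D) (pure_tensor k D D) (d' (q c)) =
      psum (tensor k D D) (\<lambda>a b. pure_tensor k D D (q a) (q b)) (d c)"
    and \<epsilon>': "\<epsilon>' \<in> linear_maps k D (regular_module k)"
    and q\<epsilon>: "\<And>c. c \<in> carrier C \<Longrightarrow> \<epsilon>' (q c) = \<epsilon> c"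
  shows "sweedler_coalgebra k D d' \<epsilon>'"
proof -
  interpret sweedler_coalgebra k C d \<epsilon> by fact
  have DD: "module k (tensor k D D)" by (rule module_tensor[OF D D])
  have T: "module k (tensor k D (tensor k D D))" by (rule module_tensor[OF D DD])
  note q' = linear_mapsD(1)[OF q]
  note lin = linear_pure_left[OF D D _ q] linear_pure_right[OF D D _ q] linear_pure_left[OF D DD _ q]
    linear_pure_right[OF D DD] pure_tensor_closed[OF D D] q'
  show ?thesis
  proof (rule quotient_coalgebra[where d = d' and W = d and p = q, OF module_axioms D q surj d_closed d' qd])
    show "(\<lambda>h. psum (tensor k D D) (\<lambda>a b. pure_tensor k D D (q a) (q b)) (d h)) \<in> linear_maps k C (tensor k D D)"
      by (rule linear_d[OF DD]) (auto intro!: bilinear_mapsI lin)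
    show "psum (tensor k D (tensor k D D)) (\<lambda>a b. psum (tensor k D (tensor k D D))
        (\<lambda>a1 a2. pure_tensor k D (tensor k D D) (q a1) (pure_tensor k D D (q a2) (q b))) (d a)) (d h) =
      psum (tensor k D (tensor k D D)) (\<lambda>a b. psum (tensor k D (tensor k D D))
        (\<lambda>b1 b2. pure_tensor k D (tensor k D D) (q a) (pure_tensor k D D (q b1) (q b2))) (d b)) (d h)"
      if "h \<in> carrier C" for h
      by (rule coassoc[OF T _ that]) (auto intro!: trilinear_mapsI lin)
    show "psum D (\<lambda>a b. \<epsilon>' (q a) \<odot>\<^bsub>D\<^esub> q b) (d h) = q h" if "h \<in> carrier C" for h
      using counit_left_map[OF D q that] psum_cong[OF d_closed[OF that], of "\<lambda>a b. \<epsilon>' (q a) \<odot>\<^bsub>D\<^esub> q b" "\<lambda>a b. \<epsilon> a \<odot>\<^bsub>D\<^esub> q b" D]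
      by (simp add: q\<epsilon>)
    show "psum D (\<lambda>a b. \<epsilon>' (q b) \<odot>\<^bsub>D\<^esub> q a) (d h) = q h" if "h \<in> carrier C" for h
      using counit_right_map[OF D q that] psum_cong[OF d_closed[OF that], of "\<lambda>a b. \<epsilon>' (q b) \<odot>\<^bsub>D\<^esub> q a" "\<lambda>a b. \<epsilon> b \<odot>\<^bsub>D\<^esub> q a" D]
      by (simp add: q\<epsilon>)
  qed (use \<epsilon>' in auto)
qed

section \<open>Images of endomorphisms and the dual module\<close>

lemma image_module_simps [simp]:
  "carrier (image_module M f) = f ` carrier M" "ring.add (image_module M f) = ring.add M"
  "ring.zero (image_module M f) = ring.zero M" "smult (image_module M f) = smult M"
  by (simp_all add: image_module_def)

lemma module_image:
  assumes "module k M" "f \<in> linear_maps k M M"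
  shows "module k (image_module M f)"
proof -
  interpret module k M by fact
  note f = linear_mapsD[OF assms(2)]
  show ?thesis
  proof (rule moduleI[OF R.cring_axioms], rule abelian_groupI)
    show "\<zero>\<^bsub>image_module M f\<^esub> \<in> carrier (image_module M f)"
      using linear_maps_zero[OF assms(1,1,2)] by (auto intro!: rev_image_eqI[of "\<zero>\<^bsub>M\<^esub>"])
    fix x assume "x \<in> carrier (image_module M f)"
    then obtain y where y: "y \<in> carrier M" "x = f y" by auto
    show "\<exists>z\<in>carrier (image_module M f). z \<oplus>\<^bsub>image_module M f\<^esub> x = \<zero>\<^bsub>image_module M f\<^esub>"
      using y f(2)[of "\<ominus>\<^bsub>M\<^esub> y" y] linear_maps_zero[OF assms(1,1,2)]
      by (intro bexI[of _ "f (\<ominus>\<^bsub>M\<^esub> y)"]) (auto simp: M.l_neg)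
    show "r \<odot>\<^bsub>image_module M f\<^esub> x \<in> carrier (image_module M f)" if "r \<in> carrier k" for r
      using y that by (auto simp: f(3)[symmetric])
  next
    fix x y assume "x \<in> carrier (image_module M f)" "y \<in> carrier (image_module M f)"
    then show "x \<oplus>\<^bsub>image_module M f\<^esub> y \<in> carrier (image_module M f)"
      by (auto simp: f(2)[symmetric])
  qed (auto simp: f(1) a_ac smult_l_distr smult_r_distr smult_assoc1)
qed

lemma image_module_cong:
  "(\<And>x. x \<in> carrier M \<Longrightarrow> f x = g x) \<Longrightarrow> image_module M f = image_module M g"
  by (simp add: image_module_def cong: image_cong)

lemma linear_to_image:
  "f \<in> linear_maps k M M \<Longrightarrow> f \<in> linear_maps k M (image_module M f)"
  by (auto simp: linear_maps_def)

lemma linear_from_image: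
  "f \<in> linear_maps k M M \<Longrightarrow> g \<in> linear_maps k M N \<Longrightarrow> g \<in> linear_maps k (image_module M f) N"
  by (auto simp: linear_maps_def Pi_iff)

lemma psum_image: "psum (image_module M f) g ps = psum M g ps"
  by (induction ps) auto

lemma psum_smult:
  fixes k :: "'k ring" and P :: "('k, 'p) module"
  assumes "module k P" "set ps \<subseteq> A \<times> B" "\<And>a b. a \<in> A \<Longrightarrow> b \<in> B \<Longrightarrow> f a b \<in> carrier P" "r \<in> carrier k"
  shows "psum P (\<lambda>a b. r \<odot>\<^bsub>P\<^esub> f a b) ps = r \<odot>\<^bsub>P\<^esub> psum P f ps"
  using linear_maps_psum[OF assms(1,1) linear_smult_const[OF assms(1,4) linear_id] assms(2,3)] ..

lemma dual_simps [simp]: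
  "carrier (dual k H \<Delta> \<epsilon>) = linear_maps k H (regular_module k) \<inter> extensional (carrier H)"
  "\<phi> \<otimes>\<^bsub>dual k H \<Delta> \<epsilon>\<^esub> \<psi> = (\<lambda>h\<in>carrier H. tensor_lift k (\<lambda>h1 h2. \<phi> h2 \<otimes>\<^bsub>k\<^esub> \<psi> h1) (\<Delta> h))"
  "\<zero>\<^bsub>dual k H \<Delta> \<epsilon>\<^esub> = (\<lambda>h\<in>carrier H. \<zero>\<^bsub>k\<^esub>)"
  "\<phi> \<oplus>\<^bsub>dual k H \<Delta> \<epsilon>\<^esub> \<psi> = (\<lambda>h\<in>carrier H. \<phi> h \<oplus>\<^bsub>k\<^esub> \<psi> h)"
  "r \<odot>\<^bsub>dual k H \<Delta> \<epsilon>\<^esub> \<phi> = (\<lambda>h\<in>carrier H. r \<otimes>\<^bsub>k\<^esub> \<phi> h)"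
  by (auto simp: dual_def)

lemma module_dual:
  assumes "module k H"
  shows "module k (dual k H \<Delta> \<epsilon>)"
proof -
  interpret module k H by fact
  let ?D = "dual k H \<Delta> \<epsilon>"
  have lin: "(\<lambda>h\<in>carrier H. f h) \<in> carrier ?D" if "f \<in> linear_maps k H (regular_module k)" for f
    using linear_maps_cong[OF module_axioms _ that, of "\<lambda>h\<in>carrier H. f h"] by simp
  have val: "x \<in> carrier H \<Longrightarrow> \<phi> x \<in> carrier k"
    "\<lbrakk>x \<in> carrier H; y \<in> carrier H\<rbrakk> \<Longrightarrow> \<phi> (x \<oplus>\<^bsub>H\<^esub> y) = \<phi> x \<oplus>\<^bsub>k\<^esub> \<phi> y"
    "\<lbrakk>x \<in> carrier H; r \<in> carrier k\<rbrakk> \<Longrightarrow> \<phi> (r \<odot>\<^bsub>H\<^esub> x) = r \<otimes>\<^bsub>k\<^esub> \<phi> x"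
    if "\<phi> \<in> carrier ?D" for \<phi> x y r
    using linear_mapsD[of \<phi> k H "regular_module k"] that by auto
  show ?thesis
  proof (rule moduleI[OF R.cring_axioms], rule abelian_groupI)
    fix \<phi> \<psi> assume "\<phi> \<in> carrier ?D" "\<psi> \<in> carrier ?D"
    then show "\<phi> \<oplus>\<^bsub>?D\<^esub> \<psi> \<in> carrier ?D"
      by (simp only: dual_simps(4), intro lin linear_mapsI) (auto simp: val R.a_ac R.r_distr simp del: dual_simps)
  next
    show "\<zero>\<^bsub>?D\<^esub> \<in> carrier ?D"
      by (simp only: dual_simps(3), intro lin linear_mapsI) auto
  next
    fix \<phi> assume \<phi>: "\<phi> \<in> carrier ?D"
    show "\<exists>\<psi>\<in>carrier ?D. \<psi> \<oplus>\<^bsub>?D\<^esub> \<phi> = \<zero>\<^bsub>?D\<^esub>"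
    proof (intro bexI)
      show "(\<lambda>h\<in>carrier H. \<ominus>\<^bsub>k\<^esub> \<phi> h) \<in> carrier ?D"
        by (intro lin linear_mapsI) (auto simp: val[OF \<phi>] R.minus_add R.r_minus simp del: dual_simps)
      show "(\<lambda>h\<in>carrier H. \<ominus>\<^bsub>k\<^esub> \<phi> h) \<oplus>\<^bsub>?D\<^esub> \<phi> = \<zero>\<^bsub>?D\<^esub>"
        using val(1)[OF \<phi>] by (auto simp: R.l_neg intro!: restrict_ext)
    qed
    show "\<zero>\<^bsub>?D\<^esub> \<oplus>\<^bsub>?D\<^esub> \<phi> = \<phi>" "\<one>\<^bsub>k\<^esub> \<odot>\<^bsub>?D\<^esub> \<phi> = \<phi>"
      using val(1)[OF \<phi>] \<phi> by (auto intro!: extensionalityI[of _ "carrier H"])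
    fix r assume "r \<in> carrier k"
    then show "r \<odot>\<^bsub>?D\<^esub> \<phi> \<in> carrier ?D"
      using \<phi> by (simp only: dual_simps(5), intro lin linear_mapsI)
        (auto simp: val R.r_distr R.m_ac simp del: dual_simps)
  qed (auto simp: val R.a_ac R.m_ac R.l_distr R.r_distr linear_mapsD(1)[of _ k H "regular_module k", simplified] intro!: restrict_ext)
qed

section \<open>Prebialgebras in Sweedler notation\<close>

locale sweedler_prebialgebra = sweedler_coalgebra k H d \<epsilon>
  for k :: "'k ring" and H :: "('k, 'h) module" and d \<epsilon> +
  fixes m :: "'h \<Rightarrow> 'h \<Rightarrow> 'h" (infixl "\<star>" 70) and u :: 'h
  assumes m_bilinear: "(\<star>) \<in> bilinear_maps k H H H"
    and m_assoc: "\<lbrakk>x \<in> carrier H; y \<in> carrier H; z \<in> carrier H\<rbrakk> \<Longrightarrow> x \<star> y \<star> z = x \<star> (y \<star> z)"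
    and u_closed [simp]: "u \<in> carrier H"
    and m_u [simp]: "x \<in> carrier H \<Longrightarrow> x \<star> u = x"
    and u_m [simp]: "x \<in> carrier H \<Longrightarrow> u \<star> x = x"
    and d_mult: "\<lbrakk>x \<in> carrier H; y \<in> carrier H\<rbrakk> \<Longrightarrow>
      psum (tensor k H H) (pure_tensor k H H) (d (x \<star> y)) =
      psum (tensor k H H) (\<lambda>a b. psum (tensor k H H) (\<lambda>a' b'. pure_tensor k H H (a \<star> a') (b \<star> b')) (d y)) (d x)"
begin

text \<open>
  For \<open>d\<close> representing \<open>\<Delta>\<close> these are \<open>\<epsilon>\<^sub>s\<close> and \<open>\<epsilon>\<^sub>t\<close>. If the multiplication is reversed they become
  the barred \<open>\<epsilon>\<^sub>s\<close> and \<open>\<epsilon>\<^sub>t\<close>, if the comultiplication is reversed the barred \<open>\<epsilon>\<^sub>t\<close> and \<open>\<epsilon>\<^sub>s\<close>,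
  and if both are reversed \<open>\<epsilon>\<^sub>t\<close> and \<open>\<epsilon>\<^sub>s\<close>.
\<close>

definition e :: "'h \<Rightarrow> 'h" where
  "e h = psum H (\<lambda>a b. \<epsilon> (h \<star> b) \<odot>\<^bsub>H\<^esub> a) (d u)"

definition t :: "'h \<Rightarrow> 'h" where
  "t h = psum H (\<lambda>a b. \<epsilon> (a \<star> h) \<odot>\<^bsub>H\<^esub> b) (d u)"

abbreviation C where "C \<equiv> image_module H e"
abbreviation CC where "CC \<equiv> tensor k C C"
abbreviation CCC where "CCC \<equiv> tensor k C CC"
abbreviation ptC where "ptC \<equiv> pure_tensor k C C"
abbreviation ptCC where "ptCC \<equiv> pure_tensor k C CC"

definition rm :: bool where
  "rm \<longleftrightarrow> (\<forall>h\<in>carrier H. \<forall>x\<in>carrier H. \<forall>l\<in>carrier H.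
     \<epsilon> (h \<star> x \<star> l) = psum k (\<lambda>a b. \<epsilon> (h \<star> b) \<otimes>\<^bsub>k\<^esub> \<epsilon> (a \<star> l)) (d x))"

definition rc :: bool where
  "rc \<longleftrightarrow>
     psum (tensor k H (tensor k H H)) (\<lambda>a b. psum (tensor k H (tensor k H H))
        (\<lambda>a1 a2. pure_tensor k H (tensor k H H) a1 (pure_tensor k H H a2 b)) (d a)) (d u) =
     psum (tensor k H (tensor k H H)) (\<lambda>a b. psum (tensor k H (tensor k H H))
        (\<lambda>a' b'. pure_tensor k H (tensor k H H) a (pure_tensor k H H (a' \<star> b) b')) (d u)) (d u)"

lemmas H = module_axioms

lemma m_closed [simp]: "x \<in> carrier H \<Longrightarrow> y \<in> carrier H \<Longrightarrow> x \<star> y \<in> carrier H"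
  by (rule bilinear_mapsD(3)[OF m_bilinear])

lemma lin_m_left: "f \<in> linear_maps k M H \<Longrightarrow> c \<in> carrier H \<Longrightarrow> (\<lambda>x. f x \<star> c) \<in> linear_maps k M H"
  using linear_maps_comp[OF _ bilinear_mapsD(2)[OF m_bilinear]] .

lemma lin_m_right: "f \<in> linear_maps k M H \<Longrightarrow> c \<in> carrier H \<Longrightarrow> (\<lambda>x. c \<star> f x) \<in> linear_maps k M H"
  using linear_maps_comp[OF _ bilinear_mapsD(1)[OF m_bilinear]] .

lemma lin_eps: "f \<in> linear_maps k M H \<Longrightarrow> (\<lambda>x. \<epsilon> (f x)) \<in> linear_maps k M (regular_module k)"
  using linear_maps_comp[OF _ counit_linear] .

lemmas R_closed = d_closed[OF u_closed]

lemma regular: "module k (regular_module k)"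
  by (rule module_regular) (rule R.cring_axioms)

lemma e_linear: "e \<in> linear_maps k H H"
  unfolding e_def
  by (intro linear_psum[OF H R_closed] linear_smult[OF H] lin_eps lin_m_left linear_id)

lemma t_linear: "t \<in> linear_maps k H H"
  unfolding t_def
  by (intro linear_psum[OF H R_closed] linear_smult[OF H] lin_eps lin_m_right linear_id)

lemma e_closed [simp]: "x \<in> carrier H \<Longrightarrow> e x \<in> carrier H"
  by (rule linear_mapsD(1)[OF e_linear])

lemma t_closed [simp]: "x \<in> carrier H \<Longrightarrow> t x \<in> carrier H"
  by (rule linear_mapsD(1)[OF t_linear])

lemma eC_closed [simp]: "x \<in> carrier H \<Longrightarrow> e x \<in> e ` carrier H"
  by (rule imageI)

lemma C: "module k C" by (rule module_image[OF H e_linear])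
lemma CC: "module k CC" by (rule module_tensor[OF C C])
lemma CCC: "module k CCC" by (rule module_tensor[OF C CC])

lemmas lin_e = linear_maps_comp[OF _ e_linear]
lemmas lin_eC = linear_maps_comp[OF _ linear_to_image[OF e_linear]]
lemmas lin_t = linear_maps_comp[OF _ t_linear]

text \<open>
  Introduction rules that prove linearity of an expression by recursion on its syntax. They are
  driven by the outermost operation, so that no higher-order search is needed.
\<close>

lemmas lin = linear_id lin_m_left lin_m_right lin_e lin_eC lin_t lin_eps
  linear_smult[OF H] linear_smult[OF C] linear_smult[OF CC] linear_smult[OF CCC] linear_smult[OF regular, simplified]
  linear_smult_const[OF H] linear_smult_const[OF C] linear_smult_const[OF CC] linear_smult_const[OF CCC]
  linear_smult_const[OF regular, simplified]
  linear_pure_left[OF C C] linear_pure_right[OF C C] linear_pure_left[OF C CC] linear_pure_right[OF C CC]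
  bilinear_mapsI trilinear_mapsI

lemma ptC_closed [simp]: "a \<in> carrier C \<Longrightarrow> b \<in> carrier C \<Longrightarrow> ptC a b \<in> carrier CC"
  by (rule pure_tensor_closed[OF C C])

lemma ptCC_closed [simp]: "a \<in> carrier C \<Longrightarrow> b \<in> carrier CC \<Longrightarrow> ptCC a b \<in> carrier CCC"
  by (rule pure_tensor_closed[OF C CC])

lemma commute:
  assumes "module k P" "x \<in> carrier H" "y \<in> carrier H"
    and "\<And>a b c e. \<lbrakk>a \<in> carrier H; b \<in> carrier H; c \<in> carrier H; e \<in> carrier H\<rbrakk> \<Longrightarrow> f a b c e \<in> carrier P"
  shows "psum P (\<lambda>a b. psum P (f a b) (d y)) (d x) = psum P (\<lambda>c e. psum P (\<lambda>a b. f a b c e) (d x)) (d y)"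
proof -
  interpret P: module k P by fact
  show ?thesis by (rule P.psum_commute[OF d_closed d_closed]) (use assms in auto)
qed

lemma cong:
  assumes "x \<in> carrier H" "\<And>a b. a \<in> carrier H \<Longrightarrow> b \<in> carrier H \<Longrightarrow> f a b = g a b"
  shows "psum P f (d x) = psum P g (d x)"
  using psum_cong[OF d_closed] assms by metis

lemma closed:
  assumes "module k P" "x \<in> carrier H" "\<And>a b. a \<in> carrier H \<Longrightarrow> b \<in> carrier H \<Longrightarrow> f a b \<in> carrier P"
  shows "psum P f (d x) \<in> carrier P"
proof -
  interpret P: module k P by fact
  show ?thesis by (rule P.psum_closed[OF d_closed]) (use assms in auto)
qed

lemma smult_sum:
  fixes P :: "('k, 'p) module"
  assumes "module k P" "x \<in> carrier H" "\<And>a b. a \<in> carrier H \<Longrightarrow> b \<in> carrier H \<Longrightarrow> f a b \<in> carrier P" "r \<in> carrier k"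
  shows "psum P (\<lambda>a b. r \<odot>\<^bsub>P\<^esub> f a b) (d x) = r \<odot>\<^bsub>P\<^esub> psum P f (d x)"
  using psum_smult[OF assms(1) d_closed[OF assms(2)] assms(3,4)] by simp

lemma mult_sum:
  assumes P: "module k P" and f: "f \<in> bilinear_maps k H H P" and xy: "x \<in> carrier H" "y \<in> carrier H"
  shows "psum P f (d (x \<star> y)) = psum P (\<lambda>a b. psum P (\<lambda>a' b'. f (a \<star> a') (b \<star> b')) (d y)) (d x)"
proof -
  let ?HH = "tensor k H H"
  have HH: "module k ?HH" by (rule module_tensor[OF H H])
  note L = lift_linear[OF H H P f]
  note pt = pure_tensor_closed[OF H H]
  have "psum P f (d (x \<star> y)) = tensor_lift P f (psum ?HH (pure_tensor k H H) (d (x \<star> y)))"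
    using xy by (simp add: lift_psum[OF H H P f] d_closed)
  also have "\<dots> = psum P (\<lambda>a b. tensor_lift P f (psum ?HH (\<lambda>a' b'. pure_tensor k H H (a \<star> a') (b \<star> b')) (d y))) (d x)"
    unfolding d_mult[OF xy]
    by (rule linear_maps_psum[OF HH P L d_closed[OF xy(1)]]) (simp add: closed[OF HH xy(2)] pt)
  also have "\<dots> = psum P (\<lambda>a b. psum P (\<lambda>a' b'. tensor_lift P f (pure_tensor k H H (a \<star> a') (b \<star> b'))) (d y)) (d x)"
    by (rule cong[OF xy(1)], rule linear_maps_psum[OF HH P L d_closed[OF xy(2)]]) (simp add: pt)
  also have "\<dots> = psum P (\<lambda>a b. psum P (\<lambda>a' b'. f (a \<star> a') (b \<star> b')) (d y)) (d x)"
    by (intro cong xy) (simp add: lift_pure[OF H H P f])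
  finally show ?thesis .
qed

lemma e_apply:
  assumes P: "module k P" and f: "f \<in> linear_maps k H P" and h: "h \<in> carrier H"
  shows "f (e h) = psum P (\<lambda>a b. \<epsilon> (h \<star> b) \<odot>\<^bsub>P\<^esub> f a) (d u)"
  unfolding e_def
  by (subst linear_maps_psum[OF H P f R_closed]) (auto intro!: cong simp: h linear_mapsD(3)[OF f])

lemma t_apply:
  assumes P: "module k P" and f: "f \<in> linear_maps k H P" and h: "h \<in> carrier H"
  shows "f (t h) = psum P (\<lambda>a b. \<epsilon> (a \<star> h) \<odot>\<^bsub>P\<^esub> f b) (d u)"
  unfolding t_def
  by (subst linear_maps_psum[OF H P f R_closed]) (auto intro!: cong simp: h linear_mapsD(3)[OF f])

lemma counit_e:
  assumes h: "h \<in> carrier H" shows "\<epsilon> (e h) = \<epsilon> h"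
proof -
  have "\<epsilon> (e h) = psum (regular_module k) (\<lambda>a b. \<epsilon> (h \<star> b) \<otimes>\<^bsub>k\<^esub> \<epsilon> a) (d u)"
    using e_apply[OF regular counit_linear h] by simp
  also have "\<dots> = psum (regular_module k) (\<lambda>a b. \<epsilon> a \<odot>\<^bsub>regular_module k\<^esub> \<epsilon> (h \<star> b)) (d u)"
    by (rule cong) (auto simp: h R.m_comm)
  also have "\<dots> = \<epsilon> (h \<star> u)"
    by (rule counit_left_map[OF regular]) (auto intro!: lin simp: h)
  finally show ?thesis by (simp add: h)
qed

text \<open>
Both sides are \<open>\<epsilon>(h1\<^sub>(\<^sub>2\<^sub>)) \<epsilon>(1\<^sub>(\<^sub>1\<^sub>)x)\<close>: the maps \<open>e\<close> and \<open>t\<close> are adjoint for the form \<open>\<epsilon>(hx)\<close>.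
\<close>

lemma counit_t_e:
  assumes h: "h \<in> carrier H" and x: "x \<in> carrier H" shows "\<epsilon> (h \<star> t x) = \<epsilon> (e h \<star> x)"
proof -
  have "\<epsilon> (h \<star> t x) = psum (regular_module k) (\<lambda>a b. \<epsilon> (a \<star> x) \<otimes>\<^bsub>k\<^esub> \<epsilon> (h \<star> b)) (d u)"
    using t_apply[OF regular lin_eps[OF lin_m_right[OF linear_id h]] x] by simp
  also have "\<dots> = psum (regular_module k) (\<lambda>a b. \<epsilon> (h \<star> b) \<otimes>\<^bsub>k\<^esub> \<epsilon> (a \<star> x)) (d u)"
    by (rule cong) (auto simp: h x R.m_comm)
  also have "\<dots> = \<epsilon> (e h \<star> x)"
    using e_apply[OF regular lin_eps[OF lin_m_left[OF linear_id x]] h] by simp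
  finally show ?thesis .
qed

text \<open>
  Expands \<open>e(h)\<close> as \<open>e(e(h))\<close>, which keeps the legs in the image of \<open>e\<close>. This is needed where \<open>f\<close>
  is linear only on that image, as for tensors over it.
\<close>

lemma idem_apply:
  assumes idem: "\<And>h. h \<in> carrier H \<Longrightarrow> e (e h) = e h"
    and P: "module k P" and f: "(\<lambda>x. f (e x)) \<in> linear_maps k H P" and h: "h \<in> carrier H"
  shows "f (e h) = psum P (\<lambda>a b. \<epsilon> (h \<star> b) \<odot>\<^bsub>P\<^esub> f (e a)) (d u)"
  using e_apply[OF P f h] by (simp add: idem h)

abbreviation "\<Delta>C y \<equiv> map (\<lambda>(a, b). (e a, e (y \<star> b))) (d u)"

lemma \<Delta>C_closed: "y \<in> carrier C \<Longrightarrow> set (\<Delta>C y) \<subseteq> carrier C \<times> carrier C"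
  using R_closed by (auto intro!: imageI)

lemma counit_C: "\<epsilon> \<in> linear_maps k C (regular_module k)"
  by (rule linear_from_image[OF e_linear counit_linear])

section \<open>Coalgebra structure under right monoidality\<close>

context
  assumes rm: rm
begin

text \<open>
The axiom (rm) with an arbitrary vector in place of the scalar \<open>1\<close>, so that it can be used inside sums in any module.
\<close>

lemma rm_smult:
  fixes P :: "('k, 'p) module"
  assumes P: "module k P" and v: "v \<in> carrier P"
    and h: "h \<in> carrier H" and x: "x \<in> carrier H" and l: "l \<in> carrier H"
  shows "\<epsilon> (h \<star> x \<star> l) \<odot>\<^bsub>P\<^esub> v = psum P (\<lambda>a b. \<epsilon> (h \<star> b) \<odot>\<^bsub>P\<^esub> (\<epsilon> (a \<star> l) \<odot>\<^bsub>P\<^esub> v)) (d x)"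
proof -
  interpret P: module k P by fact
  have "\<epsilon> (h \<star> x \<star> l) \<odot>\<^bsub>P\<^esub> v = psum (regular_module k) (\<lambda>a b. \<epsilon> (h \<star> b) \<otimes>\<^bsub>k\<^esub> \<epsilon> (a \<star> l)) (d x) \<odot>\<^bsub>P\<^esub> v"
    using rm h x l by (simp add: rm_def psum_regular)
  also have "\<dots> = psum P (\<lambda>a b. (\<epsilon> (h \<star> b) \<otimes>\<^bsub>k\<^esub> \<epsilon> (a \<star> l)) \<odot>\<^bsub>P\<^esub> v) (d x)"
    by (rule linear_maps_psum[OF regular P linear_smult[OF P linear_id v] d_closed[OF x]]) (simp add: h l)
  also have "\<dots> = psum P (\<lambda>a b. \<epsilon> (h \<star> b) \<odot>\<^bsub>P\<^esub> (\<epsilon> (a \<star> l) \<odot>\<^bsub>P\<^esub> v)) (d x)"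
    by (rule cong[OF x]) (simp add: P.smult_assoc1 h l v)
  finally show ?thesis .
qed

text \<open>
With \<open>f\<close> the identity this is \<open>e(hl) = \<epsilon>(hl\<^sub>(\<^sub>2\<^sub>)) e(l\<^sub>(\<^sub>1\<^sub>))\<close>, namely (rm) at \<open>l\<close> inside the definition of \<open>e\<close>.
\<close>

lemma rm_e_mult:
  assumes P: "module k P" and f: "f \<in> linear_maps k C P" and h: "h \<in> carrier H" and l: "l \<in> carrier H"
  shows "f (e (h \<star> l)) = psum P (\<lambda>a b. \<epsilon> (h \<star> b) \<odot>\<^bsub>P\<^esub> f (e a)) (d l)"
proof -
  have "e (h \<star> l) = psum H (\<lambda>x y. psum H (\<lambda>a b. \<epsilon> (h \<star> b) \<odot>\<^bsub>H\<^esub> (\<epsilon> (a \<star> y) \<odot>\<^bsub>H\<^esub> x)) (d l)) (d u)"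
    unfolding e_def by (rule cong) (auto simp: rm_smult[OF H] h l)
  also have "\<dots> = psum H (\<lambda>a b. psum H (\<lambda>x y. \<epsilon> (h \<star> b) \<odot>\<^bsub>H\<^esub> (\<epsilon> (a \<star> y) \<odot>\<^bsub>H\<^esub> x)) (d u)) (d l)"
    by (rule commute[OF H]) (auto simp: h l)
  also have "\<dots> = psum H (\<lambda>a b. \<epsilon> (h \<star> b) \<odot>\<^bsub>H\<^esub> e a) (d l)"
    unfolding e_def by (rule cong[OF l], rule smult_sum[OF H]) (auto simp: h l)
  also have "\<dots> = psum C (\<lambda>a b. \<epsilon> (h \<star> b) \<odot>\<^bsub>C\<^esub> e a) (d l)"
    by (simp add: psum_image)
  finally have "f (e (h \<star> l)) = f (psum C (\<lambda>a b. \<epsilon> (h \<star> b) \<odot>\<^bsub>C\<^esub> e a) (d l))" by simp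
  also have "\<dots> = psum P (\<lambda>a b. f (\<epsilon> (h \<star> b) \<odot>\<^bsub>C\<^esub> e a)) (d l)"
    by (rule linear_maps_psum[OF C P f d_closed[OF l]]) (rule module.smult_closed[OF C]; simp add: h)
  also have "\<dots> = psum P (\<lambda>a b. \<epsilon> (h \<star> b) \<odot>\<^bsub>P\<^esub> f (e a)) (d l)"
    by (rule cong[OF l]) (rule linear_mapsD(3)[OF f]; simp add: h)
  finally show ?thesis .
qed

text \<open>
Expand \<open>e(h)l = \<epsilon>(h1\<^sub>(\<^sub>2\<^sub>)) 1\<^sub>(\<^sub>1\<^sub>)l\<close>; then (rm) at \<open>1\<close> removes \<open>\<Delta>(1)\<close>.
\<close>

lemma rm_e_e_mult:
  assumes h: "h \<in> carrier H" and l: "l \<in> carrier H"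
  shows "e (e h \<star> l) = e (h \<star> l)"
proof -
  have "e (e h \<star> l) = psum H (\<lambda>a b. \<epsilon> (h \<star> b) \<odot>\<^bsub>H\<^esub> e (a \<star> l)) (d u)"
    by (rule e_apply[OF H _ h]) (auto intro!: lin simp: l)
  also have "\<dots> = psum H (\<lambda>a b. psum H (\<lambda>x y. \<epsilon> (h \<star> b) \<odot>\<^bsub>H\<^esub> (\<epsilon> (a \<star> l \<star> y) \<odot>\<^bsub>H\<^esub> x)) (d u)) (d u)"
    unfolding e_def by (rule cong, simp, rule smult_sum[OF H, symmetric]) (auto simp: h l)
  also have "\<dots> = psum H (\<lambda>x y. psum H (\<lambda>a b. \<epsilon> (h \<star> b) \<odot>\<^bsub>H\<^esub> (\<epsilon> (a \<star> (l \<star> y)) \<odot>\<^bsub>H\<^esub> x)) (d u)) (d u)"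
    by (subst commute[OF H]) (auto simp: h l m_assoc intro!: cong)
  also have "\<dots> = psum H (\<lambda>x y. \<epsilon> (h \<star> u \<star> (l \<star> y)) \<odot>\<^bsub>H\<^esub> x) (d u)"
    by (rule cong, simp, rule rm_smult[OF H, symmetric]) (auto simp: h l)
  also have "\<dots> = e (h \<star> l)"
    unfolding e_def by (rule cong) (auto simp: h l m_assoc)
  finally show ?thesis .
qed

lemma rm_e_idem: "h \<in> carrier H \<Longrightarrow> e (e h) = e h"
  using rm_e_e_mult[of h u] by simp

lemma rm_t_idem:
  assumes h: "h \<in> carrier H" shows "t (t h) = t h"
proof -
  have "t (t h) = psum H (\<lambda>a b. \<epsilon> (a \<star> h) \<odot>\<^bsub>H\<^esub> t b) (d u)"
    by (rule t_apply[OF H t_linear h])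
  also have "\<dots> = psum H (\<lambda>a b. psum H (\<lambda>x y. \<epsilon> (a \<star> h) \<odot>\<^bsub>H\<^esub> (\<epsilon> (x \<star> b) \<odot>\<^bsub>H\<^esub> y)) (d u)) (d u)"
    unfolding t_def by (rule cong, simp, rule smult_sum[OF H, symmetric]) (auto simp: h)
  also have "\<dots> = psum H (\<lambda>x y. psum H (\<lambda>a b. \<epsilon> (x \<star> b) \<odot>\<^bsub>H\<^esub> (\<epsilon> (a \<star> h) \<odot>\<^bsub>H\<^esub> y)) (d u)) (d u)"
    by (subst commute[OF H]) (auto simp: h smult_assoc1[symmetric] R.m_comm intro!: cong)
  also have "\<dots> = psum H (\<lambda>x y. \<epsilon> (x \<star> u \<star> h) \<odot>\<^bsub>H\<^esub> y) (d u)"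
    by (rule cong, simp, rule rm_smult[OF H, symmetric]) (auto simp: h)
  also have "\<dots> = t h"
    unfolding t_def by (rule cong) (auto simp: h)
  finally show ?thesis .
qed

text \<open>
  Write \<open>h\<close> as \<open>h1\<close>. Then \<open>e(h\<^sub>(\<^sub>1\<^sub>)1\<^sub>(\<^sub>1\<^sub>)) \<otimes> e(h\<^sub>(\<^sub>2\<^sub>)1\<^sub>(\<^sub>2\<^sub>))\<close> becomes
  \<open>\<epsilon>(h\<^sub>(\<^sub>1\<^sub>)1\<^sub>(\<^sub>2\<^sub>)) e(1\<^sub>(\<^sub>1\<^sub>)) \<otimes> e(h\<^sub>(\<^sub>2\<^sub>)1\<^sub>(\<^sub>3\<^sub>))\<close> by \<open>rm_e_mult\<close> on the first factor, and the
  counit axiom for \<open>h1\<^sub>(\<^sub>2\<^sub>)\<close> contracts this to the right hand side.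
\<close>

lemma rm_comult_e:
  assumes h: "h \<in> carrier H"
  shows "psum CC (\<lambda>a b. ptC (e a) (e b)) (d h) = psum CC (\<lambda>a b. ptC (e a) (e (h \<star> b))) (d u)"
proof -
  have "psum CC (\<lambda>a b. ptC (e a) (e b)) (d h) = psum CC (\<lambda>a b. ptC (e a) (e b)) (d (h \<star> u))"
    by (simp add: h)
  also have "\<dots> = psum CC (\<lambda>h1 h2. psum CC (\<lambda>a b. ptC (e (h1 \<star> a)) (e (h2 \<star> b))) (d u)) (d h)"
    by (rule mult_sum[OF CC]) (auto intro!: lin simp: h)
  also have "\<dots> = psum CC (\<lambda>h1 h2. psum CC (\<lambda>a b. psum CC (\<lambda>a1 a2.
      \<epsilon> (h1 \<star> a2) \<odot>\<^bsub>CC\<^esub> ptC (e a1) (e (h2 \<star> b))) (d a)) (d u)) (d h)"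
    by (rule cong[OF h], rule cong, simp, rule rm_e_mult[OF CC]) (auto intro!: lin)
  also have "\<dots> = psum CC (\<lambda>h1 h2. psum CC (\<lambda>a b. psum CC (\<lambda>b1 b2.
      \<epsilon> (h1 \<star> b1) \<odot>\<^bsub>CC\<^esub> ptC (e a) (e (h2 \<star> b2))) (d b)) (d u)) (d h)"
    by (rule cong[OF h], rule coassoc[OF CC]) (auto intro!: lin ptC_closed)
  also have "\<dots> = psum CC (\<lambda>a b. psum CC (\<lambda>h1 h2. psum CC (\<lambda>b1 b2.
      \<epsilon> (h1 \<star> b1) \<odot>\<^bsub>CC\<^esub> ptC (e a) (e (h2 \<star> b2))) (d b)) (d h)) (d u)"
    by (rule commute[OF CC h]) (auto intro!: closed[OF CC] module.smult_closed[OF CC] ptC_closed)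
  also have "\<dots> = psum CC (\<lambda>a b. psum CC (\<lambda>x1 x2. \<epsilon> x1 \<odot>\<^bsub>CC\<^esub> ptC (e a) (e x2)) (d (h \<star> b))) (d u)"
    by (rule cong, simp, rule mult_sum[OF CC, symmetric]) (auto intro!: lin ptC_closed simp: h)
  also have "\<dots> = psum CC (\<lambda>a b. ptC (e a) (e (h \<star> b))) (d u)"
    by (rule cong, simp, rule counit_left_map[OF CC]) (auto intro!: lin simp: h)
  finally show ?thesis .
qed

lemma rm_coalgebra: "sweedler_coalgebra k C \<Delta>C \<epsilon>"
proof (rule transport_coalgebra[OF sweedler_coalgebra_axioms C linear_to_image[OF e_linear] _ \<Delta>C_closed _ counit_C])
  show "psum CC ptC (\<Delta>C (e h)) = psum CC (\<lambda>a b. ptC (e a) (e b)) (d h)" if "h \<in> carrier H" for h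
    unfolding rm_comult_e[OF that] psum_map by (rule cong) (simp_all add: rm_e_e_mult that)
qed (simp_all add: counit_e)

end

section \<open>Coalgebra structure under right comonoidality\<close>

context
  assumes rc: rc
begin

lemma rc_transfer:
  assumes P: "module k P" and f: "f \<in> trilinear_maps k H H H P"
  shows "psum P (\<lambda>a b. psum P (\<lambda>a1 a2. f a1 a2 b) (d a)) (d u) = psum P (\<lambda>a b. psum P (\<lambda>a' b'. f a (a' \<star> b) b') (d u)) (d u)"
proof -
  let ?HH = "tensor k H H" let ?T = "tensor k H ?HH"
  have HH: "module k ?HH" by (rule module_tensor[OF H H])
  have T: "module k ?T" by (rule module_tensor[OF H HH])
  note cl = pure_tensor_closed[OF H HH] pure_tensor_closed[OF H H]
  obtain \<Phi> where \<Phi>: "\<Phi> \<in> linear_maps k ?T P"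
    "\<And>a b c. a \<in> carrier H \<Longrightarrow> b \<in> carrier H \<Longrightarrow> c \<in> carrier H \<Longrightarrow>
       \<Phi> (pure_tensor k H ?HH a (pure_tensor k H H b c)) = f a b c"
    using trilinear_lift_right[OF H H H P f] by blast
  have "psum P (\<lambda>a b. psum P (\<lambda>a1 a2. f a1 a2 b) (d a)) (d u) =
    \<Phi> (psum ?T (\<lambda>a b. psum ?T (\<lambda>a1 a2. pure_tensor k H ?HH a1 (pure_tensor k H H a2 b)) (d a)) (d u))"
    by (subst linear_maps_psum[OF T P \<Phi>(1) R_closed], simp add: closed[OF T] cl,
        rule cong, simp, subst linear_maps_psum[OF T P \<Phi>(1) d_closed])
       (auto simp: cl \<Phi>(2) intro!: cong)
  also have "\<dots> = psum P (\<lambda>a b. psum P (\<lambda>a' b'. f a (a' \<star> b) b') (d u)) (d u)"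
    unfolding rc[unfolded rc_def]
    by (subst linear_maps_psum[OF T P \<Phi>(1) R_closed], simp add: closed[OF T] cl,
        rule cong, simp, subst linear_maps_psum[OF T P \<Phi>(1) R_closed])
       (auto simp: cl \<Phi>(2) intro!: cong)
  finally show ?thesis .
qed

text \<open>
  Contracting the middle leg of (rc) with \<open>\<epsilon>\<close> gives \<open>\<epsilon>(1\<^sub>(\<^sub>1\<^sub>'\<^sub>)1\<^sub>(\<^sub>2\<^sub>)) 1\<^sub>(\<^sub>1\<^sub>) \<otimes> 1\<^sub>(\<^sub>2\<^sub>'\<^sub>) = \<Delta>(1)\<close>. Its left
  hand side can be read as \<open>e\<close> applied to the first leg of \<open>\<Delta>(1)\<close>, or as \<open>t\<close> applied to the second.
\<close>

lemma rc_e: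
  assumes P: "module k P" and f: "f \<in> bilinear_maps k H H P"
  shows "psum P (\<lambda>a b. f (e a) b) (d u) = psum P f (d u)"
proof -
  interpret P: module k P by fact
  note f' = bilinear_mapsD[OF f]
  have "psum P (\<lambda>a b. f (e a) b) (d u) = psum P (\<lambda>x y. psum P (\<lambda>a b. \<epsilon> (x \<star> b) \<odot>\<^bsub>P\<^esub> f a y) (d u)) (d u)"
    by (rule cong, simp, rule e_apply[OF P]) (auto intro!: f')
  also have "\<dots> = psum P (\<lambda>a b. psum P (\<lambda>x y. \<epsilon> (x \<star> b) \<odot>\<^bsub>P\<^esub> f a y) (d u)) (d u)"
    by (rule commute[OF P]) (auto intro!: f')
  also have "\<dots> = psum P (\<lambda>a b. psum P (\<lambda>a1 a2. \<epsilon> a2 \<odot>\<^bsub>P\<^esub> f a1 b) (d a)) (d u)"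
    by (rule rc_transfer[OF P, symmetric])
       (auto intro!: trilinear_mapsI linear_smult[OF P] linear_smult_const[OF P] lin_eps f' linear_id)
  also have "\<dots> = psum P f (d u)"
    by (rule cong, simp, rule counit_right_map[OF P]) (auto intro!: f')
  finally show ?thesis .
qed

lemma rc_t:
  assumes P: "module k P" and f: "f \<in> bilinear_maps k H H P"
  shows "psum P (\<lambda>a b. f a (t b)) (d u) = psum P f (d u)"
proof -
  interpret P: module k P by fact
  note f' = bilinear_mapsD[OF f]
  have "psum P (\<lambda>a b. f a (t b)) (d u) = psum P (\<lambda>a b. psum P (\<lambda>x y. \<epsilon> (x \<star> b) \<odot>\<^bsub>P\<^esub> f a y) (d u)) (d u)"
    by (rule cong, simp, rule t_apply[OF P]) (auto intro!: f')
  also have "\<dots> = psum P (\<lambda>a b. psum P (\<lambda>a1 a2. \<epsilon> a2 \<odot>\<^bsub>P\<^esub> f a1 b) (d a)) (d u)"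
    by (rule rc_transfer[OF P, symmetric])
       (auto intro!: trilinear_mapsI linear_smult[OF P] linear_smult_const[OF P] lin_eps f' linear_id)
  also have "\<dots> = psum P f (d u)"
    by (rule cong, simp, rule counit_right_map[OF P]) (auto intro!: f')
  finally show ?thesis .
qed

lemma rc_e_idem:
  assumes h: "h \<in> carrier H" shows "e (e h) = e h"
  by (rule trans[OF e_apply[OF H e_linear h]], unfold e_def[of h], rule rc_e[OF H]) (auto intro!: lin simp: h)

lemma rc_t_idem:
  assumes h: "h \<in> carrier H" shows "t (t h) = t h"
  by (rule trans[OF t_apply[OF H t_linear h]], unfold t_def[of h], rule rc_t[OF H]) (auto intro!: lin simp: h)

text \<open>
Since \<open>t(h) = \<epsilon>(1\<^sub>(\<^sub>1\<^sub>)h) 1\<^sub>(\<^sub>2\<^sub>)\<close>, this is (rc) with \<open>\<epsilon>(-h)\<close> applied to the first leg.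
\<close>

lemma rc_d_t:
  assumes P: "module k P" and f: "f \<in> bilinear_maps k H H P" and h: "h \<in> carrier H"
  shows "psum P f (d (t h)) = psum P (\<lambda>a b. f (a \<star> t h) b) (d u)"
proof -
  interpret P: module k P by fact
  note f' = bilinear_mapsD[OF f]
  have f2: "(\<lambda>x. f (g x) b) \<in> linear_maps k M P" if "g \<in> linear_maps k M H" "b \<in> carrier H" for g M b
    using linear_maps_comp[OF that(1) f'(2)[OF that(2)]] .
  have "psum P f (d (t h)) = psum P (\<lambda>a b. \<epsilon> (a \<star> h) \<odot>\<^bsub>P\<^esub> psum P f (d b)) (d u)"
    by (rule t_apply[OF P linear_d[OF P f] h])
  also have "\<dots> = psum P (\<lambda>a b. psum P (\<lambda>b1 b2. \<epsilon> (a \<star> h) \<odot>\<^bsub>P\<^esub> f b1 b2) (d b)) (d u)"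
    by (rule cong, simp, rule smult_sum[OF P, symmetric]) (auto simp: h f')
  also have "\<dots> = psum P (\<lambda>a b. psum P (\<lambda>a1 a2. \<epsilon> (a1 \<star> h) \<odot>\<^bsub>P\<^esub> f a2 b) (d a)) (d u)"
    by (rule coassoc[OF P, symmetric])
       (auto intro!: trilinear_mapsI linear_smult[OF P] linear_smult_const[OF P] lin_eps lin_m_left f' linear_id simp: h)
  also have "\<dots> = psum P (\<lambda>a b. psum P (\<lambda>x y. \<epsilon> (a \<star> h) \<odot>\<^bsub>P\<^esub> f (x \<star> b) y) (d u)) (d u)"
    by (rule rc_transfer[OF P])
       (auto intro!: trilinear_mapsI linear_smult[OF P] linear_smult_const[OF P] lin_eps lin_m_left f' linear_id simp: h)
  also have "\<dots> = psum P (\<lambda>x y. psum P (\<lambda>a b. \<epsilon> (a \<star> h) \<odot>\<^bsub>P\<^esub> f (x \<star> b) y) (d u)) (d u)"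
    by (rule commute[OF P]) (auto intro!: f' simp: h)
  also have "\<dots> = psum P (\<lambda>x y. f (x \<star> t h) y) (d u)"
    by (rule cong, simp, rule t_apply[OF P, symmetric]) (auto intro!: f2 lin simp: h)
  finally show ?thesis .
qed

text \<open>
  For \<open>z\<close>, \<open>w\<close> in the image of \<open>t\<close>, the formula for \<open>\<Delta>(w)\<close> and \<open>\<Delta>(z)\<Delta>(1) = \<Delta>(z)\<close> give
  \<open>\<Delta>(zw) = 1\<^sub>(\<^sub>1\<^sub>)zw \<otimes> 1\<^sub>(\<^sub>2\<^sub>)\<close>, and the counit axiom turns this into \<open>zw = t(zw)\<close>. The proof runs
  through these steps with the counit already applied to the first leg.
\<close>

lemma rc_t_mult:
  assumes x: "x \<in> carrier H" and y: "y \<in> carrier H"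
  shows "t (t x \<star> t y) = t x \<star> t y"
proof -
  define z w where "z = t x" and "w = t y"
  have zw [simp]: "z \<in> carrier H" "w \<in> carrier H" by (simp_all add: z_def w_def x y)
  have "z \<star> w = psum H (\<lambda>a b. \<epsilon> a \<odot>\<^bsub>H\<^esub> b) (d (z \<star> w))" by (simp add: d_counit_left)
  also have "\<dots> = psum H (\<lambda>a b. psum H (\<lambda>a' b'. \<epsilon> (a \<star> a') \<odot>\<^bsub>H\<^esub> (b \<star> b')) (d w)) (d z)"
    by (rule mult_sum[OF H]) (auto intro!: lin)
  also have "\<dots> = psum H (\<lambda>a b. psum H (\<lambda>a' b'. \<epsilon> (a \<star> (a' \<star> w)) \<odot>\<^bsub>H\<^esub> (b \<star> b')) (d u)) (d z)"
    unfolding w_def by (rule cong, simp, rule rc_d_t[OF H]) (auto intro!: lin simp: y)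
  also have "\<dots> = psum H (\<lambda>a b. psum H (\<lambda>a' b'. \<epsilon> (a \<star> a' \<star> w) \<odot>\<^bsub>H\<^esub> (b \<star> b')) (d u)) (d z)"
    by (intro cong) (auto simp: m_assoc)
  also have "\<dots> = psum H (\<lambda>a b. \<epsilon> (a \<star> w) \<odot>\<^bsub>H\<^esub> b) (d (z \<star> u))"
    by (rule mult_sum[OF H, symmetric]) (auto intro!: lin)
  also have "\<dots> = psum H (\<lambda>a b. \<epsilon> (a \<star> w) \<odot>\<^bsub>H\<^esub> b) (d z)" by simp
  also have "\<dots> = psum H (\<lambda>a b. \<epsilon> (a \<star> z \<star> w) \<odot>\<^bsub>H\<^esub> b) (d u)"
    unfolding z_def by (rule rc_d_t[OF H]) (auto intro!: lin simp: x)
  also have "\<dots> = t (z \<star> w)"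
    unfolding t_def by (intro cong) (auto simp: m_assoc)
  finally show ?thesis unfolding z_def w_def ..
qed

text \<open>
  In \<open>e(xt(y)) = \<epsilon>(xt(y)1\<^sub>(\<^sub>2\<^sub>)) 1\<^sub>(\<^sub>1\<^sub>)\<close> the leg \<open>1\<^sub>(\<^sub>2\<^sub>)\<close> may be replaced by its image under \<open>t\<close>; the
  product \<open>t(y)t(1\<^sub>(\<^sub>2\<^sub>))\<close> is again a value of \<open>t\<close>, so adjointness moves \<open>t\<close> over to \<open>x\<close>.
\<close>

lemma rc_e_mult_t:
  assumes x: "x \<in> carrier H" and y: "y \<in> carrier H"
  shows "e (e x \<star> t y) = e (x \<star> t y)"
proof -
  have *: "e (z \<star> t y) = psum H (\<lambda>a b. \<epsilon> (z \<star> t y \<star> t b) \<odot>\<^bsub>H\<^esub> a) (d u)" if z: "z \<in> carrier H" for z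
    unfolding e_def by (rule rc_t[OF H, symmetric]) (auto intro!: lin simp: y z)
  have "\<epsilon> (e x \<star> t y \<star> t b) = \<epsilon> (x \<star> t y \<star> t b)" if b: "b \<in> carrier H" for b
    using counit_t_e[of x "t y \<star> t b"] by (simp add: rc_t_mult m_assoc x y b)
  then show ?thesis unfolding *[OF x] *[OF e_closed[OF x]] by (intro cong) (auto simp: x y)
qed

lemma rc_e_e_mult:
  assumes h: "h \<in> carrier H"
  shows "psum CC (\<lambda>a b. ptC (e a) (e (e h \<star> b))) (d u) = psum CC (\<lambda>a b. ptC (e a) (e (h \<star> b))) (d u)"
proof -
  have *: "psum CC (\<lambda>a b. ptC (e a) (e (x \<star> t b))) (d u) = psum CC (\<lambda>a b. ptC (e a) (e (x \<star> b))) (d u)"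
    if x: "x \<in> carrier H" for x
    by (rule rc_t[OF CC]) (auto intro!: lin simp: x)
  show ?thesis
    unfolding *[OF h, symmetric] *[OF e_closed[OF h], symmetric] by (rule cong) (auto simp: rc_e_mult_t h)
qed

text \<open>
  Expanding \<open>e(1\<^sub>(\<^sub>1\<^sub>)y)\<close> by the definition of \<open>e\<close> turns the left hand side into
  \<open>e(1\<^sub>(\<^sub>1\<^sub>)) \<otimes> e(1\<^sub>(\<^sub>1\<^sub>'\<^sub>)) \<otimes> e(h t(1\<^sub>(\<^sub>2\<^sub>)1\<^sub>(\<^sub>2\<^sub>'\<^sub>)))\<close>. The two legs inside \<open>t\<close> may be taken in the image
  of \<open>t\<close>, where the outer \<open>t\<close> acts trivially on their product.
\<close>

lemma rc_coassoc:
  assumes h: "h \<in> carrier H"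
  shows "psum CCC (\<lambda>a b. psum CCC (\<lambda>x y. ptCC (e x) (ptC (e (a \<star> y)) (e (h \<star> b)))) (d u)) (d u) =
    psum CCC (\<lambda>a b. psum CCC (\<lambda>x y. ptCC (e a) (ptC (e x) (e (h \<star> b \<star> y)))) (d u)) (d u)"
proof -
  have cl: "ptCC (e a) (ptC (e b) (e c)) \<in> carrier CCC" if "a \<in> carrier H" "b \<in> carrier H" "c \<in> carrier H" for a b c
    using that by (simp add: ptC_closed ptCC_closed)
  have scl: "r \<odot>\<^bsub>CCC\<^esub> ptCC (e a) (ptC (e b) (e c)) \<in> carrier CCC"
    if "r \<in> carrier k" "a \<in> carrier H" "b \<in> carrier H" "c \<in> carrier H" for r a b c
    using that by (auto intro!: module.smult_closed[OF CCC] cl)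
  have "psum CCC (\<lambda>a b. psum CCC (\<lambda>x y. ptCC (e x) (ptC (e (a \<star> y)) (e (h \<star> b)))) (d u)) (d u) =
    psum CCC (\<lambda>x y. psum CCC (\<lambda>a b. ptCC (e x) (ptC (e (a \<star> y)) (e (h \<star> b)))) (d u)) (d u)"
    by (rule commute[OF CCC]) (auto intro!: cl simp: h)
  also have "\<dots> = psum CCC (\<lambda>x y. psum CCC (\<lambda>p q. ptCC (e x) (ptC (e p) (e (h \<star> t (y \<star> q))))) (d u)) (d u)"
  proof (rule cong, simp)
    fix x y assume xy: "x \<in> carrier H" "y \<in> carrier H"
    have "psum CCC (\<lambda>a b. ptCC (e x) (ptC (e (a \<star> y)) (e (h \<star> b)))) (d u) =
      psum CCC (\<lambda>a b. psum CCC (\<lambda>p q. \<epsilon> (a \<star> y \<star> q) \<odot>\<^bsub>CCC\<^esub> ptCC (e x) (ptC (e p) (e (h \<star> b)))) (d u)) (d u)"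
      by (rule cong, simp, rule idem_apply[OF rc_e_idem CCC, where f = "\<lambda>c. ptCC (e _) (ptC c (e _))"])
         (auto intro!: lin simp: xy h)
    also have "\<dots> = psum CCC (\<lambda>p q. psum CCC (\<lambda>a b. \<epsilon> (a \<star> (y \<star> q)) \<odot>\<^bsub>CCC\<^esub> ptCC (e x) (ptC (e p) (e (h \<star> b)))) (d u)) (d u)"
      by (subst commute[OF CCC]) (auto intro!: scl cong simp: xy h m_assoc)
    also have "\<dots> = psum CCC (\<lambda>p q. ptCC (e x) (ptC (e p) (e (h \<star> t (y \<star> q))))) (d u)"
      by (rule cong, simp, rule t_apply[OF CCC, symmetric]) (auto intro!: lin simp: xy h)
    finally show "psum CCC (\<lambda>a b. ptCC (e x) (ptC (e (a \<star> y)) (e (h \<star> b)))) (d u) =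
      psum CCC (\<lambda>p q. ptCC (e x) (ptC (e p) (e (h \<star> t (y \<star> q))))) (d u)" .
  qed
  also have "\<dots> = psum CCC (\<lambda>x y. psum CCC (\<lambda>p q. ptCC (e x) (ptC (e p) (e (h \<star> t (t y \<star> t q))))) (d u)) (d u)"
  proof -
    have "psum CCC (\<lambda>x y. psum CCC (\<lambda>p q. ptCC (e x) (ptC (e p) (e (h \<star> t (y \<star> q))))) (d u)) (d u) =
      psum CCC (\<lambda>x y. psum CCC (\<lambda>p q. ptCC (e x) (ptC (e p) (e (h \<star> t (y \<star> t q))))) (d u)) (d u)"
      by (rule cong, simp, rule rc_t[OF CCC, symmetric]) (auto intro!: lin ptC_closed simp: h)
    also have "\<dots> = psum CCC (\<lambda>x y. psum CCC (\<lambda>p q. ptCC (e x) (ptC (e p) (e (h \<star> t (t y \<star> t q))))) (d u)) (d u)"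
      by (rule rc_t[OF CCC, symmetric]) (auto intro!: lin linear_psum[OF CCC R_closed] simp: h)
    finally show ?thesis .
  qed
  also have "\<dots> = psum CCC (\<lambda>x y. psum CCC (\<lambda>p q. ptCC (e x) (ptC (e p) (e (h \<star> (t y \<star> t q))))) (d u)) (d u)"
    by (intro cong) (auto simp: rc_t_mult)
  also have "\<dots> = psum CCC (\<lambda>x y. psum CCC (\<lambda>p q. ptCC (e x) (ptC (e p) (e (h \<star> (t y \<star> q))))) (d u)) (d u)"
    by (rule cong, simp, rule rc_t[OF CCC]) (auto intro!: lin ptC_closed simp: h)
  also have "\<dots> = psum CCC (\<lambda>x y. psum CCC (\<lambda>p q. ptCC (e x) (ptC (e p) (e (h \<star> (y \<star> q))))) (d u)) (d u)"
    by (rule rc_t[OF CCC]) (auto intro!: lin linear_psum[OF CCC R_closed] simp: h)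
  also have "\<dots> = psum CCC (\<lambda>a b. psum CCC (\<lambda>x y. ptCC (e a) (ptC (e x) (e (h \<star> b \<star> y)))) (d u)) (d u)"
    by (intro cong) (auto simp: m_assoc h)
  finally show ?thesis .
qed

lemma rc_coalgebra: "sweedler_coalgebra k C \<Delta>C \<epsilon>"
proof -
  let ?W = "\<lambda>h. map (\<lambda>(a, b). (a, h \<star> b)) (d u)"
  show ?thesis
  proof (rule quotient_coalgebra[where p = e and W = ?W, OF H C linear_to_image[OF e_linear] _ _ \<Delta>C_closed _ _ counit_C])
    fix h assume h: "h \<in> carrier H"
    show "set (?W h) \<subseteq> carrier H \<times> carrier H" using R_closed h by auto
    show "psum CC ptC (\<Delta>C (e h)) = psum CC (\<lambda>a b. ptC (e a) (e b)) (?W h)"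
      unfolding psum_map by (rule rc_e_e_mult[OF h])
    show "psum CCC (\<lambda>a b. psum CCC (\<lambda>a1 a2. ptCC (e a1) (ptC (e a2) (e b))) (?W a)) (?W h) =
      psum CCC (\<lambda>a b. psum CCC (\<lambda>b1 b2. ptCC (e a) (ptC (e b1) (e b2))) (?W b)) (?W h)"
      unfolding psum_map by (rule rc_coassoc[OF h])
    have "psum C (\<lambda>a b. \<epsilon> (e a) \<odot>\<^bsub>C\<^esub> e (h \<star> b)) (d u) = psum C (\<lambda>a b. \<epsilon> a \<odot>\<^bsub>C\<^esub> e (h \<star> b)) (d u)"
      by (rule cong) (auto simp: counit_e)
    also have "\<dots> = e (h \<star> u)"
      by (rule counit_left_map[OF C]) (auto intro!: lin simp: h)
    finally show "psum C (\<lambda>a b. \<epsilon> (e a) \<odot>\<^bsub>C\<^esub> e b) (?W h) = e h"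
      unfolding psum_map by (simp add: h)
    have "psum C (\<lambda>a b. \<epsilon> (e (h \<star> b)) \<odot>\<^bsub>C\<^esub> e a) (d u) = psum C (\<lambda>a b. \<epsilon> (h \<star> b) \<odot>\<^bsub>C\<^esub> e a) (d u)"
      by (rule cong) (auto simp: counit_e h)
    also have "\<dots> = e (e h)"
      by (rule e_apply[OF C linear_to_image[OF e_linear] h, symmetric])
    finally show "psum C (\<lambda>a b. \<epsilon> (e b) \<odot>\<^bsub>C\<^esub> e a) (?W h) = e h"
      unfolding psum_map by (simp add: h rc_e_idem)
  next
    show "(\<lambda>h. psum CC (\<lambda>a b. ptC (e a) (e b)) (?W h)) \<in> linear_maps k H CC"
      unfolding psum_map by (rule linear_psum[OF CC R_closed]) (auto intro!: lin)
  qed simp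
qed

end

section \<open>Coalgebra structure on the dual side\<close>

definition dual_e :: "('h \<Rightarrow> 'k) \<Rightarrow> 'h \<Rightarrow> 'k" where
  "dual_e \<phi> = compose (carrier H) \<phi> t"

definition g :: "'h \<Rightarrow> 'h \<Rightarrow> 'k" where
  "g y = (\<lambda>x\<in>carrier H. \<epsilon> (x \<star> y))"

definition g' :: "'h \<Rightarrow> 'h \<Rightarrow> 'k" where
  "g' y = (\<lambda>x\<in>carrier H. \<epsilon> (y \<star> x))"

definition conv :: "('h \<Rightarrow> 'k) \<Rightarrow> ('h \<Rightarrow> 'k) \<Rightarrow> 'h \<Rightarrow> 'k" where
  "conv \<phi> \<psi> = (\<lambda>h\<in>carrier H. psum k (\<lambda>a b. \<phi> b \<otimes>\<^bsub>k\<^esub> \<psi> a) (d h))"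

lemma restrict_linear:
  "f \<in> linear_maps k H N \<Longrightarrow> restrict f (carrier H) \<in> linear_maps k H N"
  by (rule linear_maps_cong[OF H, of _ f]) auto

lemma dualI: "f \<in> linear_maps k H (regular_module k) \<Longrightarrow> restrict f (carrier H) \<in> carrier (dual k H \<Delta>0 \<epsilon>0)"
  by (simp add: restrict_linear)

lemma g_closed: "y \<in> carrier H \<Longrightarrow> g y \<in> carrier (dual k H \<Delta>0 \<epsilon>0)"
  unfolding g_def by (rule dualI) (auto intro!: lin)

lemma g'_linear: "g' \<in> linear_maps k H (dual k H \<Delta>0 \<epsilon>0)"
proof (rule linear_mapsI)
  show "g' y \<in> carrier (dual k H \<Delta>0 \<epsilon>0)" if "y \<in> carrier H" for y
    unfolding g'_def by (rule dualI) (auto intro!: lin simp: that)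
  show "g' (x \<oplus>\<^bsub>H\<^esub> y) = g' x \<oplus>\<^bsub>dual k H \<Delta>0 \<epsilon>0\<^esub> g' y" if "x \<in> carrier H" "y \<in> carrier H" for x y
    using linear_mapsD(2)[OF lin_eps[OF lin_m_left[OF linear_id]]] that
    by (auto simp: g'_def intro!: restrict_ext)
  show "g' (r \<odot>\<^bsub>H\<^esub> x) = r \<odot>\<^bsub>dual k H \<Delta>0 \<epsilon>0\<^esub> g' x" if "r \<in> carrier k" "x \<in> carrier H" for x r
    using linear_mapsD(3)[OF lin_eps[OF lin_m_left[OF linear_id]]] that
    by (auto simp: g'_def intro!: restrict_ext)
qed

lemma dual_e_linear: "dual_e \<in> linear_maps k (dual k H \<Delta>0 \<epsilon>0) (dual k H \<Delta>0 \<epsilon>0)"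
proof (rule linear_mapsI)
  show "dual_e \<phi> \<in> carrier (dual k H \<Delta>0 \<epsilon>0)" if "\<phi> \<in> carrier (dual k H \<Delta>0 \<epsilon>0)" for \<phi>
    unfolding dual_e_def compose_def by (rule dualI) (use that linear_maps_comp[OF t_linear] in auto)
qed (auto simp: dual_e_def compose_def intro!: restrict_ext)

lemma conv_closed:
  assumes "\<phi> \<in> carrier (dual k H \<Delta>0 \<epsilon>0)" "\<psi> \<in> carrier (dual k H \<Delta>0 \<epsilon>0)"
  shows "conv \<phi> \<psi> \<in> carrier (dual k H \<Delta>0 \<epsilon>0)"
proof -
  have \<phi>\<psi>: "\<phi> \<in> linear_maps k H (regular_module k)" "\<psi> \<in> linear_maps k H (regular_module k)" using assms by auto
  have "(\<lambda>h. psum (regular_module k) (\<lambda>a b. \<phi> b \<otimes>\<^bsub>k\<^esub> \<psi> a) (d h)) \<in> linear_maps k H (regular_module k)"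
    using linear_mapsD(1)[OF \<phi>\<psi>(1)] linear_mapsD(1)[OF \<phi>\<psi>(2)]
    by (intro linear_d[OF regular] bilinear_mapsI linear_smult[OF regular \<phi>\<psi>(1), simplified]
        linear_smult_const[OF regular _ \<phi>\<psi>(2), simplified]) auto
  then show ?thesis unfolding conv_def psum_regular by (rule dualI)
qed

lemma dual_e_g':
  assumes y: "y \<in> carrier H" shows "dual_e (g' y) = g' (e y)"
  unfolding dual_e_def compose_def g'_def
  by (rule restrict_ext) (simp add: counit_t_e y)

text \<open>
The functional \<open>\<phi> \<circ> t\<close> is represented by \<open>\<langle>\<phi>, 1\<^sub>(\<^sub>2\<^sub>)\<rangle> 1\<^sub>(\<^sub>1\<^sub>)\<close>; this is why \<open>g'\<close> is onto the image of \<open>dual_e\<close>.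
\<close>

lemma dual_e_eq_g':
  assumes "\<phi> \<in> carrier (dual k H \<Delta>0 \<epsilon>0)"
  shows "dual_e \<phi> = g' (psum H (\<lambda>a b. \<phi> b \<odot>\<^bsub>H\<^esub> a) (d u))"
proof -
  have \<phi>: "\<phi> \<in> linear_maps k H (regular_module k)" using assms by simp
  have \<phi>_closed: "\<phi> b \<in> carrier k" if "b \<in> carrier H" for b using linear_mapsD(1)[OF \<phi> that] by simp
  show ?thesis
    unfolding dual_e_def compose_def g'_def
  proof (rule restrict_ext)
    fix x assume x: "x \<in> carrier H"
    have "\<phi> (t x) = psum (regular_module k) (\<lambda>a b. \<epsilon> (a \<star> x) \<otimes>\<^bsub>k\<^esub> \<phi> b) (d u)"
      using t_apply[OF regular \<phi> x] by simp
    also have "\<dots> = psum (regular_module k) (\<lambda>a b. \<epsilon> ((\<phi> b \<odot>\<^bsub>H\<^esub> a) \<star> x)) (d u)"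
      using linear_mapsD(3)[OF lin_eps[OF lin_m_left[OF linear_id x]]]
      by (intro cong) (auto simp: x \<phi>_closed R.m_comm)
    also have "\<dots> = \<epsilon> (psum H (\<lambda>a b. \<phi> b \<odot>\<^bsub>H\<^esub> a) (d u) \<star> x)"
      using linear_maps_psum[OF H regular lin_eps[OF lin_m_left[OF linear_id x]] R_closed, of "\<lambda>a b. \<phi> b \<odot>\<^bsub>H\<^esub> a"]
      by (simp add: \<phi>_closed)
    finally show "\<phi> (t x) = \<epsilon> (psum H (\<lambda>a b. \<phi> b \<odot>\<^bsub>H\<^esub> a) (d u) \<star> x)" .
  qed
qed

context
  assumes rm_or_rc: "rm \<or> rc"
begin

lemma e_idem: "h \<in> carrier H \<Longrightarrow> e (e h) = e h"
  using rm_e_idem rc_e_idem rm_or_rc by blast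

lemma t_idem: "h \<in> carrier H \<Longrightarrow> t (t h) = t h"
  using rm_t_idem rc_t_idem rm_or_rc by blast

theorem coalgebra_C: "sweedler_coalgebra k C \<Delta>C \<epsilon>"
  using rm_coalgebra rc_coalgebra rm_or_rc by blast

text \<open>
  Under (rm) this is the axiom at \<open>t(h)\<close>. Under (rc) the formula for \<open>\<Delta>(t(h))\<close> leads to
  \<open>\<epsilon>(y1\<^sub>(\<^sub>2\<^sub>)) \<epsilon>(1\<^sub>(\<^sub>1\<^sub>)t(h)b) = \<epsilon>(e(y)t(h)b)\<close>, and \<open>e(y) = y\<close>.
\<close>

lemma conv_t:
  assumes y: "y \<in> carrier H" "e y = y" and b: "b \<in> carrier H" and h: "h \<in> carrier H"
  shows "conv (g' y) (g b) (t h) = \<epsilon> (y \<star> t h \<star> b)"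
proof -
  have "conv (g' y) (g b) (t h) = psum k (\<lambda>h1 h2. \<epsilon> (y \<star> h2) \<otimes>\<^bsub>k\<^esub> \<epsilon> (h1 \<star> b)) (d (t h))"
    unfolding conv_def using h by (auto intro!: cong simp: g_def g'_def)
  also have "\<dots> = \<epsilon> (y \<star> t h \<star> b)"
    using rm_or_rc
  proof
    assume rm
    then show ?thesis using y b h by (simp add: rm_def)
  next
    assume rc
    have "psum (regular_module k) (\<lambda>h1 h2. \<epsilon> (y \<star> h2) \<otimes>\<^bsub>k\<^esub> \<epsilon> (h1 \<star> b)) (d (t h)) =
      psum (regular_module k) (\<lambda>h1 h2. \<epsilon> (y \<star> h2) \<otimes>\<^bsub>k\<^esub> \<epsilon> (h1 \<star> t h \<star> b)) (d u)"
      by (rule rc_d_t[OF \<open>rc\<close> regular]) (auto intro!: lin simp: y b h)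
    also have "\<dots> = psum (regular_module k) (\<lambda>h1 h2. \<epsilon> (y \<star> h2) \<otimes>\<^bsub>k\<^esub> \<epsilon> (h1 \<star> (t h \<star> b))) (d u)"
      by (rule cong) (auto simp: y b h m_assoc)
    also have "\<dots> = \<epsilon> (e y \<star> (t h \<star> b))"
      using e_apply[OF regular lin_eps[OF lin_m_left[OF linear_id, of "t h \<star> b"]] y(1)] by (simp add: b h)
    finally show ?thesis by (simp add: psum_regular y b h m_assoc)
  qed
  finally show ?thesis .
qed

text \<open>
  The map \<open>g'\<close> sends the image of \<open>e\<close> onto the image of \<open>dual_e\<close>. Expanding all legs in terms of \<open>g' \<circ> e\<close>,
  \<open>conv_t\<close> shows that the given lists represent
  \<open>\<epsilon>(y1\<^sub>(\<^sub>2\<^sub>'\<^sub>)1\<^sub>(\<^sub>2\<^sub>)) g'(e(1\<^sub>(\<^sub>1\<^sub>))) \<otimes> g'(e(1\<^sub>(\<^sub>1\<^sub>'\<^sub>)))\<close> at \<open>g'(y)\<close>, while the comultiplication of the image of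
  \<open>e\<close> at \<open>y\<close> is the same expression with the two legs exchanged. Therefore the flipped
  coalgebra is transported. The parameters \<open>\<Delta>0\<close> and \<open>\<epsilon>0\<close> leave the module structure of the dual
  unchanged; keeping them free allows the same dual module to serve for the reversed
  structures.
\<close>

theorem coalgebra_dual:
  fixes \<Delta>0 \<epsilon>0
  defines "D \<equiv> image_module (dual k H \<Delta>0 \<epsilon>0) dual_e"
  shows "sweedler_coalgebra k D
    (\<lambda>\<psi>. map (\<lambda>(a, b). (dual_e (g' a), dual_e (conv \<psi> (g b)))) (d u)) (\<lambda>\<psi>. \<psi> u)"
proof -
  let ?dual = "dual k H \<Delta>0 \<epsilon>0"
  have dual: "module k ?dual" by (rule module_dual[OF H])
  have D: "module k D" unfolding D_def by (rule module_image[OF dual dual_e_linear])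
  have DD: "module k (tensor k D D)" by (rule module_tensor[OF D D])
  interpret flip: sweedler_coalgebra k C "\<lambda>c. map prod.swap (\<Delta>C c)" \<epsilon>
    by (rule sweedler_coalgebra.flip[OF coalgebra_C])
  have D_carrier: "carrier D = dual_e ` carrier ?dual" by (simp add: D_def)
  have D_ops: "ring.add D = ring.add ?dual" "smult D = smult ?dual" by (simp_all add: D_def)
  have g'_dual: "g' y \<in> carrier ?dual" if "y \<in> carrier H" for y by (rule linear_mapsD(1)[OF g'_linear that])
  have g'_e: "g' (e y) \<in> carrier D" if "y \<in> carrier H" for y
    unfolding D_carrier dual_e_g'[OF that, symmetric] using g'_dual[OF that] by (rule imageI)
  have C_H: "c \<in> carrier H" "e c = c" if "c \<in> carrier C" for c using that by (auto simp: e_idem)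
  have q: "g' \<in> linear_maps k C D"
  proof (rule linear_mapsI)
    show "g' c \<in> carrier D" if "c \<in> carrier C" for c using g'_e[of c] C_H[OF that] by simp
  qed (use C_H linear_mapsD(2,3)[OF g'_linear] in \<open>simp_all only: D_ops image_module_simps\<close>)
  have qe: "(\<lambda>x. g' (e x)) \<in> linear_maps k H D"
    by (rule linear_maps_comp[OF linear_to_image[OF e_linear] q])
  have surj: "carrier D = g' ` carrier C"
  proof
    show "g' ` carrier C \<subseteq> carrier D" using linear_mapsD(1)[OF q] by blast
    show "carrier D \<subseteq> g' ` carrier C"
    proof
      fix \<psi> assume "\<psi> \<in> carrier D"
      then obtain \<phi> where \<phi>: "\<phi> \<in> carrier ?dual" "\<psi> = dual_e \<phi>" unfolding D_carrier by blast
      let ?y = "psum H (\<lambda>a b. \<phi> b \<odot>\<^bsub>H\<^esub> a) (d u)"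
      have y: "?y \<in> carrier H"
        using \<phi>(1) linear_mapsD(1)[of \<phi> k H "regular_module k"] by (intro closed[OF H]) auto
      have "dual_e (dual_e \<phi>) = dual_e \<phi>"
        by (auto simp: dual_e_def compose_def t_idem intro!: restrict_ext)
      then have "\<psi> = g' (e ?y)"
        unfolding \<phi>(2) dual_e_g'[OF y, symmetric] dual_e_eq_g'[OF \<phi>(1), symmetric] ..
      then show "\<psi> \<in> g' ` carrier C" using y by auto
    qed
  qed
  show ?thesis
  proof (rule transport_coalgebra[OF flip.sweedler_coalgebra_axioms D q surj])
    fix \<psi> assume "\<psi> \<in> carrier D"
    then have \<psi>: "\<psi> \<in> carrier ?dual" unfolding D_carrier using linear_mapsD(1)[OF dual_e_linear] by blast
    have "dual_e (g' a) \<in> carrier D \<and> dual_e (conv \<psi> (g b)) \<in> carrier D" if "(a, b) \<in> set (d u)" for a b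
      using that R_closed D_carrier g'_dual conv_closed[OF \<psi> g_closed] by blast
    then show "set (map (\<lambda>(a, b). (dual_e (g' a), dual_e (conv \<psi> (g b)))) (d u)) \<subseteq> carrier D \<times> carrier D"
      by auto
  next
    have "(\<lambda>\<psi>. \<psi> u) \<in> linear_maps k ?dual (regular_module k)"
      using linear_mapsD(1)[of _ k H "regular_module k"] by (intro linear_mapsI) auto
    then show "(\<lambda>\<psi>. \<psi> u) \<in> linear_maps k D (regular_module k)"
      unfolding D_def by (rule linear_from_image[OF dual_e_linear])
    show "g' c u = \<epsilon> c" if "c \<in> carrier C" for c using C_H(1)[OF that] by (simp add: g'_def)
  next
    fix y assume "y \<in> carrier C"
    note y = C_H[OF this]
    (* s b represents the functional h |-> eps(y t(h) b) through g'. *)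
    define s where "s b = psum H (\<lambda>x y'. \<epsilon> (y \<star> y' \<star> b) \<odot>\<^bsub>H\<^esub> x) (d u)" for b
    have s_closed: "s b \<in> carrier H" if "b \<in> carrier H" for b
      unfolding s_def by (rule closed[OF H]) (auto simp: y that)
    have "dual_e (conv (g' y) (g b)) = g' (s b)" if b: "b \<in> carrier H" for b
      unfolding dual_e_def compose_def g'_def[of "s b"]
    proof (rule restrict_ext)
      fix h assume h: "h \<in> carrier H"
      have "conv (g' y) (g b) (t h) = \<epsilon> (y \<star> t h \<star> b)" by (rule conv_t[OF y b h])
      also have "\<dots> = psum (regular_module k) (\<lambda>x y'. \<epsilon> (x \<star> h) \<otimes>\<^bsub>k\<^esub> \<epsilon> (y \<star> y' \<star> b)) (d u)"
        using t_apply[OF regular lin_eps[OF lin_m_left[OF lin_m_right[OF linear_id y(1)] b]] h] by simp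
      also have "\<dots> = psum (regular_module k) (\<lambda>x y'. \<epsilon> ((\<epsilon> (y \<star> y' \<star> b) \<odot>\<^bsub>H\<^esub> x) \<star> h)) (d u)"
        using linear_mapsD(3)[OF lin_eps[OF lin_m_left[OF linear_id h]]]
        by (intro cong) (auto simp: y b h R.m_comm)
      also have "\<dots> = \<epsilon> (s b \<star> h)"
        using linear_maps_psum[OF H regular lin_eps[OF lin_m_left[OF linear_id h]] R_closed, of "\<lambda>x y'. \<epsilon> (y \<star> y' \<star> b) \<odot>\<^bsub>H\<^esub> x"]
        by (simp add: s_def y b)
      finally show "conv (g' y) (g b) (t h) = \<epsilon> (s b \<star> h)" .
    qed
    moreover have "dual_e (dual_e \<phi>) = dual_e \<phi>" for \<phi>
      by (auto simp: dual_e_def compose_def t_idem intro!: restrict_ext)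
    ultimately have conv: "dual_e (conv (g' y) (g b)) = g' (e (s b))" if "b \<in> carrier H" for b
      using dual_e_g'[OF s_closed[OF that]] that by metis
    let ?pt = "pure_tensor k D D"
    have pt_closed: "?pt (g' (e a)) (g' (e b)) \<in> carrier (tensor k D D)" if "a \<in> carrier H" "b \<in> carrier H" for a b
      using that by (intro pure_tensor_closed[OF D D] g'_e)
    have "psum (tensor k D D) ?pt (map (\<lambda>(a, b). (dual_e (g' a), dual_e (conv (g' y) (g b)))) (d u)) =
      psum (tensor k D D) (\<lambda>a b. ?pt (g' (e a)) (g' (e (s b)))) (d u)"
      unfolding psum_map by (rule cong) (simp_all add: conv dual_e_g')
    also have "\<dots> = psum (tensor k D D) (\<lambda>a b. psum (tensor k D D) (\<lambda>x y'.
        \<epsilon> (y \<star> y' \<star> b) \<odot>\<^bsub>tensor k D D\<^esub> ?pt (g' (e a)) (g' (e x))) (d u)) (d u)"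
    proof (rule cong, simp)
      fix a b assume ab: "a \<in> carrier H" "b \<in> carrier H"
      have L: "(\<lambda>z. ?pt (g' (e a)) (g' (e z))) \<in> linear_maps k H (tensor k D D)"
        by (rule linear_pure_right[OF D D g'_e[OF ab(1)] qe])
      show "?pt (g' (e a)) (g' (e (s b))) = psum (tensor k D D) (\<lambda>x y'.
        \<epsilon> (y \<star> y' \<star> b) \<odot>\<^bsub>tensor k D D\<^esub> ?pt (g' (e a)) (g' (e x))) (d u)"
        unfolding s_def
        by (subst linear_maps_psum[OF H DD L R_closed]) (auto simp: y ab linear_mapsD(3)[OF L] intro!: cong)
    qed
    also have "\<dots> = psum (tensor k D D) (\<lambda>x y'. psum (tensor k D D) (\<lambda>a b.
        \<epsilon> (y \<star> y' \<star> b) \<odot>\<^bsub>tensor k D D\<^esub> ?pt (g' (e a)) (g' (e x))) (d u)) (d u)"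
      by (rule commute[OF DD]) (auto intro!: module.smult_closed[OF DD] pt_closed simp: y)
    also have "\<dots> = psum (tensor k D D) (\<lambda>a b. ?pt (g' (e (y \<star> b))) (g' (e a))) (d u)"
    proof (rule cong, simp)
      fix x y' assume xy: "x \<in> carrier H" "y' \<in> carrier H"
      show "psum (tensor k D D) (\<lambda>a b. \<epsilon> (y \<star> y' \<star> b) \<odot>\<^bsub>tensor k D D\<^esub> ?pt (g' (e a)) (g' (e x))) (d u) =
        ?pt (g' (e (y \<star> y'))) (g' (e x))"
        by (rule idem_apply[OF e_idem DD, symmetric, where f = "\<lambda>c. ?pt (g' c) (g' (e x))"])
           (auto intro!: linear_pure_left[OF D D] g'_e qe simp: xy y)
    qed
    also have "\<dots> = psum (tensor k D D) (\<lambda>a b. ?pt (g' a) (g' b)) (map prod.swap (\<Delta>C y))"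
      unfolding psum_swap_pairs psum_map ..
    finally show "psum (tensor k D D) ?pt (map (\<lambda>(a, b). (dual_e (g' a), dual_e (conv (g' y) (g b)))) (d u)) =
      psum (tensor k D D) (\<lambda>a b. ?pt (g' a) (g' b)) (map prod.swap (\<Delta>C y))" .
  qed
qed

end

section \<open>Opposite multiplication and opposite comultiplication\<close>

definition lm :: bool where
  "lm \<longleftrightarrow> (\<forall>h\<in>carrier H. \<forall>x\<in>carrier H. \<forall>l\<in>carrier H.
     \<epsilon> (h \<star> x \<star> l) = psum k (\<lambda>a b. \<epsilon> (h \<star> a) \<otimes>\<^bsub>k\<^esub> \<epsilon> (b \<star> l)) (d x))"

definition lc :: bool where
  "lc \<longleftrightarrow>
     psum (tensor k H (tensor k H H)) (\<lambda>a b. psum (tensor k H (tensor k H H))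
        (\<lambda>a1 a2. pure_tensor k H (tensor k H H) a1 (pure_tensor k H H a2 b)) (d a)) (d u) =
     psum (tensor k H (tensor k H H)) (\<lambda>a b. psum (tensor k H (tensor k H H))
        (\<lambda>a' b'. pure_tensor k H (tensor k H H) a (pure_tensor k H H (b \<star> a') b')) (d u)) (d u)"

lemma opposite: "sweedler_prebialgebra k H d \<epsilon> (\<lambda>x y. y \<star> x) u"
proof (unfold_locales)
  show "(\<lambda>x y. y \<star> x) \<in> bilinear_maps k H H H" by (intro lin) auto
  fix x y assume xy: "x \<in> carrier H" "y \<in> carrier H"
  have HH: "module k (tensor k H H)" by (rule module_tensor[OF H H])
  show "psum (tensor k H H) (pure_tensor k H H) (d (y \<star> x)) =
    psum (tensor k H H) (\<lambda>a b. psum (tensor k H H) (\<lambda>a' b'. pure_tensor k H H (a' \<star> a) (b' \<star> b)) (d y)) (d x)"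
    unfolding d_mult[OF xy(2,1)] by (rule commute[OF HH xy(2,1)]) (simp add: pure_tensor_closed[OF H H])
qed (simp_all add: m_assoc)

lemma coopposite: "sweedler_prebialgebra k H (\<lambda>h. map prod.swap (d h)) \<epsilon> (\<star>) u"
proof (intro sweedler_prebialgebra.intro flip sweedler_prebialgebra_axioms.intro)
  fix x y assume xy: "x \<in> carrier H" "y \<in> carrier H"
  have HH: "module k (tensor k H H)" by (rule module_tensor[OF H H])
  show "psum (tensor k H H) (pure_tensor k H H) (map prod.swap (d (x \<star> y))) =
    psum (tensor k H H) (\<lambda>a b. psum (tensor k H H) (\<lambda>a' b'. pure_tensor k H H (a \<star> a') (b \<star> b'))
      (map prod.swap (d y))) (map prod.swap (d x))"
    unfolding psum_swap_pairs
    by (rule mult_sum[OF HH _ xy]) (intro bilinear_mapsI linear_pure_left[OF H H] linear_pure_right[OF H H] linear_id)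
qed (simp_all add: m_bilinear m_assoc)

lemma opposite_rm: "lm \<Longrightarrow> sweedler_prebialgebra.rm k H d \<epsilon> (\<lambda>x y. y \<star> x)"
proof -
  interpret op: sweedler_prebialgebra k H d \<epsilon> "\<lambda>x y. y \<star> x" u by (rule opposite)
  assume lm
  have "\<epsilon> (l \<star> (x \<star> h)) = psum k (\<lambda>a b. \<epsilon> (b \<star> h) \<otimes>\<^bsub>k\<^esub> \<epsilon> (l \<star> a)) (d x)"
    if "h \<in> carrier H" "x \<in> carrier H" "l \<in> carrier H" for h x l
  proof -
    have "\<epsilon> (l \<star> (x \<star> h)) = psum k (\<lambda>a b. \<epsilon> (l \<star> a) \<otimes>\<^bsub>k\<^esub> \<epsilon> (b \<star> h)) (d x)"
      using \<open>lm\<close> that by (simp add: lm_def m_assoc)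
    also have "\<dots> = psum k (\<lambda>a b. \<epsilon> (b \<star> h) \<otimes>\<^bsub>k\<^esub> \<epsilon> (l \<star> a)) (d x)"
      by (rule cong) (simp_all add: that R.m_comm)
    finally show ?thesis .
  qed
  then show op.rm by (simp add: op.rm_def)
qed

lemma opposite_rc: "lc \<Longrightarrow> sweedler_prebialgebra.rc k H d (\<lambda>x y. y \<star> x) u"
proof -
  interpret op: sweedler_prebialgebra k H d \<epsilon> "\<lambda>x y. y \<star> x" u by (rule opposite)
  assume lc then show op.rc by (simp add: op.rc_def lc_def)
qed

lemma coopposite_rm: "lm \<Longrightarrow> sweedler_prebialgebra.rm k H (\<lambda>h. map prod.swap (d h)) \<epsilon> (\<star>)"
proof -
  interpret cop: sweedler_prebialgebra k H "\<lambda>h. map prod.swap (d h)" \<epsilon> "(\<star>)" u by (rule coopposite)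
  assume lm then show cop.rm by (simp add: cop.rm_def lm_def psum_swap_pairs)
qed

lemma coopposite_lm: "rm \<Longrightarrow> sweedler_prebialgebra.lm k H (\<lambda>h. map prod.swap (d h)) \<epsilon> (\<star>)"
proof -
  interpret cop: sweedler_prebialgebra k H "\<lambda>h. map prod.swap (d h)" \<epsilon> "(\<star>)" u by (rule coopposite)
  assume rm then show cop.lm by (simp add: cop.lm_def rm_def psum_swap_pairs)
qed

text \<open>
  Reversing \<open>\<Delta>\<close> reads the three legs of \<open>\<Delta>\<^sup>2(1)\<close> in the opposite order, up to coassociativity;
  (lc) and (rc) are exchanged for that reason.
\<close>

lemma coassoc_reversed:
  defines "T \<equiv> tensor k H (tensor k H H)"
  shows "psum T (\<lambda>a b. psum T (\<lambda>a1 a2. pure_tensor k H (tensor k H H) a1 (pure_tensor k H H a2 b))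
      (map prod.swap (d a))) (map prod.swap (d u)) =
    psum T (\<lambda>a b. psum T (\<lambda>a1 a2. pure_tensor k H (tensor k H H) b (pure_tensor k H H a2 a1)) (d a)) (d u)"
proof -
  have HH: "module k (tensor k H H)" by (rule module_tensor[OF H H])
  have T: "module k T" unfolding T_def by (rule module_tensor[OF H HH])
  show ?thesis
    unfolding psum_swap_pairs
    by (rule coassoc[OF T, symmetric])
       (auto intro!: trilinear_mapsI linear_pure_left linear_pure_right H HH linear_id pure_tensor_closed simp: T_def)
qed

lemma coopposite_rc: "lc \<Longrightarrow> sweedler_prebialgebra.rc k H (\<lambda>h. map prod.swap (d h)) (\<star>) u"
proof -
  interpret op: sweedler_prebialgebra k H d \<epsilon> "\<lambda>x y. y \<star> x" u by (rule opposite)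
  interpret cop: sweedler_prebialgebra k H "\<lambda>h. map prod.swap (d h)" \<epsilon> "(\<star>)" u by (rule coopposite)
  let ?HH = "tensor k H H" let ?T = "tensor k H ?HH"
  have HH: "module k ?HH" by (rule module_tensor[OF H H])
  have T: "module k ?T" by (rule module_tensor[OF H HH])
  assume lc
  then have rc: op.rc by (rule opposite_rc)
  have "psum ?T (\<lambda>a b. psum ?T (\<lambda>a1 a2. pure_tensor k H ?HH b (pure_tensor k H H a2 a1)) (d a)) (d u) =
    psum ?T (\<lambda>a b. psum ?T (\<lambda>a' b'. pure_tensor k H ?HH b' (pure_tensor k H H (b \<star> a') a)) (d u)) (d u)"
    by (rule op.rc_transfer[OF rc T])
       (auto intro!: trilinear_mapsI linear_pure_left linear_pure_right H HH linear_id pure_tensor_closed)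
  also have "\<dots> = psum ?T (\<lambda>a b. psum ?T (\<lambda>a' b'. pure_tensor k H ?HH b (pure_tensor k H H (b' \<star> a) a')) (d u)) (d u)"
    by (rule commute[OF T]) (auto intro!: pure_tensor_closed H HH)
  finally show cop.rc
    unfolding cop.rc_def coassoc_reversed by (simp add: psum_swap_pairs)
qed

lemma coopposite_lc: "rc \<Longrightarrow> sweedler_prebialgebra.lc k H (\<lambda>h. map prod.swap (d h)) (\<star>) u"
proof -
  interpret cop: sweedler_prebialgebra k H "\<lambda>h. map prod.swap (d h)" \<epsilon> "(\<star>)" u by (rule coopposite)
  let ?HH = "tensor k H H" let ?T = "tensor k H ?HH"
  have HH: "module k ?HH" by (rule module_tensor[OF H H])
  have T: "module k ?T" by (rule module_tensor[OF H HH])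
  assume rc
  have "psum ?T (\<lambda>a b. psum ?T (\<lambda>a1 a2. pure_tensor k H ?HH b (pure_tensor k H H a2 a1)) (d a)) (d u) =
    psum ?T (\<lambda>a b. psum ?T (\<lambda>a' b'. pure_tensor k H ?HH b' (pure_tensor k H H (a' \<star> b) a)) (d u)) (d u)"
    by (rule rc_transfer[OF \<open>rc\<close> T])
       (auto intro!: trilinear_mapsI linear_pure_left linear_pure_right H HH linear_id pure_tensor_closed)
  also have "\<dots> = psum ?T (\<lambda>a b. psum ?T (\<lambda>a' b'. pure_tensor k H ?HH b (pure_tensor k H H (a \<star> b') a')) (d u)) (d u)"
    by (rule commute[OF T]) (auto intro!: pure_tensor_closed H HH)
  finally show cop.lc
    unfolding cop.lc_def coassoc_reversed by (simp add: psum_swap_pairs)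
qed

lemma conv_linear:
  assumes \<phi>: "\<phi> \<in> carrier (dual k H \<Delta>0 \<epsilon>0)"
  shows "conv \<phi> \<in> linear_maps k (dual k H \<Delta>0 \<epsilon>0) (dual k H \<Delta>0 \<epsilon>0)"
proof (rule linear_mapsI)
  let ?D = "dual k H \<Delta>0 \<epsilon>0"
  have val: "\<psi> x \<in> carrier k" if "\<psi> \<in> carrier ?D" "x \<in> carrier H" for \<psi> x
    using linear_mapsD(1)[of \<psi> k H "regular_module k"] that by auto
  fix \<psi> assume \<psi>: "\<psi> \<in> carrier ?D"
  show "conv \<phi> \<psi> \<in> carrier ?D" by (rule conv_closed[OF \<phi> \<psi>])
  show "conv \<phi> (\<psi> \<oplus>\<^bsub>?D\<^esub> \<chi>) = conv \<phi> \<psi> \<oplus>\<^bsub>?D\<^esub> conv \<phi> \<chi>" if \<chi>: "\<chi> \<in> carrier ?D" for \<chi>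
  proof -
    have "psum k (\<lambda>a b. \<phi> b \<otimes>\<^bsub>k\<^esub> (\<psi> \<oplus>\<^bsub>?D\<^esub> \<chi>) a) (d h) =
      psum k (\<lambda>a b. \<phi> b \<otimes>\<^bsub>k\<^esub> \<psi> a) (d h) \<oplus>\<^bsub>k\<^esub> psum k (\<lambda>a b. \<phi> b \<otimes>\<^bsub>k\<^esub> \<chi> a) (d h)" if h: "h \<in> carrier H" for h
      by (subst R.psum_add[OF d_closed[OF h], symmetric])
         (auto intro!: cong h simp: val[OF \<phi>] val[OF \<psi>] val[OF \<chi>] R.r_distr)
    then show ?thesis by (auto simp: conv_def intro!: restrict_ext)
  qed
  show "conv \<phi> (r \<odot>\<^bsub>?D\<^esub> \<psi>) = r \<odot>\<^bsub>?D\<^esub> conv \<phi> \<psi>" if r: "r \<in> carrier k" for r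
  proof -
    have "psum k (\<lambda>a b. \<phi> b \<otimes>\<^bsub>k\<^esub> (r \<odot>\<^bsub>?D\<^esub> \<psi>) a) (d h) = r \<otimes>\<^bsub>k\<^esub> psum k (\<lambda>a b. \<phi> b \<otimes>\<^bsub>k\<^esub> \<psi> a) (d h)"
      if h: "h \<in> carrier H" for h
    proof -
      have "psum k (\<lambda>a b. \<phi> b \<otimes>\<^bsub>k\<^esub> (r \<odot>\<^bsub>?D\<^esub> \<psi>) a) (d h) =
        psum (regular_module k) (\<lambda>a b. r \<odot>\<^bsub>regular_module k\<^esub> (\<phi> b \<otimes>\<^bsub>k\<^esub> \<psi> a)) (d h)"
        unfolding psum_regular by (intro cong h) (auto simp: val[OF \<phi>] val[OF \<psi>] r R.m_lcomm)
      then show ?thesis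
        by (subst (asm) smult_sum[OF regular h]) (auto simp: psum_regular val[OF \<phi>] val[OF \<psi>] r)
    qed
    then show ?thesis by (auto simp: conv_def intro!: restrict_ext)
  qed
qed

lemma g_linear: "g \<in> linear_maps k H (dual k H \<Delta>0 \<epsilon>0)"
proof -
  interpret op: sweedler_prebialgebra k H d \<epsilon> "\<lambda>x y. y \<star> x" u by (rule opposite)
  have "op.g' = g" by (rule ext) (simp add: op.g'_def g_def)
  then show ?thesis using op.g'_linear by metis
qed

lemma dual_lin:
  shows "(\<lambda>a. dual_e (g' a)) \<in> linear_maps k H (image_module (dual k H \<Delta>0 \<epsilon>0) dual_e)"
    and "\<psi> \<in> carrier (dual k H \<Delta>0 \<epsilon>0) \<Longrightarrow>
      (\<lambda>b. dual_e (conv \<psi> (g b))) \<in> linear_maps k H (image_module (dual k H \<Delta>0 \<epsilon>0) dual_e)"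
  by (rule linear_maps_comp[OF g'_linear linear_to_image[OF dual_e_linear]],
      rule linear_maps_comp[OF linear_maps_comp[OF g_linear conv_linear] linear_to_image[OF dual_e_linear]])

lemma dual_e_carrier:
  "\<psi> \<in> carrier (image_module (dual k H \<Delta>0 \<epsilon>0) dual_e) \<Longrightarrow> \<psi> \<in> carrier (dual k H \<Delta>0 \<epsilon>0)"
  using linear_mapsD(1)[OF dual_e_linear] by auto

end

section \<open>The eight coalgebras\<close>

locale represented_prebialgebra = prebialgebra k H \<Delta> \<epsilon> + S: sweedler_coalgebra k H d \<epsilon>
  for k :: "'k ring" and H :: "('k, 'h) module" and \<Delta> \<epsilon> d +
  assumes \<Delta>_d: "c \<in> carrier H \<Longrightarrow> \<Delta> c = psum (tensor k H H) (pure_tensor k H H) (d c)"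
begin

lemma mult_bilinear: "monoid.mult H \<in> bilinear_maps k H H H"
  by (intro bilinear_mapsI linear_mapsI) (auto simp: smult_mult_left smult_mult_right l_distr r_distr)

lemma lin_mult:
  "f \<in> linear_maps k M H \<Longrightarrow> c \<in> carrier H \<Longrightarrow> (\<lambda>x. f x \<otimes>\<^bsub>H\<^esub> c) \<in> linear_maps k M H"
  "f \<in> linear_maps k M H \<Longrightarrow> c \<in> carrier H \<Longrightarrow> (\<lambda>x. c \<otimes>\<^bsub>H\<^esub> f x) \<in> linear_maps k M H"
  by (erule linear_maps_comp, erule bilinear_mapsD(2)[OF mult_bilinear],
      erule linear_maps_comp, erule bilinear_mapsD(1)[OF mult_bilinear])

lemma sweedler_prebialgebra: "sweedler_prebialgebra k H d \<epsilon> (monoid.mult H) \<one>\<^bsub>H\<^esub>"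
proof
  fix x y assume xy: "x \<in> carrier H" "y \<in> carrier H"
  let ?T = "tensor k H H" and ?pt = "pure_tensor k H H"
  have "\<Delta> (x \<otimes>\<^bsub>H\<^esub> y) = psum ?T ?pt (d x) \<otimes>\<^bsub>?T\<^esub> psum ?T ?pt (d y)"
    using comult_mult[OF xy] by (simp add: \<Delta>_d xy)
  also have "\<dots> = psum ?T (\<lambda>a b. psum ?T (\<lambda>a' b'. ?pt (a \<otimes>\<^bsub>H\<^esub> a') (b \<otimes>\<^bsub>H\<^esub> b')) (d y)) (d x)"
    by (rule two_modules.T_mult[OF two_modulesI[OF module_axioms module_axioms] _ _ _ _ S.d_closed[OF xy(1)] S.d_closed[OF xy(2)]])
       (auto intro!: bilinear_mapsI linear_pure_left linear_pure_right module_axioms lin_mult linear_id)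
  finally show "psum ?T ?pt (d (x \<otimes>\<^bsub>H\<^esub> y)) =
    psum ?T (\<lambda>a b. psum ?T (\<lambda>a' b'. ?pt (a \<otimes>\<^bsub>H\<^esub> a') (b \<otimes>\<^bsub>H\<^esub> b')) (d y)) (d x)"
    by (simp add: \<Delta>_d xy)
qed (simp_all add: mult_bilinear m_assoc)

sublocale P: sweedler_prebialgebra k H d \<epsilon> "monoid.mult H" "\<one>\<^bsub>H\<^esub>"
  by (rule sweedler_prebialgebra)

text \<open>
This translates an expression in Sweedler notation into a sum over the chosen lists.
\<close>

lemma lift_\<Delta>:
  assumes "module k P" "f \<in> bilinear_maps k H H P" "x \<in> carrier H"
    and "\<And>a b. a \<in> carrier H \<Longrightarrow> b \<in> carrier H \<Longrightarrow> g a b = f a b"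
  shows "tensor_lift P g (\<Delta> x) = psum P f (d x)"
  unfolding \<Delta>_d[OF assms(3)]
  by (rule tensor_lift_cong[OF module_axioms module_axioms assms(1,2) S.d_closed[OF assms(3)] assms(4)])

lemma lift_\<Delta>_scalar:
  assumes "f \<in> bilinear_maps k H H (regular_module k)" "x \<in> carrier H"
    and "\<And>a b. a \<in> carrier H \<Longrightarrow> b \<in> carrier H \<Longrightarrow> g a b = f a b"
  shows "tensor_lift k g (\<Delta> x) = psum k f (d x)"
  using lift_\<Delta>[OF P.regular assms] by (simp add: psum_regular tensor_lift_regular)

lemma axiom_rm: "axiom_rm k H \<Delta> \<epsilon> \<Longrightarrow> P.rm"
  unfolding axiom_rm_def P.rm_def
  by (auto intro!: lift_\<Delta>_scalar P.lin simp: linear_mapsD)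

lemma axiom_lm: "axiom_lm k H \<Delta> \<epsilon> \<Longrightarrow> P.lm"
  unfolding axiom_lm_def P.lm_def
  by (auto intro!: lift_\<Delta>_scalar P.lin simp: linear_mapsD)

text \<open>
  The axioms (lc) and (rc) are equations in \<open>(H \<otimes> H) \<otimes> H\<close>; the associativity isomorphism carries
  them to the list form in \<open>H \<otimes> (H \<otimes> H)\<close>. The parameter \<open>w\<close> is the multiplication or its opposite.
\<close>

lemma comonoidality_in_lists:
  assumes w: "w \<in> bilinear_maps k H H H"
    and eq: "tensor_map k (tensor k H H) H \<Delta> (\<lambda>x. x) (\<Delta> \<one>\<^bsub>H\<^esub>) =
     tensor_lift (tensor k (tensor k H H) H) (\<lambda>a b.
       tensor_lift (tensor k (tensor k H H) H) (\<lambda>a' b'.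
         pure_tensor k (tensor k H H) H (pure_tensor k H H a (w b a')) b')
       (\<Delta> \<one>\<^bsub>H\<^esub>)) (\<Delta> \<one>\<^bsub>H\<^esub>)"
  shows "psum (tensor k H (tensor k H H)) (\<lambda>a b. psum (tensor k H (tensor k H H))
        (\<lambda>a1 a2. pure_tensor k H (tensor k H H) a1 (pure_tensor k H H a2 b)) (d a)) (d \<one>\<^bsub>H\<^esub>) =
     psum (tensor k H (tensor k H H)) (\<lambda>a b. psum (tensor k H (tensor k H H))
        (\<lambda>a' b'. pure_tensor k H (tensor k H H) a (pure_tensor k H H (w b a') b')) (d \<one>\<^bsub>H\<^esub>)) (d \<one>\<^bsub>H\<^esub>)"
    (is "?l = ?r")
proof -
  let ?HH = "tensor k H H" let ?S = "tensor k ?HH H" let ?T = "tensor k H ?HH"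
  note H = module_axioms
  have HH: "module k ?HH" by (rule module_tensor[OF H H])
  have S: "module k ?S" by (rule module_tensor[OF HH H])
  have T: "module k ?T" by (rule module_tensor[OF H HH])
  note assoc = tensor_assoc_linear[OF H H H]
  note w' = bilinear_mapsD[OF w]
  let ?q = "\<lambda>a b a' b'. pure_tensor k ?HH H (pure_tensor k H H a (w b a')) b'"
  note lin = bilinear_mapsI linear_pure_left[OF HH H] linear_pure_right[OF HH H] linear_pure_left[OF H H] linear_pure_right[OF H H]
    linear_id w' pure_tensor_closed[OF H H] linear_psum[OF S S.d_closed]
  have cl: "?q a b a' b' \<in> carrier ?S" if "a \<in> carrier H" "b \<in> carrier H" "a' \<in> carrier H" "b' \<in> carrier H" for a b a' b'
    using that by (intro pure_tensor_closed HH H w')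
  have "tensor_lift ?S (\<lambda>a b. tensor_lift ?S (?q a b) (\<Delta> \<one>\<^bsub>H\<^esub>)) (\<Delta> \<one>\<^bsub>H\<^esub>) =
    psum ?S (\<lambda>a b. psum ?S (?q a b) (d \<one>\<^bsub>H\<^esub>)) (d \<one>\<^bsub>H\<^esub>)"
  proof (rule lift_\<Delta>[OF S])
    show "tensor_lift ?S (?q a b) (\<Delta> \<one>\<^bsub>H\<^esub>) = psum ?S (?q a b) (d \<one>\<^bsub>H\<^esub>)" if "a \<in> carrier H" "b \<in> carrier H" for a b
      by (rule lift_\<Delta>[OF S]) (auto intro!: lin simp: that)
  qed (auto intro!: lin)
  then have "tensor_assoc k H H H (tensor_lift ?S (\<lambda>a b. tensor_lift ?S (?q a b) (\<Delta> \<one>\<^bsub>H\<^esub>)) (\<Delta> \<one>\<^bsub>H\<^esub>)) =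
    psum ?T (\<lambda>a b. tensor_assoc k H H H (psum ?S (?q a b) (d \<one>\<^bsub>H\<^esub>))) (d \<one>\<^bsub>H\<^esub>)"
    by (simp only:) (rule linear_maps_psum[OF S T assoc(1) S.d_closed], auto intro!: P.closed[OF S] cl)
  also have "\<dots> = psum ?T (\<lambda>a b. psum ?T (\<lambda>a' b'. tensor_assoc k H H H (?q a b a' b')) (d \<one>\<^bsub>H\<^esub>)) (d \<one>\<^bsub>H\<^esub>)"
    by (rule P.cong, simp, rule linear_maps_psum[OF S T assoc(1) S.d_closed], auto intro!: cl)
  also have "\<dots> = ?r"
    by (intro P.cong) (auto simp: assoc(2) w')
  finally have "tensor_assoc k H H H (tensor_map k ?HH H \<Delta> (\<lambda>x. x) (\<Delta> \<one>\<^bsub>H\<^esub>)) = ?r"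
    unfolding eq .
  moreover have "tensor_assoc k H H H (tensor_map k ?HH H \<Delta> (\<lambda>x. x) (\<Delta> \<one>\<^bsub>H\<^esub>)) = ?l"
    by (rule coassoc_in_lists[where d = d and \<Delta> = \<Delta>, OF H S.d_closed \<Delta>_d comult_linear]) simp_all
  ultimately show ?thesis by simp
qed

lemma axiom_rc: "axiom_rc k H \<Delta> \<Longrightarrow> P.rc"
  unfolding axiom_rc_def P.rc_def
  by (rule comonoidality_in_lists) (auto intro!: P.lin)

lemma axiom_lc: "axiom_lc k H \<Delta> \<Longrightarrow> P.lc"
  unfolding axiom_lc_def P.lc_def
  by (rule comonoidality_in_lists) (auto intro!: P.lin)

sublocale op: sweedler_prebialgebra k H d \<epsilon> "\<lambda>x y. y \<otimes>\<^bsub>H\<^esub> x" "\<one>\<^bsub>H\<^esub>"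
  by (rule P.opposite)

sublocale cop: sweedler_prebialgebra k H "\<lambda>h. map prod.swap (d h)" \<epsilon> "monoid.mult H" "\<one>\<^bsub>H\<^esub>"
  by (rule P.coopposite)

sublocale opcop: sweedler_prebialgebra k H "\<lambda>h. map prod.swap (d h)" \<epsilon> "\<lambda>x y. y \<otimes>\<^bsub>H\<^esub> x" "\<one>\<^bsub>H\<^esub>"
  by (rule cop.opposite)

lemma right_axioms:
  assumes "axiom_rm k H \<Delta> \<epsilon> \<or> axiom_rc k H \<Delta>"
  shows "P.rm \<or> P.rc" "opcop.rm \<or> opcop.rc"
proof -
  show P: "P.rm \<or> P.rc" using assms axiom_rm axiom_rc by blast
  then have "cop.lm \<or> cop.lc" using P.coopposite_lm P.coopposite_lc by blast
  then show "opcop.rm \<or> opcop.rc" using cop.opposite_rm cop.opposite_rc by blast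
qed

lemma left_axioms:
  assumes "axiom_lm k H \<Delta> \<epsilon> \<or> axiom_lc k H \<Delta>"
  shows "op.rm \<or> op.rc" "cop.rm \<or> cop.rc"
proof -
  have P: "P.lm \<or> P.lc" using assms axiom_lm axiom_lc by blast
  then show "op.rm \<or> op.rc" using P.opposite_rm P.opposite_rc by blast
  show "cop.rm \<or> cop.rc" using P P.coopposite_rm P.coopposite_rc by blast
qed

text \<open>
Reversing \<open>\<Delta>\<close> reverses the product of the dual.
\<close>

lemma dual_mult:
  assumes "\<phi> \<in> carrier (dual k H \<Delta> \<epsilon>)" "\<psi> \<in> carrier (dual k H \<Delta> \<epsilon>)"
  shows "\<phi> \<otimes>\<^bsub>dual k H \<Delta> \<epsilon>\<^esub> \<psi> = P.conv \<phi> \<psi>" "\<phi> \<otimes>\<^bsub>dual k H \<Delta> \<epsilon>\<^esub> \<psi> = cop.conv \<psi> \<phi>"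
proof -
  have lin: "\<phi> \<in> linear_maps k H (regular_module k)" "\<psi> \<in> linear_maps k H (regular_module k)" using assms by auto
  note val = linear_mapsD(1)[OF lin(1), simplified] linear_mapsD(1)[OF lin(2), simplified]
  have "tensor_lift k (\<lambda>h1 h2. \<phi> h2 \<otimes>\<^bsub>k\<^esub> \<psi> h1) (\<Delta> h) = psum k (\<lambda>h1 h2. \<phi> h2 \<otimes>\<^bsub>k\<^esub> \<psi> h1) (d h)"
    if "h \<in> carrier H" for h
    by (rule lift_\<Delta>_scalar[OF _ that])
       (auto intro!: bilinear_mapsI linear_smult[OF P.regular lin(1), simplified]
          linear_smult_const[OF P.regular _ lin(2), simplified] val)
  moreover have "psum k (\<lambda>h1 h2. \<phi> h2 \<otimes>\<^bsub>k\<^esub> \<psi> h1) (d h) = psum k (\<lambda>h1 h2. \<psi> h1 \<otimes>\<^bsub>k\<^esub> \<phi> h2) (d h)"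
    if "h \<in> carrier H" for h
    by (rule P.cong[OF that]) (simp add: val R.m_comm)
  ultimately show "\<phi> \<otimes>\<^bsub>dual k H \<Delta> \<epsilon>\<^esub> \<psi> = P.conv \<phi> \<psi>" "\<phi> \<otimes>\<^bsub>dual k H \<Delta> \<epsilon>\<^esub> \<psi> = cop.conv \<psi> \<phi>"
    by (auto simp: P.conv_def cop.conv_def psum_swap_pairs intro!: restrict_ext)
qed

text \<open>
Reversing the multiplication exchanges the roles of \<open>g\<close> and \<open>g'\<close>.
\<close>

lemma dual_g_eq:
  "dual_g H \<epsilon> = P.g" "dual_g H \<epsilon> = op.g'" "dual_g' H \<epsilon> = P.g'" "dual_g' H \<epsilon> = op.g"
  by (simp_all add: fun_eq_iff dual_g_def dual_g'_def P.g_def P.g'_def op.g_def op.g'_def)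

text \<open>
  Each of the following eight lemmas matches the defining formulas with those of one of the four
  prebialgebras, the passage to \<open>H\<^sub>t\<close> and to its barred version involving a flip: there the factor that
  carries the argument comes first.
\<close>

lemma coalgebra_H_s:
  assumes "P.rm \<or> P.rc"
  shows "coalgebra k (H_s H \<Delta> \<epsilon>) (Delta_s k H \<Delta> \<epsilon>) \<epsilon>"
proof -
  have e: "eps_s H \<Delta> \<epsilon> h = P.e h" if "h \<in> carrier H" for h
    unfolding eps_s_def P.e_def psum_swap_pairs
    by (rule lift_\<Delta>[OF module_axioms]) (auto intro!: P.lin simp: that)
  have C: "H_s H \<Delta> \<epsilon> = P.C"
    unfolding H_s_def by (rule image_module_cong[OF e])
  show ?thesis
    unfolding C
  proof (rule sweedler_imp_coalgebra[OF P.coalgebra_C[OF assms]])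
    fix y assume "y \<in> carrier P.C"
    then have y: "y \<in> carrier H" by auto
    show "Delta_s k H \<Delta> \<epsilon> y = psum P.CC P.ptC (P.\<Delta>C y)"
      unfolding Delta_s_def Let_def C psum_swap_pairs psum_map
      by (rule lift_\<Delta>[OF P.CC]) (auto intro!: P.lin simp: e y)
  qed
qed

lemma coalgebra_H_t:
  assumes "opcop.rm \<or> opcop.rc"
  shows "coalgebra k (H_t H \<Delta> \<epsilon>) (Delta_t k H \<Delta> \<epsilon>) \<epsilon>"
proof -
  have e: "eps_t H \<Delta> \<epsilon> h = opcop.e h" if "h \<in> carrier H" for h
    unfolding eps_t_def opcop.e_def psum_swap_pairs
    by (rule lift_\<Delta>[OF module_axioms]) (auto intro!: opcop.lin simp: that)
  have C: "H_t H \<Delta> \<epsilon> = opcop.C"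
    unfolding H_t_def by (rule image_module_cong[OF e])
  show ?thesis
    unfolding C
  proof (rule sweedler_imp_coalgebra[OF sweedler_coalgebra.flip[OF opcop.coalgebra_C[OF assms]]])
    fix y assume "y \<in> carrier opcop.C"
    then have y: "y \<in> carrier H" by auto
    show "Delta_t k H \<Delta> \<epsilon> y = psum opcop.CC opcop.ptC (map prod.swap (opcop.\<Delta>C y))"
      unfolding Delta_t_def Let_def C psum_swap_pairs psum_map
      by (rule lift_\<Delta>[OF opcop.CC]) (auto intro!: opcop.lin simp: e y)
  qed
qed

lemma coalgebra_bar_H_s:
  assumes "op.rm \<or> op.rc"
  shows "coalgebra k (bar_H_s H \<Delta> \<epsilon>) (bar_Delta_s k H \<Delta> \<epsilon>) \<epsilon>"
proof -
  have e: "bar_eps_s H \<Delta> \<epsilon> h = op.e h" if "h \<in> carrier H" for h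
    unfolding bar_eps_s_def op.e_def psum_swap_pairs
    by (rule lift_\<Delta>[OF module_axioms]) (auto intro!: op.lin simp: that)
  have C: "bar_H_s H \<Delta> \<epsilon> = op.C"
    unfolding bar_H_s_def by (rule image_module_cong[OF e])
  show ?thesis
    unfolding C
  proof (rule sweedler_imp_coalgebra[OF op.coalgebra_C[OF assms]])
    fix y assume "y \<in> carrier op.C"
    then have y: "y \<in> carrier H" by auto
    show "bar_Delta_s k H \<Delta> \<epsilon> y = psum op.CC op.ptC (op.\<Delta>C y)"
      unfolding bar_Delta_s_def Let_def C psum_swap_pairs psum_map
      by (rule lift_\<Delta>[OF op.CC]) (auto intro!: op.lin simp: e y)
  qed
qed

lemma coalgebra_bar_H_t:
  assumes "cop.rm \<or> cop.rc"
  shows "coalgebra k (bar_H_t H \<Delta> \<epsilon>) (bar_Delta_t k H \<Delta> \<epsilon>) \<epsilon>"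
proof -
  have e: "bar_eps_t H \<Delta> \<epsilon> h = cop.e h" if "h \<in> carrier H" for h
    unfolding bar_eps_t_def cop.e_def psum_swap_pairs
    by (rule lift_\<Delta>[OF module_axioms]) (auto intro!: cop.lin simp: that)
  have C: "bar_H_t H \<Delta> \<epsilon> = cop.C"
    unfolding bar_H_t_def by (rule image_module_cong[OF e])
  show ?thesis
    unfolding C
  proof (rule sweedler_imp_coalgebra[OF sweedler_coalgebra.flip[OF cop.coalgebra_C[OF assms]]])
    fix y assume "y \<in> carrier cop.C"
    then have y: "y \<in> carrier H" by auto
    show "bar_Delta_t k H \<Delta> \<epsilon> y = psum cop.CC cop.ptC (map prod.swap (cop.\<Delta>C y))"
      unfolding bar_Delta_t_def Let_def C psum_swap_pairs psum_map
      by (rule lift_\<Delta>[OF cop.CC]) (auto intro!: cop.lin simp: e y)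
  qed
qed

text \<open>
On the dual side evaluation at \<open>1\<close> is the counit, as \<open>g'(y)\<close> takes the value \<open>\<epsilon>(y)\<close> there.
\<close>

lemma coalgebra_dual_H_s:
  assumes "P.rm \<or> P.rc"
  shows "coalgebra k (dual_H_s k H \<Delta> \<epsilon>) (dual_Delta_s k H \<Delta> \<epsilon>) (\<lambda>\<psi>. \<psi> \<one>\<^bsub>H\<^esub>)"
proof -
  let ?D = "image_module (dual k H \<Delta> \<epsilon>) P.dual_e"
  have D: "module k ?D" by (rule module_image[OF module_dual[OF module_axioms] P.dual_e_linear])
  have DD: "module k (tensor k ?D ?D)" by (rule module_tensor[OF D D])
  have t: "eps_t H \<Delta> \<epsilon> h = P.t h" if "h \<in> carrier H" for h
    unfolding eps_t_def P.t_def psum_swap_pairs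
    by (rule lift_\<Delta>[OF module_axioms]) (auto intro!: P.lin simp: that)
  have e: "dual_eps_s H \<Delta> \<epsilon> = P.dual_e"
    by (auto simp: fun_eq_iff dual_eps_s_def P.dual_e_def compose_def t)
  have C: "dual_H_s k H \<Delta> \<epsilon> = ?D"
    unfolding dual_H_s_def e ..
  show ?thesis
    unfolding C
  proof (rule sweedler_imp_coalgebra[OF P.coalgebra_dual[OF assms, of \<Delta> \<epsilon>]])
    fix \<psi> assume "\<psi> \<in> carrier ?D"
    note \<psi> = P.dual_e_carrier[OF this]
    note lin = P.dual_lin(1) P.dual_lin(2)[OF \<psi>]
    show "dual_Delta_s k H \<Delta> \<epsilon> \<psi> = psum (tensor k ?D ?D) (pure_tensor k ?D ?D) (map (\<lambda>(a, b). (P.dual_e (P.g' a), P.dual_e (P.conv \<psi> (P.g b)))) (d \<one>\<^bsub>H\<^esub>))"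
      unfolding dual_Delta_s_def Let_def C e psum_swap_pairs psum_map
      by (rule lift_\<Delta>[OF DD])
        (auto intro!: bilinear_mapsI linear_pure_left[OF D D] linear_pure_right[OF D D] lin linear_mapsD(1)[OF lin(1)] linear_mapsD(1)[OF lin(2)]
        simp del: dual_simps image_module_simps
        simp: dual_g_eq(1) dual_g_eq(3) dual_mult(1)[OF \<psi> _] P.g_closed)
  qed
qed

lemma coalgebra_dual_H_t:
  assumes "opcop.rm \<or> opcop.rc"
  shows "coalgebra k (dual_H_t k H \<Delta> \<epsilon>) (dual_Delta_t k H \<Delta> \<epsilon>) (\<lambda>\<psi>. \<psi> \<one>\<^bsub>H\<^esub>)"
proof -
  let ?D = "image_module (dual k H \<Delta> \<epsilon>) opcop.dual_e"
  have D: "module k ?D" by (rule module_image[OF module_dual[OF module_axioms] opcop.dual_e_linear])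
  have DD: "module k (tensor k ?D ?D)" by (rule module_tensor[OF D D])
  have t: "eps_s H \<Delta> \<epsilon> h = opcop.t h" if "h \<in> carrier H" for h
    unfolding eps_s_def opcop.t_def psum_swap_pairs
    by (rule lift_\<Delta>[OF module_axioms]) (auto intro!: opcop.lin simp: that)
  have e: "dual_eps_t H \<Delta> \<epsilon> = opcop.dual_e"
    by (auto simp: fun_eq_iff dual_eps_t_def opcop.dual_e_def compose_def t)
  have C: "dual_H_t k H \<Delta> \<epsilon> = ?D"
    unfolding dual_H_t_def e ..
  show ?thesis
    unfolding C
  proof (rule sweedler_imp_coalgebra[OF sweedler_coalgebra.flip[OF opcop.coalgebra_dual[OF assms, of \<Delta> \<epsilon>]]])
    fix \<psi> assume "\<psi> \<in> carrier ?D"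
    note \<psi> = opcop.dual_e_carrier[OF this]
    note lin = opcop.dual_lin(1) opcop.dual_lin(2)[OF \<psi>]
    show "dual_Delta_t k H \<Delta> \<epsilon> \<psi> = psum (tensor k ?D ?D) (pure_tensor k ?D ?D) (map prod.swap (map (\<lambda>(a, b). (opcop.dual_e (opcop.g' a), opcop.dual_e (opcop.conv \<psi> (opcop.g b)))) (map prod.swap (d \<one>\<^bsub>H\<^esub>))))"
      unfolding dual_Delta_t_def Let_def C e psum_swap_pairs psum_map
      by (rule lift_\<Delta>[OF DD])
        (auto intro!: bilinear_mapsI linear_pure_left[OF D D] linear_pure_right[OF D D] lin linear_mapsD(1)[OF lin(1)] linear_mapsD(1)[OF lin(2)]
        simp del: dual_simps image_module_simps
        simp: dual_g_eq(2) dual_g_eq(4) dual_mult(2)[OF _ \<psi>] opcop.g_closed)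
  qed
qed

lemma coalgebra_dual_bar_H_s:
  assumes "cop.rm \<or> cop.rc"
  shows "coalgebra k (dual_bar_H_s k H \<Delta> \<epsilon>) (dual_bar_Delta_s k H \<Delta> \<epsilon>) (\<lambda>\<psi>. \<psi> \<one>\<^bsub>H\<^esub>)"
proof -
  let ?D = "image_module (dual k H \<Delta> \<epsilon>) cop.dual_e"
  have D: "module k ?D" by (rule module_image[OF module_dual[OF module_axioms] cop.dual_e_linear])
  have DD: "module k (tensor k ?D ?D)" by (rule module_tensor[OF D D])
  have t: "bar_eps_s H \<Delta> \<epsilon> h = cop.t h" if "h \<in> carrier H" for h
    unfolding bar_eps_s_def cop.t_def psum_swap_pairs
    by (rule lift_\<Delta>[OF module_axioms]) (auto intro!: cop.lin simp: that)
  have e: "dual_bar_eps_s H \<Delta> \<epsilon> = cop.dual_e"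
    by (auto simp: fun_eq_iff dual_bar_eps_s_def cop.dual_e_def compose_def t)
  have C: "dual_bar_H_s k H \<Delta> \<epsilon> = ?D"
    unfolding dual_bar_H_s_def e ..
  show ?thesis
    unfolding C
  proof (rule sweedler_imp_coalgebra[OF cop.coalgebra_dual[OF assms, of \<Delta> \<epsilon>]])
    fix \<psi> assume "\<psi> \<in> carrier ?D"
    note \<psi> = cop.dual_e_carrier[OF this]
    note lin = cop.dual_lin(1) cop.dual_lin(2)[OF \<psi>]
    show "dual_bar_Delta_s k H \<Delta> \<epsilon> \<psi> = psum (tensor k ?D ?D) (pure_tensor k ?D ?D) (map (\<lambda>(a, b). (cop.dual_e (cop.g' a), cop.dual_e (cop.conv \<psi> (cop.g b)))) (map prod.swap (d \<one>\<^bsub>H\<^esub>)))"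
      unfolding dual_bar_Delta_s_def Let_def C e psum_swap_pairs psum_map
      by (rule lift_\<Delta>[OF DD])
        (auto intro!: bilinear_mapsI linear_pure_left[OF D D] linear_pure_right[OF D D] lin linear_mapsD(1)[OF lin(1)] linear_mapsD(1)[OF lin(2)]
        simp del: dual_simps image_module_simps
        simp: dual_g_eq(1) dual_g_eq(3) dual_mult(2)[OF _ \<psi>] cop.g_closed)
  qed
qed

lemma coalgebra_dual_bar_H_t:
  assumes "op.rm \<or> op.rc"
  shows "coalgebra k (dual_bar_H_t k H \<Delta> \<epsilon>) (dual_bar_Delta_t k H \<Delta> \<epsilon>) (\<lambda>\<psi>. \<psi> \<one>\<^bsub>H\<^esub>)"
proof -
  let ?D = "image_module (dual k H \<Delta> \<epsilon>) op.dual_e"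
  have D: "module k ?D" by (rule module_image[OF module_dual[OF module_axioms] op.dual_e_linear])
  have DD: "module k (tensor k ?D ?D)" by (rule module_tensor[OF D D])
  have t: "bar_eps_t H \<Delta> \<epsilon> h = op.t h" if "h \<in> carrier H" for h
    unfolding bar_eps_t_def op.t_def psum_swap_pairs
    by (rule lift_\<Delta>[OF module_axioms]) (auto intro!: op.lin simp: that)
  have e: "dual_bar_eps_t H \<Delta> \<epsilon> = op.dual_e"
    by (auto simp: fun_eq_iff dual_bar_eps_t_def op.dual_e_def compose_def t)
  have C: "dual_bar_H_t k H \<Delta> \<epsilon> = ?D"
    unfolding dual_bar_H_t_def e ..
  show ?thesis
    unfolding C
  proof (rule sweedler_imp_coalgebra[OF sweedler_coalgebra.flip[OF op.coalgebra_dual[OF assms, of \<Delta> \<epsilon>]]])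
    fix \<psi> assume "\<psi> \<in> carrier ?D"
    note \<psi> = op.dual_e_carrier[OF this]
    note lin = op.dual_lin(1) op.dual_lin(2)[OF \<psi>]
    show "dual_bar_Delta_t k H \<Delta> \<epsilon> \<psi> = psum (tensor k ?D ?D) (pure_tensor k ?D ?D) (map prod.swap (map (\<lambda>(a, b). (op.dual_e (op.g' a), op.dual_e (op.conv \<psi> (op.g b)))) (d \<one>\<^bsub>H\<^esub>)))"
      unfolding dual_bar_Delta_t_def Let_def C e psum_swap_pairs psum_map
      by (rule lift_\<Delta>[OF DD])
        (auto intro!: bilinear_mapsI linear_pure_left[OF D D] linear_pure_right[OF D D] lin linear_mapsD(1)[OF lin(1)] linear_mapsD(1)[OF lin(2)]
        simp del: dual_simps image_module_simps
        simp: dual_g_eq(2) dual_g_eq(4) dual_mult(1)[OF \<psi> _] op.g_closed)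
  qed
qed

end

theorem proposition1p17:
  fixes k :: "'k ring" and H :: "('k, 'h) module"
    and \<Delta> :: "'h \<Rightarrow> (('h \<times> 'h) \<Rightarrow>\<^sub>0 int) set" and \<epsilon> :: "'h \<Rightarrow> 'k"
  assumes "prebialgebra k H \<Delta> \<epsilon>"
  shows "(axiom_rm k H \<Delta> \<epsilon> \<or> axiom_rc k H \<Delta> \<longrightarrow>
           (\<exists>e. coalgebra k (H_s H \<Delta> \<epsilon>) (Delta_s k H \<Delta> \<epsilon>) e) \<and>
           (\<exists>e. coalgebra k (H_t H \<Delta> \<epsilon>) (Delta_t k H \<Delta> \<epsilon>) e) \<and>
           (\<exists>e. coalgebra k (dual_H_s k H \<Delta> \<epsilon>) (dual_Delta_s k H \<Delta> \<epsilon>) e) \<and>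
           (\<exists>e. coalgebra k (dual_H_t k H \<Delta> \<epsilon>) (dual_Delta_t k H \<Delta> \<epsilon>) e)) \<and>
         (axiom_lm k H \<Delta> \<epsilon> \<or> axiom_lc k H \<Delta> \<longrightarrow>
           (\<exists>e. coalgebra k (bar_H_s H \<Delta> \<epsilon>) (bar_Delta_s k H \<Delta> \<epsilon>) e) \<and>
           (\<exists>e. coalgebra k (bar_H_t H \<Delta> \<epsilon>) (bar_Delta_t k H \<Delta> \<epsilon>) e) \<and>
           (\<exists>e. coalgebra k (dual_bar_H_s k H \<Delta> \<epsilon>) (dual_bar_Delta_s k H \<Delta> \<epsilon>) e) \<and>
           (\<exists>e. coalgebra k (dual_bar_H_t k H \<Delta> \<epsilon>) (dual_bar_Delta_t k H \<Delta> \<epsilon>) e))"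
proof -
  interpret prebialgebra k H \<Delta> \<epsilon> by fact
  obtain d where d: "sweedler_coalgebra k H d \<epsilon>"
    "\<And>c. c \<in> carrier H \<Longrightarrow> \<Delta> c = psum (tensor k H H) (pure_tensor k H H) (d c)"
    using coalgebra_imp_sweedler[OF coalgebra_axioms] by blast
  interpret represented_prebialgebra k H \<Delta> \<epsilon> d
    by (intro represented_prebialgebra.intro represented_prebialgebra_axioms.intro assms d)
  show ?thesis
    using coalgebra_H_s[OF right_axioms(1)] coalgebra_H_t[OF right_axioms(2)]
      coalgebra_dual_H_s[OF right_axioms(1)] coalgebra_dual_H_t[OF right_axioms(2)]
      coalgebra_bar_H_s[OF left_axioms(1)] coalgebra_bar_H_t[OF left_axioms(2)]
      coalgebra_dual_bar_H_s[OF left_axioms(2)] coalgebra_dual_bar_H_t[OF left_axioms(1)]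
    by blast
qed

end
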